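(* Let $J,B,\mathcal{H}$ be the coefficients of a symmetric first order system on $\mathbb{R}$ (see context), and assume that the system is definite on $\mathbb{R}_+=[0,\infty)$ and on $\mathbb{R}_-=(-\infty,0]$. Let $S,S_+,S_-$ (resp. $\mathcal{S},\mathcal{S}_+,\mathcal{S}_-$) be the associated relations on $\mathbb{R},\mathbb{R}_+,\mathbb{R}_-$. Then $$N_\pm(S)=N_\pm(S_+)+N_\pm(S_-)-n,\qquad \mathcal{N}_\pm(\mathcal{S})=\mathcal{N}_\pm(\mathcal{S}_+)+\mathcal{N}_\pm(\mathcal{S}_-)-n .$$
   Context: For an interval $I$ (here $I=\mathbb{R},\mathbb{R}_+,\mathbb{R}_-$), $AC(I,\cdot)$ denotes functions absolutely continuous on compact subintervals of $I$. Standing assumptions: $J\in AC(\mathbb{R},\mathrm{Mat}(n,\mathbb{C}))$, $J(x)^*=-J(x)$, $\det J(x)\neq0$; $B\in L^1_{loc}(\mathbb{R},\mathrm{Mat}(n,\mathbb{C}))$, $B^*=B-J'$; $\mathcal{H}\in L^1_{loc}(\mathbb{R},\mathrm{Mat}(n,\mathbb{C}))$, $\mathcal{H}=\mathcal{H}^*\ge0$. The system is definite on $I$ if $f=0$ is the only $f\in AC(I,\mathbb{C}^n)$ with $Jf'+Bf=0$ and $\mathcal{H}f=0$ a.e. on $I$. $\mathcal{L}^2_{\mathcal H}(I)$: Borel measurable $f:I\to\mathbb{C}^n$ with $\int_I f^*\mathcal{H}f<\infty$, $\langle f,g\rangle_{\mathcal H}=\int_I f^*\mathcal{H}g$; $L^2_{\mathcal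 H}(I)$ is the quotient Hilbert space by $\{\|f\|_{\mathcal H}=0\}$; $\tilde f$ is the class of $f$. The relation ($S$, $S_+$, $S_-$ for $I=\mathbb{R},\mathbb{R}_+,\mathbb{R}_-$) is the closure in $L^2_{\mathcal H}(I)^2$ of the set of $\{\tilde f,\tilde g\}$ with $f\in AC(I,\mathbb{C}^n)$, $g\in\mathcal{L}^2_{\mathcal H}(I)$, both compactly supported in the interior of $I$, and $Jf'+Bf=\mathcal{H}g$ a.e. For a relation $T$, $T^*=\{\{\tilde f,\tilde g\}:\langle \tilde f,\tilde\psi\rangle_{\mathcal H}=\langle\tilde g,\tilde\varphi\rangle_{\mathcal H}\ \forall\{\tilde\varphi,\tilde\psi\}\in T\}$ and $N_\pm(T)=\dim\{\tilde f:\{\tilde f,\pm i\tilde f\}\in T^*\}$. The formal deficiency indices $\mathcal{N}_\pm(\mathcal{S})$, $\mathcal{N}_\pm(\mathcal{S}_+)$, $\mathcal{N}_\pm(\mathcal{S}_-)$ are the dimensions of $\{f\in AC(I,\mathbb{C}^n)\cap\mathcal{L}^2_{\mathcal H}(I): Jf'+Bf=\pm i\mathcal{H}f\}$ for $I=\mathbb{R},\mathbb{R}_+,\mathbb{R}_-$ respectively. *)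

theory Defs
  imports "HOL-Analysis.Analysis" "HOL-Library.Extended_Nat"
begin

definition cinner :: "complex^'n \<Rightarrow> complex^'n \<Rightarrow> complex" where
  "cinner u v = (\<Sum>i\<in>UNIV. cnj (u $ i) * v $ i)"

definition conj_transpose :: "complex^'n^'n \<Rightarrow> complex^'n^'n" where
  "conj_transpose A = map_matrix cnj (transpose A)"

definition pos_semidef :: "complex^'n^'n \<Rightarrow> bool" where
  "pos_semidef A \<longleftrightarrow> conj_transpose A = A \<and> (\<forall>v. 0 \<le> Re (cinner v (A *v v)))"

(* The finite set D lists pairwise non-overlapping intervals [u,v], coded as pairs (u,v). *)
definition abs_continuous_on_interval ::
    "real \<Rightarrow> real \<Rightarrow> (real \<Rightarrow> 'a::real_normed_vector) \<Rightarrow> bool" where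
  "abs_continuous_on_interval a b f \<longleftrightarrow>
     (\<forall>\<epsilon>>0. \<exists>\<delta>>0. \<forall>D. finite D \<longrightarrow>
        (\<forall>(u,v)\<in>D. a \<le> u \<and> u \<le> v \<and> v \<le> b) \<longrightarrow>
        pairwise (\<lambda>p q. disjnt {fst p<..<snd p} {fst q<..<snd q}) D \<longrightarrow>
        (\<Sum>(u,v)\<in>D. v - u) < \<delta> \<longrightarrow> (\<Sum>(u,v)\<in>D. norm (f v - f u)) < \<epsilon>)"

definition AC :: "real set \<Rightarrow> (real \<Rightarrow> 'a::real_normed_vector) set" where
  "AC I = {f. \<forall>a b. a \<le> b \<longrightarrow> {a..b} \<subseteq> I \<longrightarrow> abs_continuous_on_interval a b f}"

definition L1_loc :: "(real \<Rightarrow> 'a::euclidean_space) set" where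
  "L1_loc = {f. \<forall>a b. f absolutely_integrable_on {a..b}}"

definition symmetric_system ::
    "(real \<Rightarrow> complex^'n^'n) \<Rightarrow> (real \<Rightarrow> complex^'n^'n) \<Rightarrow> (real \<Rightarrow> complex^'n^'n) \<Rightarrow> bool" where
  "symmetric_system J B H \<longleftrightarrow>
     J \<in> AC UNIV \<and> (\<forall>x. conj_transpose (J x) = - J x) \<and> (\<forall>x. det (J x) \<noteq> 0) \<and>
     B \<in> L1_loc \<and> (AE x in lebesgue. conj_transpose (B x) = B x - vector_derivative J (at x)) \<and>
     H \<in> L1_loc \<and> (AE x in lebesgue. pos_semidef (H x))"

(* J f' + B f = H g almost everywhere on I.  This is only used for f in AC I, so that the
   derivative exists almost everywhere (on the half-lines the end point 0 is a null set). *)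
definition system_eq ::
    "(real \<Rightarrow> complex^'n^'n) \<Rightarrow> (real \<Rightarrow> complex^'n^'n) \<Rightarrow> (real \<Rightarrow> complex^'n^'n) \<Rightarrow> real set \<Rightarrow>
     (real \<Rightarrow> complex^'n) \<Rightarrow> (real \<Rightarrow> complex^'n) \<Rightarrow> bool" where
  "system_eq J B H I f g \<longleftrightarrow>
     (AE x\<in>I in lebesgue. J x *v vector_derivative f (at x) + B x *v f x = H x *v g x)"

definition definite_on ::
    "(real \<Rightarrow> complex^'n^'n) \<Rightarrow> (real \<Rightarrow> complex^'n^'n) \<Rightarrow> (real \<Rightarrow> complex^'n^'n) \<Rightarrow> real set \<Rightarrow> bool" where
  "definite_on J B H I \<longleftrightarrow>
     (\<forall>f\<in>AC I. system_eq J B H I f (\<lambda>x. 0) \<longrightarrow> (AE x\<in>I in lebesgue. H x *v f x = 0) \<longrightarrow>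
        (\<forall>x\<in>I. f x = 0))"

(* A function I -> C^n is represented by a total function; in the following definitions its
   values outside I are irrelevant. *)
definition L2H :: "(real \<Rightarrow> complex^'n^'n) \<Rightarrow> real set \<Rightarrow> (real \<Rightarrow> complex^'n) set" where
  "L2H H I = {f \<in> borel_measurable (restrict_space borel I).
                set_integrable lebesgue I (\<lambda>x. cinner (f x) (H x *v f x))}"

definition innerH ::
    "(real \<Rightarrow> complex^'n^'n) \<Rightarrow> real set \<Rightarrow> (real \<Rightarrow> complex^'n) \<Rightarrow> (real \<Rightarrow> complex^'n) \<Rightarrow> complex" where
  "innerH H I f g = (LINT x:I|lebesgue. cinner (f x) (H x *v g x))"

definition normH :: "(real \<Rightarrow> complex^'n^'n) \<Rightarrow> real set \<Rightarrow> (real \<Rightarrow> complex^'n) \<Rightarrow> real" where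
  "normH H I f = sqrt (Re (innerH H I f f))"

(* The elements of the quotient Hilbert space are the sets L2_class H I f with f in L2H H I. *)
definition L2_class ::
    "(real \<Rightarrow> complex^'n^'n) \<Rightarrow> real set \<Rightarrow> (real \<Rightarrow> complex^'n) \<Rightarrow> (real \<Rightarrow> complex^'n) set" where
  "L2_class H I f = {g \<in> L2H H I. normH H I (\<lambda>x. g x - f x) = 0}"

type_synonym 'n relation_L2 = "((real \<Rightarrow> complex^'n) set \<times> (real \<Rightarrow> complex^'n) set) set"

definition closure_rel ::
    "(real \<Rightarrow> complex^'n^'n) \<Rightarrow> real set \<Rightarrow> 'n relation_L2 \<Rightarrow> 'n relation_L2" where
  "closure_rel H I T =
     {(L2_class H I f, L2_class H I g) | f g. f \<in> L2H H I \<and> g \<in> L2H H I \<and>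
        (\<forall>\<epsilon>>0. \<exists>\<phi>\<in>L2H H I. \<exists>\<psi>\<in>L2H H I. (L2_class H I \<phi>, L2_class H I \<psi>) \<in> T \<and>
           normH H I (\<lambda>x. f x - \<phi> x) < \<epsilon> \<and> normH H I (\<lambda>x. g x - \<psi> x) < \<epsilon>)}"

definition adjoint_rel ::
    "(real \<Rightarrow> complex^'n^'n) \<Rightarrow> real set \<Rightarrow> 'n relation_L2 \<Rightarrow> 'n relation_L2" where
  "adjoint_rel H I T =
     {(L2_class H I f, L2_class H I g) | f g. f \<in> L2H H I \<and> g \<in> L2H H I \<and>
        (\<forall>\<phi>\<in>L2H H I. \<forall>\<psi>\<in>L2H H I. (L2_class H I \<phi>, L2_class H I \<psi>) \<in> T \<longrightarrow>
           innerH H I f \<psi> = innerH H I g \<phi>)}"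

definition compactly_supported_in_interior :: "real set \<Rightarrow> (real \<Rightarrow> complex^'n) \<Rightarrow> bool" where
  "compactly_supported_in_interior I f \<longleftrightarrow>
     (\<exists>K. compact K \<and> K \<subseteq> interior I \<and> (\<forall>x\<in>I - K. f x = 0))"

definition minimal_rel ::
    "(real \<Rightarrow> complex^'n^'n) \<Rightarrow> (real \<Rightarrow> complex^'n^'n) \<Rightarrow> (real \<Rightarrow> complex^'n^'n) \<Rightarrow> real set \<Rightarrow>
     'n relation_L2" where
  "minimal_rel J B H I = closure_rel H I
     {(L2_class H I f, L2_class H I g) | f g. f \<in> AC I \<and> g \<in> L2H H I \<and>
        compactly_supported_in_interior I f \<and> compactly_supported_in_interior I g \<and>
        system_eq J B H I f g}"

(* Dimension of the complex vector space V/N, for linear subspaces N of V: the supremum of the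
   sizes of finite subsets of V that are linearly independent modulo N. *)
definition quotient_dim ::
    "(real \<Rightarrow> complex^'n) set \<Rightarrow> (real \<Rightarrow> complex^'n) set \<Rightarrow> enat" where
  "quotient_dim V N =
     (SUP F \<in> {F. finite F \<and> F \<subseteq> V \<and>
                 (\<forall>c. (\<lambda>x. \<Sum>f\<in>F. c f *s f x) \<in> N \<longrightarrow> (\<forall>f\<in>F. c f = 0))}. enat (card F))"

(* Dimension of the set of classes {F. (F, zF) in T*}, i.e. of the union of these classes modulo
   the zero class; the deficiency indices are the cases z = i and z = -i. *)
definition deficiency_index ::
    "(real \<Rightarrow> complex^'n^'n) \<Rightarrow> real set \<Rightarrow> complex \<Rightarrow> 'n relation_L2 \<Rightarrow> enat" where
  "deficiency_index H I z T = quotient_dim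
     (\<Union>{L2_class H I f | f. f \<in> L2H H I \<and>
           (L2_class H I f, L2_class H I (\<lambda>x. z *s f x)) \<in> adjoint_rel H I T})
     (L2_class H I (\<lambda>x. 0))"

(* Here functions on I, not classes, are counted, so a function on I is identified with its
   extension by 0; with N = {0}, quotient_dim is the dimension of V itself. *)
definition formal_deficiency_index ::
    "(real \<Rightarrow> complex^'n^'n) \<Rightarrow> (real \<Rightarrow> complex^'n^'n) \<Rightarrow> (real \<Rightarrow> complex^'n^'n) \<Rightarrow> real set \<Rightarrow>
     complex \<Rightarrow> enat" where
  "formal_deficiency_index J B H I z = quotient_dim
     {f. f \<in> AC I \<and> f \<in> L2H H I \<and> system_eq J B H I f (\<lambda>x. z *s f x) \<and> (\<forall>x. x \<notin> I \<longrightarrow> f x = 0)}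
     {\<lambda>x. 0}"

end

theory Submission
  imports Defs
begin

text \<open>
  Let \<open>Im z \<noteq> 0\<close>. A solution of \<open>J f' + B f = z H f\<close> is determined by \<open>f 0\<close>, and the initial values of
  the solutions that are square integrable on \<open>I\<close> form a subspace \<open>V I\<close> of \<open>\<complex>\<^sup>n\<close> with
  \<open>V \<real> = V \<real>\<^sub>+ \<inter> V \<real>\<^sub>-\<close>. The formula for the formal indices is therefore the dimension formula, once
  \<open>V \<real>\<^sub>+ + V \<real>\<^sub>- = \<complex>\<^sup>n\<close> is known. To decompose a vector \<open>v\<close>, take on \<open>[-R, R]\<close> the solution with jump
  \<open>v\<close> at \<open>0\<close> whose values at \<open>R\<close> and \<open>-R\<close> are coupled through a solution for \<open>z = 0\<close>. By Green's
  identity the boundary terms at \<open>R\<close> and \<open>-R\<close> cancel, so that the energy is bounded in terms of \<open>v\<close>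
  and, by definiteness, so is the solution; a compactness argument lets \<open>R \<rightarrow> \<infinity>\<close>.

  For the indices of the relations, an element \<open>{f, z f}\<close> of the adjoint is represented by a solution:
  on a compact interval, \<open>f\<close> minus its orthogonal projection to the solutions is a test function for
  which variation of constants gives an element of the minimal relation. By definiteness this solution is unique.

  Absolutely continuous functions are indefinite integrals by the Radon-Nikodym theorem, applied to the
  positive variation; indefinite integrals are differentiable almost everywhere by Henstock's lemma and
  the Vitali covering lemma.
\<close>

section \<open>Functions of one real variable: differentiation of indefinite integrals\<close>

text \<open>\<open>AC\<close> is an epsilon-delta condition, whereas the system speaks of the total
  operator \<open>vector_derivative\<close>. Lagrange's identity needs the fundamental theorem of
  calculus to connect the two, hence the long preparation.

  The main obstacle is to find enough square integrable solutions on the half-lines although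
  \<open>J x\<close> may have any signature. The coupling at \<open>R\<close> and \<open>-R\<close>
  uses the parameter \<open>0\<close> because it is its own conjugate: the form
  \<open>cinner f (J f)\<close> is then constant along solutions, so it takes the same value at both
  ends. What is left expresses \<open>2 |Im z|\<close> times the energy through boundary terms at
  \<open>0\<close>; with \<open>a = b + v\<close> their part quadratic in \<open>b\<close> drops
  out. Definiteness on one fixed compact interval bounds the energy below by a multiple of
  \<open>|b|^2\<close>, so a linear upper bound against a quadratic lower bound keeps
  \<open>b\<close> bounded independently of \<open>R\<close>.

  For the relations, orthogonality to the solutions for \<open>z\<close> is what lets the
  inhomogeneous equation for \<open>cnj z\<close> have a solution vanishing at both ends of an
  interval; this is why \<open>f\<close> is projected before it is used as a test function.\<close>

lemma has_vector_derivative_indefinite_integral_AE: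
  fixes f :: "real \<Rightarrow> 'a::euclidean_space"
  assumes f: "f integrable_on {a..b}"
  shows "negligible {x\<in>{a<..<b}. \<not> ((\<lambda>u. integral {a..u} f) has_vector_derivative f x) (at x)}"
proof -
  define F where "F u = integral {a..u} f" for u
  \<comment> \<open>If the derivative fails at \<open>x\<close>, then for some fixed
    \<open>m\<close> the relative error exceeds \<open>1 / Suc m\<close> at arbitrarily small
    scales. The bad set is a countable union of such sets, and each can be treated with a fixed
    threshold.\<close>
  define E where "E m = {x\<in>{a<..<b}. \<forall>d>0. \<exists>y\<in>{a<..<b}. 0 < \<bar>y - x\<bar> \<and> \<bar>y - x\<bar> < d \<and>
      norm (F y - F x - (y - x) *\<^sub>R f x) > \<bar>y - x\<bar> / real (Suc m)}" for m
  have sub: "{x\<in>{a<..<b}. \<not> (F has_vector_derivative f x) (at x)} \<subseteq> (\<Union>m. E m)"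
  proof safe
    fix x assume x: "x \<in> {a<..<b}" and nd: "\<not> (F has_vector_derivative f x) (at x)"
    show "x \<in> (\<Union>m. E m)"
    proof (rule ccontr)
      assume c: "x \<notin> (\<Union>m. E m)"
      have "(F has_vector_derivative f x) (at x within UNIV)"
        unfolding has_vector_derivative_def has_derivative_within_alt
      proof (intro conjI allI impI bounded_linear_scaleR_left)
        fix e :: real assume "e > 0"
        then obtain m where m: "1 / real (Suc m) < e"
          by (rule nat_approx_posE)
        from c x obtain d where d: "d > 0" "\<And>y. y\<in>{a<..<b} \<Longrightarrow> 0 < \<bar>y - x\<bar> \<Longrightarrow> \<bar>y - x\<bar> < d \<Longrightarrow>
            norm (F y - F x - (y - x) *\<^sub>R f x) \<le> \<bar>y - x\<bar> / real (Suc m)"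
          unfolding E_def not_le[symmetric] by blast
        show "\<exists>d>0. \<forall>y\<in>UNIV. norm (y - x) < d \<longrightarrow>
            norm (F y - F x - (y - x) *\<^sub>R f x) \<le> e * norm (y - x)"
        proof (intro exI[of _ "min d (min (x - a) (b - x))"] conjI ballI impI)
          show "0 < min d (min (x - a) (b - x))" using d x by auto
          fix y assume y: "norm (y - x) < min d (min (x - a) (b - x))"
          show "norm (F y - F x - (y - x) *\<^sub>R f x) \<le> e * norm (y - x)"
          proof (cases "y = x")
            case False
            have "norm (F y - F x - (y - x) *\<^sub>R f x) \<le> (1 / real (Suc m)) * \<bar>y - x\<bar>"
              using d(2)[of y] y False x by (auto simp: abs_if split: if_splits)
            also have "\<dots> \<le> e * \<bar>y - x\<bar>" using m by (intro mult_right_mono) auto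
            finally show ?thesis by simp
          qed simp
        qed
      qed
      with nd show False by simp
    qed
  qed
  \<comment> \<open>Pick intervals \<open>[x, y x]\<close> with a large error; Henstock's lemma bounds the total length of a
    disjoint subfamily whose fivefold enlargements still cover \<open>E m\<close>.\<close>
  have "negligible (E m)" for m
    unfolding negligible_outer_le
  proof (intro allI impI)
    fix e :: real assume "e > 0"
    \<comment> \<open>The factor \<open>Suc m\<close> turns an error bound into a bound for lengths,
      and \<open>10\<close> is the length of a fivefold enlarged ball per unit of radius.\<close>
    define e' where "e' = e / (10 * real (Suc m))"
    have e'_eq: "e' * real (Suc m) = e / 10" unfolding e'_def by (simp del: of_nat_Suc)
    have e': "e' > 0" unfolding e'_def using \<open>e > 0\<close> by simp
    obtain \<gamma> where \<gamma>: "gauge \<gamma>"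
      and H: "\<And>p. \<lbrakk>p tagged_partial_division_of (cbox a b); \<gamma> fine p\<rbrakk> \<Longrightarrow>
             sum (\<lambda>(x,k). norm(measure lborel k *\<^sub>R f x - integral k f)) p < e'"
      using f by (auto intro: Henstock_lemma[of f a b, OF _ e'])
    have "\<exists>y. y\<in>{a<..<b} \<and> 0 < \<bar>y - x\<bar> \<and> \<bar>y - x\<bar> < 1 \<and> cball x \<bar>y - x\<bar> \<subseteq> \<gamma> x \<and>
      norm (F y - F x - (y - x) *\<^sub>R f x) > \<bar>y - x\<bar> / real (Suc m)" if xE: "x \<in> E m" for x
    proof -
      obtain d where d: "d > 0" "ball x d \<subseteq> \<gamma> x"
        using \<gamma> unfolding gauge_def by (meson openE)
      obtain y where "y\<in>{a<..<b}" "0 < \<bar>y - x\<bar>" "\<bar>y - x\<bar> < min d 1"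
        "norm (F y - F x - (y - x) *\<^sub>R f x) > \<bar>y - x\<bar> / real (Suc m)"
        using xE \<open>d > 0\<close> unfolding E_def mem_Collect_eq
        by (metis (no_types, lifting) min_less_iff_conj zero_less_one)
      moreover have "cball x \<bar>y - x\<bar> \<subseteq> ball x d" using \<open>\<bar>y - x\<bar> < min d 1\<close> by auto
      ultimately show ?thesis using d by (intro exI[of _ y]) auto
    qed
    then obtain y where y: "\<And>x. x \<in> E m \<Longrightarrow> y x\<in>{a<..<b}" "\<And>x. x \<in> E m \<Longrightarrow> 0 < \<bar>y x - x\<bar>"
       "\<And>x. x \<in> E m \<Longrightarrow> \<bar>y x - x\<bar> < 1" "\<And>x. x \<in> E m \<Longrightarrow> cball x \<bar>y x - x\<bar> \<subseteq> \<gamma> x"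
       "\<And>x. x \<in> E m \<Longrightarrow> norm (F (y x) - F x - (y x - x) *\<^sub>R f x) > \<bar>y x - x\<bar> / real (Suc m)"
      by metis
    have cov: "E m \<subseteq> (\<Union>i\<in>E m. cball i \<bar>y i - i\<bar>)" by auto
    have rad: "0 < \<bar>y i - i\<bar> \<and> \<bar>y i - i\<bar> \<le> 1" if "i \<in> E m" for i
      using y(2,3)[OF that] by simp
    obtain C where C: "countable C" "C \<subseteq> E m"
      "pairwise (\<lambda>i j. disjnt (cball i \<bar>y i - i\<bar>) (cball j \<bar>y j - j\<bar>)) C"
      "E m \<subseteq> (\<Union>i\<in>C. cball i (5 * \<bar>y i - i\<bar>))"
      using Vitali_covering_lemma_cballs[OF cov rad] by blast
    have bound: "measure lebesgue (\<Union>i\<in>C'. cball i (5 * \<bar>y i - i\<bar>)) \<le> e" if C': "C' \<subseteq> C" "finite C'" for C'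
    proof -
      define k where "k x = {min x (y x)..max x (y x)}" for x
      define p where "p = (\<lambda>x. (x, k x)) ` C'"
      have CE: "x \<in> E m" if "x \<in> C'" for x using that C' C by auto
      have inab: "x \<in> {a<..<b}" if "x \<in> E m" for x using that E_def by auto
      have kc: "k x \<subseteq> cball x \<bar>y x - x\<bar>" for x unfolding k_def by (auto simp: dist_real_def)
      have p: "p tagged_partial_division_of cbox a b"
        unfolding tagged_partial_division_of_def
      proof (intro conjI allI impI)
        show "finite p" using C' p_def by simp
        fix x K assume xK: "(x, K) \<in> p"
        then have x: "x \<in> E m" "K = k x" using CE by (auto simp: p_def)
        show "x \<in> K" using x by (auto simp: k_def)
        show "K \<subseteq> cbox a b" using inab[OF x(1)] y(1)[OF x(1)] x(2) by (auto simp: k_def)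
        show "\<exists>a b. K = cbox a b" using x(2) k_def by auto
      next
        fix x1 K1 x2 K2 assume as: "(x1, K1) \<in> p \<and> (x2, K2) \<in> p \<and> (x1, K1) \<noteq> (x2, K2)"
        then have *: "x1 \<in> C" "x2 \<in> C" "x1 \<noteq> x2" "K1 = k x1" "K2 = k x2" using C' by (auto simp: p_def)
        then have "disjnt (cball x1 \<bar>y x1 - x1\<bar>) (cball x2 \<bar>y x2 - x2\<bar>)" using C(3) by (auto simp: pairwise_def)
        then have "K1 \<inter> K2 = {}" using kc[of x1] kc[of x2] * by (auto simp: disjnt_def)
        then show "interior K1 \<inter> interior K2 = {}" using interior_subset by blast
      qed
      have fine: "\<gamma> fine p" unfolding fine_def p_def using kc y(4) CE by (auto; blast)
      have eq: "norm (measure lborel (k x) *\<^sub>R f x - integral (k x) f) = norm (F (y x) - F x - (y x - x) *\<^sub>R f x)"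
        if x: "x \<in> E m" for x
      proof -
        have Fd: "F v - F u = integral {u..v} f" if "a \<le> u" "u \<le> v" "v \<le> b" for u v
          using Henstock_Kurzweil_Integration.integral_combine[of a u v f] that
            integrable_subinterval_real[OF f, of a v] unfolding F_def by (auto simp: algebra_simps)
        show ?thesis
        proof (cases "x \<le> y x")
          case True
          then have "integral (k x) f = F (y x) - F x" using Fd[of x "y x"] inab[OF x] y(1)[OF x]
            by (auto simp: k_def)
          then show ?thesis using True by (simp add: k_def norm_minus_commute)
        next
          case False
          then have "integral (k x) f = F x - F (y x)" using Fd[of "y x" x] inab[OF x] y(1)[OF x]
            by (auto simp: k_def)
          moreover have "measure lborel (k x) = x - y x" using False by (simp add: k_def)
          moreover have "(x - y x) *\<^sub>R f x - (F x - F (y x)) = F (y x) - F x - (y x - x) *\<^sub>R f x"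
            by (simp add: algebra_simps)
          ultimately show ?thesis by metis
        qed
      qed
      have inj: "inj_on (\<lambda>x. (x, k x)) C'" by (auto simp: inj_on_def)
      have "(\<Sum>x\<in>C'. \<bar>y x - x\<bar> / real (Suc m)) \<le> (\<Sum>x\<in>C'. norm (measure lborel (k x) *\<^sub>R f x - integral (k x) f))"
        using y(5) CE by (intro sum_mono) (simp add: eq less_imp_le)
      also have "\<dots> = sum (\<lambda>(x,k). norm(measure lborel k *\<^sub>R f x - integral k f)) p"
        unfolding p_def by (simp add: sum.reindex[OF inj])
      also have "\<dots> < e'" by (rule H[OF p fine])
      finally have s: "(\<Sum>x\<in>C'. \<bar>y x - x\<bar>) < e' * real (Suc m)"
        unfolding sum_divide_distrib[symmetric] by (simp add: field_simps)
      have "measure lebesgue (\<Union>i\<in>C'. cball i (5 * \<bar>y i - i\<bar>)) \<le> (\<Sum>i\<in>C'. measure lebesgue (cball i (5 * \<bar>y i - i\<bar>)))"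
        by (rule measure_UNION_le) (use C' in auto)
      also have "\<dots> = (\<Sum>i\<in>C'. 10 * \<bar>y i - i\<bar>)"
        by (intro sum.cong refl) (simp add: cball_eq_atLeastAtMost)
      also have "\<dots> = 10 * (\<Sum>i\<in>C'. \<bar>y i - i\<bar>)" by (simp add: sum_distrib_left)
      also have "\<dots> \<le> e" using s e'_eq by simp
      finally show ?thesis .
    qed
    show "\<exists>T. E m \<subseteq> T \<and> T \<in> lmeasurable \<and> measure lebesgue T \<le> e"
    proof (intro exI conjI)
      show "E m \<subseteq> (\<Union>i\<in>C. cball i (5 * \<bar>y i - i\<bar>))" by (rule C)
      show "(\<Union>i\<in>C. cball i (5 * \<bar>y i - i\<bar>)) \<in> lmeasurable"
        by (rule fmeasurable_UN_bound[OF C(1) _ bound]) auto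
      show "measure lebesgue (\<Union>i\<in>C. cball i (5 * \<bar>y i - i\<bar>)) \<le> e"
        by (rule measure_UN_bound[OF C(1) _ bound]) auto
    qed
  qed
  then have "negligible (\<Union>m. E m)" by (rule negligible_Union_nat)
  then show ?thesis using sub negligible_subset unfolding F_def by blast
qed

section \<open>Absolutely continuous functions\<close>

definition nonoverlapping :: "real \<Rightarrow> real \<Rightarrow> (real \<times> real) set \<Rightarrow> bool" where
  "nonoverlapping a b D \<longleftrightarrow> finite D \<and> (\<forall>(u,v)\<in>D. a \<le> u \<and> u \<le> v \<and> v \<le> b) \<and>
     pairwise (\<lambda>p q. disjnt {fst p<..<snd p} {fst q<..<snd q}) D"

abbreviation total_length :: "(real \<times> real) set \<Rightarrow> real" where
  "total_length D \<equiv> \<Sum>(u,v)\<in>D. v - u"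

abbreviation increment :: "(real \<Rightarrow> 'a::ab_group_add) \<Rightarrow> (real \<times> real) set \<Rightarrow> 'a" where
  "increment f D \<equiv> \<Sum>(u,v)\<in>D. f v - f u"

abbreviation variation :: "(real \<Rightarrow> 'a::real_normed_vector) \<Rightarrow> (real \<times> real) set \<Rightarrow> real" where
  "variation f D \<equiv> \<Sum>(u,v)\<in>D. norm (f v - f u)"

lemma abs_continuous_alt:
  "abs_continuous_on_interval a b f \<longleftrightarrow>
     (\<forall>\<epsilon>>0. \<exists>\<delta>>0. \<forall>D. nonoverlapping a b D \<longrightarrow>
        total_length D < \<delta> \<longrightarrow> variation f D < \<epsilon>)"
  unfolding abs_continuous_on_interval_def nonoverlapping_def imp_conjL ..

lemma nonoverlapping_subset: "nonoverlapping a b D \<Longrightarrow> D' \<subseteq> D \<Longrightarrow> nonoverlapping a b D'"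
  unfolding nonoverlapping_def by (auto intro: finite_subset pairwise_subset)

lemma nonoverlapping_mono: "nonoverlapping a b D \<Longrightarrow> a' \<le> a \<Longrightarrow> b \<le> b' \<Longrightarrow> nonoverlapping a' b' D"
  unfolding nonoverlapping_def by force

lemma nonoverlapping_unique:
  assumes "nonoverlapping a b D" "p \<in> D" "q \<in> D" "fst p < x" "x < snd p" "fst q < x" "x < snd q"
  shows "p = q"
proof (rule ccontr)
  assume "p \<noteq> q"
  then have "{fst p<..<snd p} \<inter> {fst q<..<snd q} = {}"
    using assms(1-3) unfolding nonoverlapping_def pairwise_def disjnt_def by blast
  then show False using assms(4-7) by (simp add: set_eq_iff)
qed

text \<open>A point lies in the interior of at most one interval, so the restrictions of
  \<open>h\<close> to the open intervals add up to at most \<open>h\<close>. Shared end points do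
  not affect the integrals.\<close>

lemma sum_integral_nonoverlapping_le:
  fixes h :: "real \<Rightarrow> real"
  assumes D: "nonoverlapping a b D" and h: "h integrable_on {a..b}" and pos: "\<And>x. x \<in> {a..b} \<Longrightarrow> 0 \<le> h x"
  shows "(\<Sum>(u,v)\<in>D. integral {u..v} h) \<le> integral {a..b} h"
proof -
  define G where "G p x = (if x \<in> {fst p<..<snd p} then h x else 0)" for p :: "real \<times> real" and x
  have fin: "finite D" using D by (simp add: nonoverlapping_def)
  have hi: "(G p has_integral integral {fst p..snd p} h) {a..b}" if "p \<in> D" for p
  proof -
    have p: "a \<le> fst p" "fst p \<le> snd p" "snd p \<le> b" using D that by (auto simp: nonoverlapping_def)
    have "h integrable_on {fst p..snd p}"
      by (rule integrable_subinterval_real[OF h]) (use p in auto)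
    then have "(h has_integral integral {fst p..snd p} h) {fst p<..<snd p}"
      by (simp add: has_integral_Icc_iff_Ioo[symmetric] integrable_integral)
    then show ?thesis
      unfolding G_def by (subst has_integral_restrict) (use p in auto)
  qed
  have "((\<lambda>x. \<Sum>p\<in>D. G p x) has_integral (\<Sum>p\<in>D. integral {fst p..snd p} h)) {a..b}"
    by (rule has_integral_sum[OF fin hi])
  moreover have "(\<Sum>p\<in>D. G p x) \<le> h x" if x: "x \<in> {a..b}" for x
  proof (cases "\<exists>p\<in>D. x \<in> {fst p<..<snd p}")
    case True
    then obtain p where p: "p \<in> D" "x \<in> {fst p<..<snd p}" by blast
    have "(\<Sum>q\<in>D. G q x) = (\<Sum>q\<in>{p}. G q x)"
    proof (rule sum.mono_neutral_right)
      show "\<forall>q\<in>D - {p}. G q x = 0"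
        using nonoverlapping_unique[OF D p(1)] p(2) unfolding G_def by (metis DiffE greaterThanLessThan_iff singletonI)
    qed (use fin p in auto)
    also have "\<dots> = h x" using p by (simp add: G_def)
    finally show ?thesis by simp
  next
    case False
    then have "(\<Sum>q\<in>D. G q x) = 0" by (intro sum.neutral) (auto simp: G_def)
    then show ?thesis using pos[OF x] by simp
  qed
  ultimately have "(\<Sum>p\<in>D. integral {fst p..snd p} h) \<le> integral {a..b} h"
    by (rule has_integral_le[OF _ integrable_integral[OF h]])
  then show ?thesis by (simp add: case_prod_beta)
qed

lemma nonoverlapping_length_le: "nonoverlapping a b D \<Longrightarrow> a \<le> b \<Longrightarrow> total_length D \<le> b - a"
proof -
  assume D: "nonoverlapping a b D" and "a \<le> b"
  have "total_length D = (\<Sum>(u,v)\<in>D. integral {u..v} (\<lambda>_. 1::real))"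
    by (intro sum.cong refl) (use D in \<open>auto simp: nonoverlapping_def\<close>)
  also have "\<dots> \<le> integral {a..b} (\<lambda>_. 1::real)"
    by (rule sum_integral_nonoverlapping_le[OF D]) auto
  finally show ?thesis using \<open>a \<le> b\<close> by simp
qed

text \<open>By truncation: for large \<open>k\<close> the part of \<open>norm g\<close> above the
  level \<open>k\<close> has small integral over all of \<open>{a..b}\<close>, while the part below
  contributes at most \<open>k\<close> times the total length.\<close>

lemma abs_continuous_indefinite_integral:
  fixes g :: "real \<Rightarrow> 'a::euclidean_space"
  assumes g: "g absolutely_integrable_on {a..b}"
    and F: "\<And>u v. a \<le> u \<Longrightarrow> u \<le> v \<Longrightarrow> v \<le> b \<Longrightarrow> F v - F u = integral {u..v} g"
  shows "abs_continuous_on_interval a b F"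
  unfolding abs_continuous_alt
proof (intro allI impI)
  fix e :: real assume "e > 0"
  define n where "n x = norm (g x)" for x
  define t where "t k x = min (n x) (real k)" for k :: nat and x
  have n: "n integrable_on {a..b}" using g unfolding n_def absolutely_integrable_on_def by simp
  have nabs: "n absolutely_integrable_on {a..b}"
    using g unfolding n_def by (rule set_integrable_norm)
  have t: "t k integrable_on {a..b}" for k
    unfolding t_def using absolutely_integrable_min[OF nabs, of "\<lambda>_. real k"]
      absolutely_integrable_imp_integrable by (auto simp: absolutely_integrable_on_def)
  have "(\<lambda>k. integral {a..b} (\<lambda>x. n x - t k x)) \<longlonglongrightarrow> integral {a..b} (\<lambda>x. 0)"
  proof (rule dominated_convergence(2)[where h=n])
    show "(\<lambda>x. n x - t k x) integrable_on {a..b}" for k using integrable_diff[OF n t] .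
    show "n integrable_on {a..b}" by (rule n)
    show "norm (n x - t k x) \<le> n x" for k x by (auto simp: t_def n_def)
    show "(\<lambda>k. n x - t k x) \<longlonglongrightarrow> 0" for x
    proof (rule tendsto_eventually)
      obtain K where "n x \<le> real K" using real_arch_simple by blast
      then show "\<forall>\<^sub>F k in sequentially. n x - t k x = 0"
        unfolding eventually_sequentially by (intro exI[of _ K]) (auto simp: t_def)
    qed
  qed
  then have "\<forall>\<^sub>F k in sequentially. integral {a..b} (\<lambda>x. n x - t k x) < e / 2"
    using \<open>e > 0\<close> by (intro order_tendstoD) auto
  then obtain k where k: "integral {a..b} (\<lambda>x. n x - t k x) < e / 2"
    unfolding eventually_sequentially by blast
  \<comment> \<open>\<open>Suc k\<close> instead of \<open>k\<close> keeps the divisor positive when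
    \<open>k = 0\<close>.\<close>
  define d where "d = e / (2 * real (Suc k))"
  show "\<exists>d>0. \<forall>D. nonoverlapping a b D \<longrightarrow> total_length D < d \<longrightarrow> variation F D < e"
  proof (intro exI[of _ d] conjI allI impI)
    show "d > 0" using \<open>e > 0\<close> by (simp add: d_def)
    fix D assume D: "nonoverlapping a b D" and len: "total_length D < d"
    have "norm (F v - F u) \<le> real (Suc k) * (v - u) + integral {u..v} (\<lambda>x. n x - t k x)" if "(u,v) \<in> D" for u v
    proof -
      have uv: "a \<le> u" "u \<le> v" "v \<le> b" using D that by (auto simp: nonoverlapping_def)
      then have sub: "{u..v} \<subseteq> {a..b}" by auto
      have i: "g integrable_on {u..v}" "n integrable_on {u..v}" "t k integrable_on {u..v}"
        using integrable_subinterval_real[OF _ sub] n t g by (auto simp: absolutely_integrable_on_def)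
      have "norm (F v - F u) \<le> integral {u..v} n"
        unfolding F[OF uv] by (rule integral_norm_bound_integral[OF i(1,2)]) (simp add: n_def)
      also have "\<dots> = integral {u..v} (t k) + integral {u..v} (\<lambda>x. n x - t k x)"
        using integral_diff[OF i(2,3)] by simp
      also have "integral {u..v} (t k) \<le> integral {u..v} (\<lambda>_. real (Suc k))"
        by (rule integral_le[OF i(3)]) (auto simp: t_def)
      finally show ?thesis using uv by (simp add: mult.commute)
    qed
    then have "variation F D \<le>
       (\<Sum>(u,v)\<in>D. real (Suc k) * (v - u) + integral {u..v} (\<lambda>x. n x - t k x))"
      by (intro sum_mono) auto
    also have "\<dots> = real (Suc k) * total_length D + (\<Sum>(u,v)\<in>D. integral {u..v} (\<lambda>x. n x - t k x))"
      by (simp add: case_prod_beta sum.distrib sum_distrib_left)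
    also have "(\<Sum>(u,v)\<in>D. integral {u..v} (\<lambda>x. n x - t k x)) \<le> integral {a..b} (\<lambda>x. n x - t k x)"
      by (rule sum_integral_nonoverlapping_le[OF D integrable_diff[OF n t]]) (auto simp: t_def)
    also have "real (Suc k) * total_length D < real (Suc k) * d"
      using len by (intro mult_strict_left_mono) auto
    also have "real (Suc k) * d = e / 2" unfolding d_def by (simp del: of_nat_Suc)
    finally show "variation F D < e" using k by simp
  qed
qed

text \<open>An interior point of a piece is interior to the interval it was cut from and so
  identifies that interval; this gives injectivity and disjointness. Nondegenerate pieces are
  required because distinct intervals could shrink to the same point.\<close>

lemma nonoverlapping_shrink:
  assumes E: "nonoverlapping a b E" and S: "S \<subseteq> E"
    and h: "\<And>p. p \<in> S \<Longrightarrow> fst p \<le> fst (h p) \<and> fst (h p) < snd (h p) \<and> snd (h p) \<le> snd p \<and>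
      c \<le> fst (h p) \<and> snd (h p) \<le> d"
  shows "inj_on h S" "nonoverlapping c d (h ` S)"
proof -
  have same: "p = q" if "p \<in> S" "q \<in> S" "fst (h p) < t" "t < snd (h p)" "fst (h q) < t" "t < snd (h q)" for p q t
    by (rule nonoverlapping_unique[OF E, of p q t]) (use S h[OF that(1)] h[OF that(2)] that in auto)
  show "inj_on h S"
  proof (rule inj_onI)
    fix p q assume pq: "p \<in> S" "q \<in> S" "h p = h q"
    show "p = q"
      by (rule same[OF pq(1,2), of "(fst (h p) + snd (h p)) / 2"]) (use h[OF pq(1)] pq(3) in auto)
  qed
  show "nonoverlapping c d (h ` S)"
    unfolding nonoverlapping_def
  proof (intro conjI)
    show "finite (h ` S)" using E S by (auto simp: nonoverlapping_def intro: finite_subset)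
    show "\<forall>(u, v)\<in>h ` S. c \<le> u \<and> u \<le> v \<and> v \<le> d"
    proof
      fix r assume "r \<in> h ` S"
      then obtain p where "p \<in> S" "r = h p" by blast
      then show "case r of (u, v) \<Rightarrow> c \<le> u \<and> u \<le> v \<and> v \<le> d" using h[of p] by (simp add: case_prod_beta)
    qed
    show "pairwise (\<lambda>p q. disjnt {fst p<..<snd p} {fst q<..<snd q}) (h ` S)"
      unfolding pairwise_def disjnt_def
    proof (intro ballI impI)
      fix r s assume "r \<in> h ` S" "s \<in> h ` S" "r \<noteq> s"
      then obtain p q where pq: "p \<in> S" "q \<in> S" "r = h p" "s = h q" "p \<noteq> q" by blast
      then show "{fst r<..<snd r} \<inter> {fst s<..<snd s} = {}"
        using same[OF pq(1,2)] by (simp only: disjoint_iff greaterThanLessThan_iff) blast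
    qed
  qed
qed

text \<open>Every interval is cut at \<open>y\<close>: one that contains \<open>y\<close> in its
  interior leaves a piece on each side, and its increment telescopes through
  \<open>f y\<close>.\<close>

lemma nonoverlapping_split:
  fixes f :: "real \<Rightarrow> 'a::ab_group_add"
  assumes D: "nonoverlapping x z D" and y: "x \<le> y" "y \<le> z"
  obtains D1 D2 where "nonoverlapping x y D1" "nonoverlapping y z D2"
    "increment f D = increment f D1 + increment f D2"
proof -
  \<comment> \<open>Pairs \<open>(u,u)\<close> are admissible but contribute nothing; they are
    dropped because \<open>nonoverlapping_shrink\<close> works with nondegenerate pieces.\<close>
  define E where "E = {p\<in>D. fst p < snd p}"
  have E: "nonoverlapping x z E" using D by (rule nonoverlapping_subset) (auto simp: E_def)
  have finE: "finite E" using E by (simp add: nonoverlapping_def)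
  have bE: "x \<le> fst p" "fst p < snd p" "snd p \<le> z" if "p \<in> E" for p
    using D that by (auto simp: nonoverlapping_def E_def case_prod_beta)
  define E1 where "E1 = {p\<in>E. fst p < y}"
  define E2 where "E2 = {p\<in>E. y < snd p}"
  define h1 where "h1 p = (fst p, min (snd p) y)" for p :: "real \<times> real"
  define h2 where "h2 p = (max (fst p) y, snd p)" for p :: "real \<times> real"
  have "E1 \<subseteq> E" "\<And>p. p \<in> E1 \<Longrightarrow> fst p \<le> fst (h1 p) \<and> fst (h1 p) < snd (h1 p) \<and> snd (h1 p) \<le> snd p \<and>
      x \<le> fst (h1 p) \<and> snd (h1 p) \<le> y"
    using bE by (auto simp: E1_def h1_def)
  note 1 = nonoverlapping_shrink[OF E this]
  have "E2 \<subseteq> E" "\<And>p. p \<in> E2 \<Longrightarrow> fst p \<le> fst (h2 p) \<and> fst (h2 p) < snd (h2 p) \<and> snd (h2 p) \<le> snd p \<and>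
      y \<le> fst (h2 p) \<and> snd (h2 p) \<le> z"
    using bE by (auto simp: E2_def h2_def)
  note 2 = nonoverlapping_shrink[OF E this]
  show thesis
  proof (rule that[OF 1(2) 2(2)])
    have "increment f D = increment f E"
    proof (rule sum.mono_neutral_right)
      show "finite D" "E \<subseteq> D" using D by (auto simp: nonoverlapping_def E_def)
      show "\<forall>p\<in>D - E. (case p of (u,v) \<Rightarrow> f v - f u) = 0"
      proof
        fix p assume "p \<in> D - E"
        then have "fst p = snd p" using D by (auto simp: nonoverlapping_def E_def case_prod_beta)
        then show "(case p of (u,v) \<Rightarrow> f v - f u) = 0" by (simp add: case_prod_beta)
      qed
    qed
    also have "\<dots> = (\<Sum>p\<in>E. (if fst p < y then f (snd (h1 p)) - f (fst (h1 p)) else 0) +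
        (if y < snd p then f (snd (h2 p)) - f (fst (h2 p)) else 0))"
    proof (intro sum.cong refl)
      fix p assume "p \<in> E"
      then have "fst p < snd p" by (simp add: E_def)
      then show "(case p of (u,v) \<Rightarrow> f v - f u) = (if fst p < y then f (snd (h1 p)) - f (fst (h1 p)) else 0) +
        (if y < snd p then f (snd (h2 p)) - f (fst (h2 p)) else 0)"
        by (cases p; cases "snd p \<le> y"; cases "y \<le> fst p") (simp_all add: h1_def h2_def)
    qed
    also have "\<dots> = (\<Sum>p\<in>E1. f (snd (h1 p)) - f (fst (h1 p))) + (\<Sum>p\<in>E2. f (snd (h2 p)) - f (fst (h2 p)))"
      unfolding sum.distrib E1_def E2_def by (simp add: sum.inter_filter[OF finE])
    also have "\<dots> = (\<Sum>(u,v)\<in>h1 ` E1. f v - f u) + (\<Sum>(u,v)\<in>h2 ` E2. f v - f u)"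
      by (simp add: sum.reindex[OF 1(1)] sum.reindex[OF 2(1)] case_prod_beta)
    finally show "increment f D = (\<Sum>(u,v)\<in>h1 ` E1. f v - f u) + (\<Sum>(u,v)\<in>h2 ` E2. f v - f u)" .
  qed
qed

text \<open>A single Lipschitz-type estimate from which differences, products, linear images,
  exponentials and pointwise equal functions inherit absolute continuity. Since \<open>C\<close> may
  have any sign, the proof works with \<open>\<bar>C\<bar> + 1\<close>.\<close>

lemma abs_continuous_dominated:
  assumes f: "abs_continuous_on_interval a b f" and g: "abs_continuous_on_interval a b g"
    and F: "\<And>u v. u \<in> {a..b} \<Longrightarrow> v \<in> {a..b} \<Longrightarrow> norm (F v - F u) \<le> C * (norm (f v - f u) + norm (g v - g u))"
  shows "abs_continuous_on_interval a b F"
  unfolding abs_continuous_alt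
proof (intro allI impI)
  fix e :: real assume "e > 0"
  define c where "c = e / (2 * (\<bar>C\<bar> + 1))"
  have c: "c > 0" using \<open>e > 0\<close> by (simp add: c_def)
  have "K * (e / (2 * K) + e / (2 * K)) = e" if "K > 0" for K :: real using that by (simp add: field_simps)
  from this[of "\<bar>C\<bar> + 1"] have c_eq: "(\<bar>C\<bar> + 1) * (c + c) = e" unfolding c_def by simp
  obtain d1 where d1: "d1 > 0" "\<And>D. nonoverlapping a b D \<Longrightarrow> total_length D < d1 \<Longrightarrow> variation f D < c"
    using f c unfolding abs_continuous_alt by meson
  obtain d2 where d2: "d2 > 0" "\<And>D. nonoverlapping a b D \<Longrightarrow> total_length D < d2 \<Longrightarrow> variation g D < c"
    using g c unfolding abs_continuous_alt by meson
  show "\<exists>d>0. \<forall>D. nonoverlapping a b D \<longrightarrow> total_length D < d \<longrightarrow> variation F D < e"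
  proof (intro exI[of _ "min d1 d2"] conjI allI impI)
    fix D assume D: "nonoverlapping a b D" "total_length D < min d1 d2"
    have "variation F D \<le> (\<Sum>(u,v)\<in>D. (\<bar>C\<bar> + 1) * (norm (f v - f u) + norm (g v - g u)))"
    proof (intro sum_mono)
      fix p assume p: "p \<in> D"
      then have "fst p \<in> {a..b}" "snd p \<in> {a..b}" using D(1) by (auto simp: nonoverlapping_def case_prod_beta)
      then have "norm (F (snd p) - F (fst p)) \<le> C * (norm (f (snd p) - f (fst p)) + norm (g (snd p) - g (fst p)))"
        by (rule F)
      also have "\<dots> \<le> (\<bar>C\<bar> + 1) * (norm (f (snd p) - f (fst p)) + norm (g (snd p) - g (fst p)))"
        by (intro mult_right_mono) auto
      finally show "(case p of (u,v) \<Rightarrow> norm (F v - F u)) \<le> (case p of (u,v) \<Rightarrow> (\<bar>C\<bar> + 1) * (norm (f v - f u) + norm (g v - g u)))"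
        by (simp add: case_prod_beta)
    qed
    also have "\<dots> = (\<bar>C\<bar> + 1) * (variation f D + variation g D)"
      by (simp add: case_prod_beta sum.distrib sum_distrib_left distrib_left)
    also have "\<dots> < (\<bar>C\<bar> + 1) * (c + c)"
      using d1(2)[OF D(1)] d2(2)[OF D(1)] D(2) by (intro mult_strict_left_mono) auto
    also have "\<dots> = e" by (rule c_eq)
    finally show "variation F D < e" .
  qed (use d1 d2 in auto)
qed

section \<open>Positive variation and its absolute continuity\<close>

definition positive_variation :: "(real \<Rightarrow> real) \<Rightarrow> real \<Rightarrow> real \<Rightarrow> real" where
  "positive_variation f a b = (SUP D\<in>{D. nonoverlapping a b D}. \<Sum>(u,v)\<in>D. f v - f u)"

lemma nonoverlapping_empty: "nonoverlapping a b {}"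
  by (simp add: nonoverlapping_def)

lemma nonoverlapping_singleton: "a \<le> u \<Longrightarrow> u \<le> v \<Longrightarrow> v \<le> b \<Longrightarrow> nonoverlapping a b {(u,v)}"
  by (simp add: nonoverlapping_def)

text \<open>On an interval shorter than \<open>d\<close> every family has variation below 1, and
  \<open>{a..b}\<close> is a union of finitely many such intervals; families are cut along
  them.\<close>

lemma abs_continuous_bounded_sums:
  fixes f :: "real \<Rightarrow> real"
  assumes f: "abs_continuous_on_interval a b f"
  shows "\<exists>C. \<forall>D. nonoverlapping a b D \<longrightarrow> increment f D \<le> C"
proof -
  obtain d where d: "d > 0" "\<And>D. nonoverlapping a b D \<Longrightarrow> total_length D < d \<Longrightarrow> variation f D < 1"
    using f unfolding abs_continuous_alt by (meson zero_less_one)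
  have main: "x \<le> y \<Longrightarrow> a \<le> x \<Longrightarrow> y \<le> b \<Longrightarrow> y - x < real n * (d/2) \<Longrightarrow> nonoverlapping x y D \<Longrightarrow> increment f D \<le> real n" for n x y D
  proof (induction n arbitrary: y D)
    case 0
    then show ?case by simp
  next
    case (Suc n)
    \<comment> \<open>Splits off the last stretch of length at most \<open>d/2\<close>, which is
      strictly shorter than \<open>d\<close>; \<open>max\<close> covers the case that all of
      \<open>{x..y}\<close> is that short.\<close>
    define m where "m = max x (y - d/2)"
    have m: "x \<le> m" "m \<le> y" "y - m < d" using Suc.prems d(1) by (auto simp: m_def)
    obtain D1 D2 where D12: "nonoverlapping x m D1" "nonoverlapping m y D2"
      "increment f D = increment f D1 + increment f D2"
      using nonoverlapping_split[OF Suc.prems(5) m(1,2)] by metis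
    have "increment f D1 \<le> real n"
    proof (cases "m = x")
      case True
      have "fst p = snd p" if "p \<in> D1" for p
        using D12(1) that True by (auto simp: nonoverlapping_def case_prod_beta)
      then have "increment f D1 = 0" by (intro sum.neutral) (auto simp: case_prod_beta)
      then show ?thesis by simp
    next
      case False
      then have "m = y - d/2" by (auto simp: m_def max_def split: if_splits)
      then have "m - x < real n * (d/2)" using Suc.prems(4) by (simp add: field_simps)
      then show ?thesis using Suc.IH[of m D1] m D12(1) Suc.prems by auto
    qed
    moreover have "increment f D2 \<le> 1"
    proof -
      have "increment f D2 \<le> variation f D2"
        by (intro sum_mono) auto
      also have "\<dots> < 1"
      proof (rule d(2))
        show "nonoverlapping a b D2" using nonoverlapping_mono[OF D12(2)] m Suc.prems by auto
        show "total_length D2 < d"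
          using nonoverlapping_length_le[OF D12(2)] m by auto
      qed
      finally show ?thesis by simp
    qed
    ultimately show ?case using D12(3) by simp
  qed
  show ?thesis
  proof (cases "a \<le> b")
    case True
    obtain n where n: "b - a < real n * (d/2)"
      using d(1) reals_Archimedean3[of "d/2"] half_gt_zero by blast
    then show ?thesis using main[of a b n] True by blast
  next
    case False
    then have "D = {}" if "nonoverlapping a b D" for D
      using that by (auto simp: nonoverlapping_def)
    then have "increment f D \<le> 0" if "nonoverlapping a b D" for D
      using that by force
    then show ?thesis by blast
  qed
qed

lemma abs_continuous_subinterval:
  "abs_continuous_on_interval a b f \<Longrightarrow> a \<le> a' \<Longrightarrow> b' \<le> b \<Longrightarrow> abs_continuous_on_interval a' b' f"
  unfolding abs_continuous_alt by (meson nonoverlapping_mono)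

lemma positive_variation_bdd:
  fixes f :: "real \<Rightarrow> real"
  assumes f: "abs_continuous_on_interval a b f" and xy: "a \<le> x" "y \<le> b"
  shows "bdd_above (increment f ` {D. nonoverlapping x y D})"
proof -
  have "abs_continuous_on_interval x y f"
    using abs_continuous_subinterval[OF f] xy by simp
  from abs_continuous_bounded_sums[OF this] show ?thesis
    unfolding bdd_above_def by (auto simp del: split_paired_All)
qed

lemma positive_variation_upper:
  assumes f: "abs_continuous_on_interval a b f" and xy: "a \<le> x" "y \<le> b" and D: "nonoverlapping x y D"
  shows "increment f D \<le> positive_variation f x y"
  unfolding positive_variation_def
  by (rule cSUP_upper[OF _ positive_variation_bdd[OF f xy]]) (use D in auto)

lemma positive_variation_split:
  assumes f: "abs_continuous_on_interval a b f" and xyz: "a \<le> x" "x \<le> y" "y \<le> z" "z \<le> b"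
  shows "positive_variation f x z \<le> positive_variation f x y + positive_variation f y z"
  unfolding positive_variation_def[of f x z]
proof (rule cSUP_least)
  show "{D. nonoverlapping x z D} \<noteq> {}" using nonoverlapping_empty by blast
  fix D assume "D \<in> {D. nonoverlapping x z D}"
  then obtain D1 D2 where D12: "nonoverlapping x y D1" "nonoverlapping y z D2"
      "increment f D = increment f D1 + increment f D2"
    using nonoverlapping_split[of x z D y f] xyz by blast
  then show "increment f D \<le> positive_variation f x y + positive_variation f y z"
    using positive_variation_upper[OF f _ _ D12(1)] positive_variation_upper[OF f _ _ D12(2)] xyz by simp
qed

lemma nonoverlapping_Un:
  assumes "nonoverlapping x y D1" "nonoverlapping y z D2" "x \<le> y" "y \<le> z"
  shows "nonoverlapping x z (D1 \<union> D2)"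
proof -
  have "disjnt {fst p<..<snd p} {fst q<..<snd q}" if "p \<in> D1" "q \<in> D2" for p q
  proof -
    have "snd p \<le> y" "y \<le> fst q" using assms that by (auto simp: nonoverlapping_def case_prod_beta)
    then show ?thesis by (auto simp: disjnt_def)
  qed
  then have "pairwise (\<lambda>p q. disjnt {fst p<..<snd p} {fst q<..<snd q}) (D1 \<union> D2)"
    using assms(1,2) unfolding nonoverlapping_def pairwise_def by (metis Un_iff disjnt_sym)
  moreover have "\<forall>(u,v)\<in>D1 \<union> D2. x \<le> u \<and> u \<le> v \<and> v \<le> z"
    using assms by (auto simp: nonoverlapping_def case_prod_beta)
  ultimately show ?thesis using assms(1,2) by (simp add: nonoverlapping_def)
qed

text \<open>The two halves of Jordan's decomposition: \<open>p = positive_variation f a\<close> and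
  \<open>p - f\<close> are both increasing. A family need not exhaust its interval, so it can be
  reused on a larger one; appending the pair \<open>(y,z)\<close> adds exactly
  \<open>f z - f y\<close>.\<close>

lemma positive_variation_ge:
  assumes f: "abs_continuous_on_interval a b f" and xyz: "a \<le> x" "x \<le> y" "y \<le> z" "z \<le> b"
  shows "positive_variation f x y \<le> positive_variation f x z"
    and "positive_variation f x y + (f z - f y) \<le> positive_variation f x z"
proof -
  show "positive_variation f x y \<le> positive_variation f x z"
    unfolding positive_variation_def[of f x y]
  proof (rule cSUP_least)
    show "{D. nonoverlapping x y D} \<noteq> {}" using nonoverlapping_empty by blast
    fix D assume "D \<in> {D. nonoverlapping x y D}"
    then have "nonoverlapping x z D" using nonoverlapping_mono xyz by blast
    then show "increment f D \<le> positive_variation f x z"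
      using positive_variation_upper[OF f] xyz by auto
  qed
  have "positive_variation f x y \<le> positive_variation f x z - (f z - f y)"
    unfolding positive_variation_def[of f x y]
  proof (rule cSUP_least)
    show "{D. nonoverlapping x y D} \<noteq> {}" using nonoverlapping_empty by blast
    fix D assume "D \<in> {D. nonoverlapping x y D}"
    then have D: "nonoverlapping x y D" by simp
    show "increment f D \<le> positive_variation f x z - (f z - f y)"
    \<comment> \<open>For \<open>y < z\<close> the pair \<open>(y,z)\<close> cannot already belong
      to \<open>D\<close>, so its increment is really added to the sum; a degenerate pair might be
      there already.\<close>
    proof (cases "y = z")
      case True
      then show ?thesis using positive_variation_upper[OF f _ _ D] xyz by auto
    next
      case False
      then have yz: "y < z" using xyz by simp
      have "nonoverlapping x z (D \<union> {(y,z)})"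
        by (rule nonoverlapping_Un[OF D nonoverlapping_singleton]) (use xyz in auto)
      then have "(\<Sum>(u,v)\<in>D \<union> {(y,z)}. f v - f u) \<le> positive_variation f x z"
        using positive_variation_upper[OF f] xyz by auto
      moreover have "(y,z) \<notin> D" "finite D" using D yz by (auto simp: nonoverlapping_def)
      ultimately show ?thesis by simp
    qed
  qed
  then show "positive_variation f x y + (f z - f y) \<le> positive_variation f x z" by simp
qed

lemma nonoverlapping_refine:
  assumes D: "nonoverlapping a b D" and E: "\<And>p. p \<in> D \<Longrightarrow> nonoverlapping (fst p) (snd p) (E p)"
    and ne: "\<And>p q. p \<in> D \<Longrightarrow> q \<in> E p \<Longrightarrow> fst q < snd q"
  shows "nonoverlapping a b (\<Union>p\<in>D. E p)" "p \<in> D \<Longrightarrow> q \<in> D \<Longrightarrow> p \<noteq> q \<Longrightarrow> E p \<inter> E q = {}"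
proof -
  have b: "fst p \<le> fst r \<and> snd r \<le> snd p \<and> fst r < snd r" if "p \<in> D" "r \<in> E p" for p r
    using E[OF that(1)] ne[OF that] that(2) by (auto simp: nonoverlapping_def case_prod_beta)
  have bD: "a \<le> fst p \<and> snd p \<le> b" if "p \<in> D" for p
    using D that by (auto simp: nonoverlapping_def case_prod_beta)
  have same: "p = q" if "p \<in> D" "q \<in> D" "r \<in> E p" "s \<in> E q" "fst r < t" "t < snd r" "fst s < t" "t < snd s" for p q r s t
    using nonoverlapping_unique[OF D that(1,2), of t] b[OF that(1,3)] b[OF that(2,4)] that(5-8) by linarith
  show "E p \<inter> E q = {}" if "p \<in> D" "q \<in> D" "p \<noteq> q"
  proof (rule ccontr)
    assume "E p \<inter> E q \<noteq> {}"
    then obtain r where r: "r \<in> E p" "r \<in> E q" by blast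
    then show False
      using same[OF that(1,2) r, of "(fst r + snd r) / 2"] that(3) b[OF that(1) r(1)] by auto
  qed
  show "nonoverlapping a b (\<Union>p\<in>D. E p)"
    unfolding nonoverlapping_def
  proof (intro conjI)
    show "finite (\<Union>p\<in>D. E p)" using D E by (auto simp: nonoverlapping_def)
    show "\<forall>(u,v)\<in>\<Union> (E ` D). a \<le> u \<and> u \<le> v \<and> v \<le> b"
    proof (intro ballI)
      fix r assume "r \<in> \<Union> (E ` D)"
      then obtain p where "p \<in> D" "r \<in> E p" by blast
      then show "case r of (u,v) \<Rightarrow> a \<le> u \<and> u \<le> v \<and> v \<le> b" using b[of p r] bD[of p] by (simp add: case_prod_beta)
    qed
    show "pairwise (\<lambda>p q. disjnt {fst p<..<snd p} {fst q<..<snd q}) (\<Union>p\<in>D. E p)"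
      unfolding pairwise_def disjnt_def
    proof (intro ballI impI)
      fix r s assume "r \<in> (\<Union>p\<in>D. E p)" "s \<in> (\<Union>p\<in>D. E p)" "r \<noteq> s"
      then obtain p q where pq: "p \<in> D" "q \<in> D" "r \<in> E p" "s \<in> E q" "r \<noteq> s" by blast
      show "{fst r<..<snd r} \<inter> {fst s<..<snd s} = {}"
      proof (rule ccontr)
        assume "{fst r<..<snd r} \<inter> {fst s<..<snd s} \<noteq> {}"
        then obtain t where t: "fst r < t" "t < snd r" "fst s < t" "t < snd s"
          by (metis disjoint_iff greaterThanLessThan_iff)
        then have "p = q" using same[OF pq(1-4)] by blast
        then have "r = s" using nonoverlapping_unique[OF E[OF pq(1)] pq(3) _ t(1,2)] pq(4) t by blast
        with pq(5) show False by simp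
      qed
    qed
  qed
qed

text \<open>The increment of the positive variation over \<open>{u..v}\<close> is at most the
  positive variation on \<open>{u..v}\<close>, which a family inside \<open>{u..v}\<close> nearly
  attains. These families together refine \<open>D\<close> without increasing its total length, so
  the absolute continuity of \<open>f\<close> applies to their union.\<close>

lemma abs_continuous_positive_variation:
  fixes f :: "real \<Rightarrow> real"
  assumes f: "abs_continuous_on_interval a b f"
  shows "abs_continuous_on_interval a b (positive_variation f a)"
  unfolding abs_continuous_alt
proof (intro allI impI)
  fix e :: real assume "e > 0"
  then obtain d where d: "d > 0" "\<And>D. nonoverlapping a b D \<Longrightarrow> total_length D < d \<Longrightarrow> variation f D < e/2"
    using f unfolding abs_continuous_alt by (meson half_gt_zero)
  show "\<exists>d>0. \<forall>D. nonoverlapping a b D \<longrightarrow> total_length D < d \<longrightarrow>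
      (\<Sum>(u,v)\<in>D. norm (positive_variation f a v - positive_variation f a u)) < e"
  proof (intro exI[of _ d] conjI allI impI d(1))
    fix D assume D: "nonoverlapping a b D" and len: "total_length D < d"
    have finD: "finite D" using D by (simp add: nonoverlapping_def)
    \<comment> \<open>The allowed defect for each interval; over all of \<open>D\<close> the defects
      add up to at most \<open>e/2\<close>, and \<open>Suc\<close> covers the empty family.\<close>
    define h where "h = e / (2 * real (Suc (card D)))"
    have h: "h > 0" using \<open>e > 0\<close> by (simp add: h_def)
    have pD: "a \<le> fst p \<and> fst p \<le> snd p \<and> snd p \<le> b" if "p \<in> D" for p
      using D that by (auto simp: nonoverlapping_def case_prod_beta)
    have "\<exists>E. nonoverlapping (fst p) (snd p) E \<and> (\<forall>q\<in>E. fst q < snd q) \<and>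
       positive_variation f (fst p) (snd p) - h < increment f E" if "p \<in> D" for p
    proof -
      have "\<exists>s\<in>increment f ` {D. nonoverlapping (fst p) (snd p) D}. positive_variation f (fst p) (snd p) - h < s"
      proof (subst less_cSup_iff[symmetric])
        show "increment f ` {D. nonoverlapping (fst p) (snd p) D} \<noteq> {}"
          using nonoverlapping_empty by blast
        show "bdd_above (increment f ` {D. nonoverlapping (fst p) (snd p) D})"
          by (rule positive_variation_bdd[OF f]) (use pD[OF that] in auto)
        show "positive_variation f (fst p) (snd p) - h < (SUP D\<in>{D. nonoverlapping (fst p) (snd p) D}. \<Sum>(u,v)\<in>D. f v - f u)"
          using h unfolding positive_variation_def by simp
      qed
      then obtain E where E: "nonoverlapping (fst p) (snd p) E" "positive_variation f (fst p) (snd p) - h < increment f E"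
        by blast
      define E' where "E' = {q\<in>E. fst q < snd q}"
      have "increment f E = increment f E'"
      proof (rule sum.mono_neutral_right)
        show "finite E" using E(1) by (simp add: nonoverlapping_def)
        show "E' \<subseteq> E" by (auto simp: E'_def)
        show "\<forall>q\<in>E - E'. (case q of (u,v) \<Rightarrow> f v - f u) = 0"
        proof
          fix q assume "q \<in> E - E'"
          then have "fst q = snd q" using E(1) by (auto simp: nonoverlapping_def E'_def case_prod_beta)
          then show "(case q of (u,v) \<Rightarrow> f v - f u) = 0" by (simp add: case_prod_beta)
        qed
      qed
      moreover have "nonoverlapping (fst p) (snd p) E'"
        using E(1) by (rule nonoverlapping_subset) (auto simp: E'_def)
      ultimately show ?thesis using E(2) by (intro exI[of _ E']) (auto simp: E'_def)
    qed
    then obtain E where E: "\<And>p. p \<in> D \<Longrightarrow> nonoverlapping (fst p) (snd p) (E p)"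
      "\<And>p q. p \<in> D \<Longrightarrow> q \<in> E p \<Longrightarrow> fst q < snd q"
      "\<And>p. p \<in> D \<Longrightarrow> positive_variation f (fst p) (snd p) - h < (\<Sum>(u,v)\<in>E p. f v - f u)"
      by metis
    have ref: "nonoverlapping a b (\<Union>p\<in>D. E p)"
      by (rule nonoverlapping_refine(1)[OF D]) (use E in auto)
    have disj: "E p \<inter> E q = {}" if "p \<in> D" "q \<in> D" "p \<noteq> q" for p q
      by (rule nonoverlapping_refine(2)[OF D _ _ that]) (use E in auto)
    have finE: "finite (E p)" if "p \<in> D" for p using E(1)[OF that] by (simp add: nonoverlapping_def)
    have UN: "sum g (\<Union>p\<in>D. E p) = (\<Sum>p\<in>D. sum g (E p))" for g :: "real \<times> real \<Rightarrow> real"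
      by (rule sum.UNION_disjoint[OF finD]) (use finE disj in \<open>blast+\<close>)
    have "total_length (\<Union>p\<in>D. E p) = (\<Sum>p\<in>D. \<Sum>(u,v)\<in>E p. v - u)" by (rule UN)
    also have "\<dots> \<le> (\<Sum>p\<in>D. snd p - fst p)"
      using nonoverlapping_length_le[OF E(1)] pD by (intro sum_mono) auto
    also have "\<dots> < d" using len by (simp add: case_prod_beta)
    finally have "variation f (\<Union>p\<in>D. E p) < e/2"
      using d(2)[OF ref] by simp
    moreover have "increment f (\<Union>p\<in>D. E p) \<le> variation f (\<Union>p\<in>D. E p)"
      by (intro sum_mono) auto
    ultimately have s: "(\<Sum>p\<in>D. \<Sum>(u,v)\<in>E p. f v - f u) < e/2" unfolding UN by linarith
    have "(\<Sum>(u,v)\<in>D. norm (positive_variation f a v - positive_variation f a u)) \<le> (\<Sum>p\<in>D. h + (\<Sum>(u,v)\<in>E p. f v - f u))"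
    proof (intro sum_mono)
      fix p assume p: "p \<in> D"
      have "positive_variation f a (fst p) \<le> positive_variation f a (snd p)"
        using positive_variation_ge(1)[OF f] pD[OF p] by auto
      moreover have "positive_variation f a (snd p) \<le> positive_variation f a (fst p) + positive_variation f (fst p) (snd p)"
        using positive_variation_split[OF f] pD[OF p] by auto
      ultimately show "(case p of (u,v) \<Rightarrow> norm (positive_variation f a v - positive_variation f a u)) \<le> h + (\<Sum>(u,v)\<in>E p. f v - f u)"
        using E(3)[OF p] by (simp add: case_prod_beta)
    qed
    also have "\<dots> = real (card D) * h + (\<Sum>p\<in>D. \<Sum>(u,v)\<in>E p. f v - f u)" by (simp add: sum.distrib)
    also have "real (card D) * h \<le> real (Suc (card D)) * h" using h by (intro mult_right_mono) auto
    also have "\<dots> = e/2" unfolding h_def by (simp del: of_nat_Suc)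
    finally show "(\<Sum>(u,v)\<in>D. norm (positive_variation f a v - positive_variation f a u)) < e" using s by simp
  qed
qed

section \<open>Absolutely continuous functions as indefinite integrals\<close>

lemma abs_continuous_imp_continuous:
  assumes f: "abs_continuous_on_interval a b f"
  shows "continuous_on {a..b} f"
  unfolding continuous_on_iff
proof (intro ballI allI impI)
  fix x e :: real assume x: "x \<in> {a..b}" and "0 < e"
  then obtain d where d: "d > 0" "\<And>D. nonoverlapping a b D \<Longrightarrow> total_length D < d \<Longrightarrow> variation f D < e"
    using f unfolding abs_continuous_alt by meson
  show "\<exists>d>0. \<forall>x'\<in>{a..b}. dist x' x < d \<longrightarrow> dist (f x') (f x) < e"
  proof (intro exI[of _ d] conjI ballI impI d(1))
    fix y assume y: "y \<in> {a..b}" "dist y x < d"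
    have "norm (f (max x y) - f (min x y)) < e"
      using d(2)[OF nonoverlapping_singleton[of a "min x y" "max x y" b]] x y
      by (simp add: dist_real_def abs_if split: if_splits)
    then show "dist (f y) (f x) < e" by (cases "x \<le> y") (simp_all add: dist_norm norm_minus_commute)
  qed
qed

text \<open>The Stieltjes measure of \<open>F\<close> inherits absolute continuity: a null set lies
  in an open set of measure below \<open>d\<close>, is covered inside it by countably many
  non-overlapping intervals, and over finitely many of these \<open>F\<close> increases by less than
  \<open>e\<close>.\<close>

lemma abs_continuous_mono_null_sets:
  fixes F :: "real \<Rightarrow> real"
  assumes ab: "a < b" and mono: "mono F" and cont: "continuous_on UNIV F"
    and F: "abs_continuous_on_interval a b F"
    and S: "S \<in> null_sets lborel" "S \<subseteq> {a..b}"
  shows "S \<in> null_sets (interval_measure F)"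
proof -
  let ?M = "interval_measure F"
  have Icc: "emeasure ?M {u..v} = ennreal (F v - F u)" if "u \<le> v" for u v
    by (rule emeasure_interval_measure_Icc[OF that]) (use mono cont in \<open>auto simp: mono_def\<close>)
  have Sb: "S \<in> sets borel" using S by auto
  have bound: "emeasure ?M S \<le> ennreal e" if "e > 0" for e :: real
  proof -
    obtain d where d: "d > 0" "\<And>D. nonoverlapping a b D \<Longrightarrow> total_length D < d \<Longrightarrow> variation F D < e"
      using F \<open>e > 0\<close> unfolding abs_continuous_alt by meson
    have "S \<in> sets lebesgue" using Sb by simp
    then obtain T where T: "open T" "S \<subseteq> T" "emeasure lebesgue (T - S) < ennreal d"
      using sets_lebesgue_outer_open[OF _ d(1)] by metis
    have Tb: "T \<in> sets borel" using T(1) by simp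
    have "emeasure lborel T \<le> emeasure lborel (T - S) + emeasure lborel S"
      using T(2) Sb Tb emeasure_subadditive[of "T - S" lborel S] by (simp add: Un_absorb2)
    also have "\<dots> < ennreal d" using S(1) T(3) Sb Tb by (simp add: null_sets_def)
    finally have Td: "emeasure lborel T < ennreal d" .
    \<comment> \<open>The covering lemma keeps each interval inside the gauge set of one of its
      points in \<open>S\<close>, so this gauge forces all intervals into \<open>T\<close>. The
      value \<open>UNIV\<close> off \<open>S\<close> only completes the gauge.\<close>
    have gauge: "gauge (\<lambda>x. if x \<in> S then T else UNIV)" using T by (auto simp: gauge_def)
    have "S \<subseteq> cbox a b" "box a b \<noteq> {}" using S(2) ab by auto
    from covering_lemma[OF this gauge] obtain \<D> where \<D>: "countable \<D>" "\<Union>\<D> \<subseteq> cbox a b"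
      "\<And>K. K \<in> \<D> \<Longrightarrow> interior K \<noteq> {} \<and> (\<exists>c d. K = cbox c d)"
      "pairwise (\<lambda>A B. interior A \<inter> interior B = {}) \<D>"
      "\<And>K. K \<in> \<D> \<Longrightarrow> \<exists>x \<in> S \<inter> K. K \<subseteq> (if x \<in> S then T else UNIV)"
      "S \<subseteq> \<Union>\<D>"
      by metis
    have KT: "K \<subseteq> T" if "K \<in> \<D>" for K using \<D>(5)[OF that] by auto
    have K: "K = {Inf K..Sup K} \<and> a \<le> Inf K \<and> Inf K < Sup K \<and> Sup K \<le> b \<and> interior K = {Inf K<..<Sup K}" if KD: "K \<in> \<D>" for K
    proof -
      obtain c e where K: "K = {c..e}" using \<D>(3)[OF KD] by auto
      moreover have "c < e" using \<D>(3)[OF KD] K by auto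
      moreover have "K \<subseteq> {a..b}" using \<D>(2) KD by auto
      ultimately show ?thesis by auto
    qed
    have fin: "emeasure ?M (\<Union>\<F>) \<le> ennreal e" if "finite \<F>" "\<F> \<subseteq> \<D>" for \<F>
    proof -
      define D where "D = (\<lambda>K. (Inf K, Sup K)) ` \<F>"
      have K': "K = {Inf K..Sup K}" "a \<le> Inf K" "Inf K < Sup K" "Sup K \<le> b" "interior K = {Inf K<..<Sup K}" if "K \<in> \<F>" for K
        using K[of K] that \<open>\<F> \<subseteq> \<D>\<close> by auto
      have inj: "inj_on (\<lambda>K. (Inf K, Sup K)) \<F>"
        using K'(1) by (auto simp: inj_on_def) metis+
      have D: "nonoverlapping a b D"
        unfolding nonoverlapping_def
      proof (intro conjI)
        show "finite D" using that by (simp add: D_def)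
        show "\<forall>(u,v)\<in>D. a \<le> u \<and> u \<le> v \<and> v \<le> b" using K'(2-4) by (auto simp: D_def less_imp_le)
        show "pairwise (\<lambda>p q. disjnt {fst p<..<snd p} {fst q<..<snd q}) D"
          unfolding pairwise_def disjnt_def
        proof (intro ballI impI)
          fix p q assume "p \<in> D" "q \<in> D" "p \<noteq> q"
          then obtain K L where KL: "K \<in> \<F>" "L \<in> \<F>" "K \<noteq> L" "p = (Inf K, Sup K)" "q = (Inf L, Sup L)"
            by (auto simp: D_def)
          then have "interior K \<inter> interior L = {}" using \<D>(4) that(2) by (auto simp: pairwise_def)
          then show "{fst p<..<snd p} \<inter> {fst q<..<snd q} = {}" using K'(5) KL by simp
        qed
      qed
      have Tf: "T \<inter> {a..b} \<in> lmeasurable" using Tb by (subst Int_commute, intro fmeasurable_Int_fmeasurable) auto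
      \<comment> \<open>The intervals lie in \<open>T \<inter> {a..b}\<close>, so integrating the
        indicator of that set over them returns their lengths; hence the total length is at most the
        measure of the set.\<close>
      have "total_length D = (\<Sum>(u,v)\<in>D. integral {u..v} (indicat_real (T \<inter> {a..b})))"
      proof (intro sum.cong refl)
        fix p assume "p \<in> D"
        then obtain K where KF: "K \<in> \<F>" "p = (Inf K, Sup K)" by (auto simp: D_def)
        have "integral {Inf K..Sup K} (indicat_real (T \<inter> {a..b})) = integral {Inf K..Sup K} (\<lambda>_. 1::real)"
        proof (rule integral_cong)
          fix x assume "x \<in> {Inf K..Sup K}"
          then have "x \<in> K" using K'(1)[OF KF(1)] by blast
          moreover have "K \<in> \<D>" using KF(1) that(2) by blast
          ultimately have "x \<in> T" "x \<in> {a..b}" using KT \<D>(2) by (blast, fastforce)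
          then show "indicat_real (T \<inter> {a..b}) x = 1" by simp
        qed
        then show "(case p of (u,v) \<Rightarrow> v - u) = (case p of (u,v) \<Rightarrow> integral {u..v} (indicat_real (T \<inter> {a..b})))"
          using K'(3)[OF KF(1)] KF(2) by simp
      qed
      also have "\<dots> \<le> integral {a..b} (indicat_real (T \<inter> {a..b}))"
      proof (rule sum_integral_nonoverlapping_le[OF D])
        show "indicat_real (T \<inter> {a..b}) integrable_on {a..b}"
          using Tf by (simp add: integrable_on_indicator Int_assoc)
      qed auto
      also have "integral {a..b} (indicat_real (T \<inter> {a..b})) = measure lebesgue (T \<inter> {a..b})"
        using Tf by (simp add: integral_indicator)
      also have "\<dots> < d"
      proof -
        have "emeasure lborel (T \<inter> {a..b}) < ennreal d"
          using Td emeasure_mono[of "T \<inter> {a..b}" T lborel] Tb by (simp add: order_le_less_trans)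
        moreover have "emeasure lborel (T \<inter> {a..b}) = ennreal (measure lebesgue (T \<inter> {a..b}))"
          using emeasure_eq_measure2[OF Tf] Tb by simp
        ultimately show ?thesis by (simp add: ennreal_less_iff)
      qed
      finally have "variation F D < e" using d(2)[OF D] by simp
      then have le: "(\<Sum>K\<in>\<F>. F (Sup K) - F (Inf K)) \<le> e"
        unfolding D_def sum.reindex[OF inj]
        using K'(3) mono by (auto simp: mono_def less_imp_le cong: sum.cong)
      have "emeasure ?M (\<Union>\<F>) \<le> (\<Sum>K\<in>\<F>. emeasure ?M K)"
      proof -
        have "K \<in> sets borel" if "K \<in> \<F>" for K using K'(1)[OF that] by (metis atLeastAtMost_borel)
        then show ?thesis using emeasure_subadditive_finite[of \<F> "\<lambda>K. K" ?M] \<open>finite \<F>\<close> by auto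
      qed
      also have "\<dots> = (\<Sum>K\<in>\<F>. ennreal (F (Sup K) - F (Inf K)))"
        using K' Icc by (intro sum.cong refl) (metis less_imp_le)
      also have "\<dots> = ennreal (\<Sum>K\<in>\<F>. F (Sup K) - F (Inf K))"
        using K'(3) mono by (intro sum_ennreal) (auto simp: mono_def less_imp_le)
      also have "\<dots> \<le> ennreal e" using le by (rule ennreal_leI)
      finally show ?thesis .
    qed
    show ?thesis
    proof (cases "\<D> = {}")
      case True
      then show ?thesis using \<D>(6) by simp
    next
      case False
      define A where "A n = (\<Union>(from_nat_into \<D> ` {..n}))" for n :: nat
      have rng: "range (from_nat_into \<D>) = \<D>" using False \<D>(1) by (rule range_from_nat_into)
      have sub: "from_nat_into \<D> ` {..n} \<subseteq> \<D>" for n using rng by blast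
      have UA: "\<Union>\<D> = (\<Union>n. A n)" unfolding A_def using rng by auto blast
      have "K \<in> sets borel" if "K \<in> \<D>" for K using \<D>(3)[OF that] by auto
      then have Am: "A n \<in> sets ?M" for n unfolding A_def using sub[of n] by auto
      have inc: "incseq A" unfolding A_def incseq_def by fastforce
      have "emeasure ?M S \<le> emeasure ?M (\<Union>n. A n)"
        using \<D>(6) Am UA by (intro emeasure_mono) auto
      also have "\<dots> = (SUP n. emeasure ?M (A n))"
        by (rule SUP_emeasure_incseq[OF _ inc, symmetric]) (use Am in auto)
      also have "\<dots> \<le> ennreal e"
        unfolding A_def by (rule SUP_least) (rule fin, use sub in auto)
      finally show ?thesis .
    qed
  qed
  have "emeasure ?M S \<le> 0"
    by (rule ennreal_le_epsilon) (use bound in simp)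
  then show ?thesis using Sb by (auto simp: null_sets_def)
qed

text \<open>For increasing \<open>f\<close> the density is the Radon-Nikodym derivative of the
  Stieltjes measure with respect to Lebesgue measure; \<open>abs_continuous_mono_null_sets\<close>
  supplies the required absolute continuity of measures.\<close>

lemma abs_continuous_mono_density:
  fixes f :: "real \<Rightarrow> real"
  assumes ab: "a < b" and mono: "mono_on {a..b} f" and f: "abs_continuous_on_interval a b f"
  shows "\<exists>g. g absolutely_integrable_on {a..b} \<and> (\<forall>x\<in>{a..b}. integral {a..x} g = f x - f a)"
proof -
  \<comment> \<open>Freezing \<open>f\<close> outside \<open>{a..b}\<close> makes it increasing and
    continuous on the whole line, with a Stieltjes measure that gives no mass to the complement of
    the interval.\<close>
  define F where "F x = f (max a (min b x))" for x
  have monoF: "mono F" using mono ab by (auto simp: mono_def F_def mono_on_def)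
  have contF: "continuous_on UNIV F"
    unfolding F_def by (rule continuous_on_compose2[OF abs_continuous_imp_continuous[OF f]])
      (use ab in \<open>auto intro!: continuous_intros\<close>)
  have Ff: "F x = f x" if "x \<in> {a..b}" for x using that by (simp add: F_def)
  have acF: "abs_continuous_on_interval a b F"
  proof -
    have "variation F D = variation f D" if "nonoverlapping a b D" for D
      using that by (intro sum.cong refl) (auto simp: nonoverlapping_def Ff)
    then show ?thesis using f unfolding abs_continuous_alt by metis
  qed
  let ?M = "interval_measure F"
  have Ioc: "emeasure ?M {u<..v} = ennreal (F v - F u)" if "u \<le> v" for u v
    by (rule emeasure_interval_measure_Ioc[OF that])
      (use monoF contF in \<open>auto simp: mono_def continuous_on_eq_continuous_within intro: continuous_within_subset\<close>)
  have Icc: "emeasure ?M {u..v} = ennreal (F v - F u)" if "u \<le> v" for u v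
    by (rule emeasure_interval_measure_Icc[OF that]) (use monoF contF in \<open>auto simp: mono_def\<close>)
  have "{..a} = (\<Union>n. {a - real n..a})"
    by auto (metis diff_le_eq add.commute le_diff_eq real_arch_simple)
  moreover have "{a - real n..a} \<in> null_sets ?M" for n
    using Icc[of "a - real n" a] ab by (auto simp: null_sets_def F_def)
  ultimately have n1: "{..a} \<in> null_sets ?M" by (metis null_sets_UN)
  have "{b..} = (\<Union>n. {b..b + real n})"
    by auto (metis add.commute diff_le_eq real_arch_simple)
  moreover have "{b..b + real n} \<in> null_sets ?M" for n
    using Icc[of b "b + real n"] ab by (auto simp: null_sets_def F_def)
  ultimately have n2: "{b..} \<in> null_sets ?M" by (metis null_sets_UN)
  have "absolutely_continuous lborel ?M"
    unfolding absolutely_continuous_def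
  proof
    fix S assume S: "S \<in> null_sets (lborel :: real measure)"
    have "S \<inter> {a..b} \<in> null_sets ?M"
      by (rule abs_continuous_mono_null_sets[OF ab monoF contF acF]) (use S in \<open>auto intro: null_set_Int2\<close>)
    then have "S \<inter> {a..b} \<union> {..a} \<union> {b..} \<in> null_sets ?M" using n1 n2 by blast
    then show "S \<in> null_sets ?M"
      by (rule null_sets_subset) (use S in auto)
  qed
  then obtain g where g: "g \<in> borel_measurable lborel" "density lborel g = ?M"
    using sigma_finite_measure.Radon_Nikodym[OF sigma_finite_lborel] by (metis sets_interval_measure sets_lborel)
  \<comment> \<open>The Radon-Nikodym density takes values in \<open>ennreal\<close>. The finite
    mass \<open>F b - F a\<close> makes it finite almost everywhere on \<open>{a..b}\<close>, so
    passing to real values loses nothing there.\<close>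
  define G where "G x = enn2real (g x)" for x
  have nn: "(\<integral>\<^sup>+x. g x * indicator {u..v} x \<partial>lborel) = ennreal (F v - F u)" if "u \<le> v" for u v
    using Icc[OF that] emeasure_density[OF g(1), of "{u..v}"] g(2) by simp
  have "AE x in lborel. g x * indicator {a..b} x \<noteq> \<infinity>"
    by (rule nn_integral_PInf_AE) (use g(1) nn[of a b] ab in auto)
  then have fin: "AE x in lborel. x \<in> {a..b} \<longrightarrow> g x = ennreal (G x)"
    by eventually_elim (auto simp: G_def less_top)
  have hi: "(G has_integral (f x - f a)) {a..x}" if x: "x \<in> {a..b}" for x
  proof -
    have "(\<integral>\<^sup>+t. ennreal (indicator {a..x} t * G t) \<partial>lborel) = (\<integral>\<^sup>+t. g t * indicator {a..x} t \<partial>lborel)"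
      using fin by (intro nn_integral_cong_AE, eventually_elim) (use x in \<open>auto simp: indicator_def\<close>)
    also have "\<dots> = ennreal (F x - F a)" using nn[of a x] x by simp
    also have "F x - F a = f x - f a" using Ff x by auto
    finally have "(\<integral>\<^sup>+t. ennreal (indicator {a..x} t * G t) \<partial>lborel) = ennreal (f x - f a)" .
    moreover have "0 \<le> f x - f a" using mono x ab by (auto simp: mono_on_def)
    moreover have "(\<lambda>t. indicator {a..x} t * G t) \<in> borel_measurable borel"
      using g(1) unfolding G_def by measurable
    ultimately have "((\<lambda>t. indicator {a..x} t * G t) has_integral (f x - f a)) UNIV"
      by (intro nn_integral_has_integral) (auto simp: G_def)
    moreover have "(\<lambda>t. indicator {a..x} t * G t) = (\<lambda>t. if t \<in> {a..x} then G t else 0)"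
      by (auto simp: indicator_def)
    ultimately show ?thesis by (simp only: has_integral_restrict_UNIV)
  qed
  have "G absolutely_integrable_on {a..b}"
    using hi[of b] ab by (intro nonnegative_absolutely_integrable_1) (auto simp: G_def integrable_on_def)
  then show ?thesis using hi by (auto simp: integral_unique)
qed

text \<open>Jordan's decomposition \<open>f = p - (p - f)\<close> reduces the claim to two
  increasing functions.\<close>

lemma abs_continuous_real_density:
  fixes f :: "real \<Rightarrow> real"
  assumes ab: "a < b" and f: "abs_continuous_on_interval a b f"
  shows "\<exists>g. g absolutely_integrable_on {a..b} \<and> (\<forall>x\<in>{a..b}. integral {a..x} g = f x - f a)"
proof -
  define p where "p = positive_variation f a"
  have p: "abs_continuous_on_interval a b p"
    unfolding p_def by (rule abs_continuous_positive_variation[OF f])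
  have q: "abs_continuous_on_interval a b (\<lambda>x. p x - f x)"
    by (rule abs_continuous_dominated[OF p f, where C=1]) simp
  have mp: "mono_on {a..b} p"
    using positive_variation_ge(1)[OF f] by (auto simp: mono_on_def p_def)
  have mq: "mono_on {a..b} (\<lambda>x. p x - f x)"
    using positive_variation_ge(2)[OF f] by (fastforce simp: mono_on_def p_def)
  obtain g h where g: "g absolutely_integrable_on {a..b}" "\<forall>x\<in>{a..b}. integral {a..x} g = p x - p a"
    and h: "h absolutely_integrable_on {a..b}" "\<forall>x\<in>{a..b}. integral {a..x} h = (p x - f x) - (p a - f a)"
    using abs_continuous_mono_density[OF ab mp p] abs_continuous_mono_density[OF ab mq q] by blast
  show ?thesis
  proof (intro exI[of _ "\<lambda>x. g x - h x"] conjI ballI)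
    show "(\<lambda>x. g x - h x) absolutely_integrable_on {a..b}" using g h by auto
    fix x assume x: "x \<in> {a..b}"
    then have "g integrable_on {a..x}" "h integrable_on {a..x}"
      using g(1) h(1) by (auto intro: integrable_subinterval_real simp: absolutely_integrable_on_def)
    then show "integral {a..x} (\<lambda>x. g x - h x) = f x - f a" using g h x by (simp add: integral_diff)
  qed
qed

section \<open>Calculus of absolutely continuous functions and the fundamental theorem\<close>

lemma abs_continuous_bounded:
  assumes "abs_continuous_on_interval a b f"
  obtains M where "M > 0" "\<And>x. x \<in> {a..b} \<Longrightarrow> norm (f x) \<le> M"
proof -
  have "compact (f ` {a..b})"
    by (rule compact_continuous_image[OF abs_continuous_imp_continuous[OF assms] compact_Icc])
  then obtain M where "\<forall>x\<in>f ` {a..b}. norm x \<le> M" using compact_imp_bounded bounded_iff by blast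
  then show thesis by (intro that[of "max M 1"]) (auto simp: le_max_iff_disj)
qed

lemma abs_continuous_bilinear:
  assumes h: "bounded_bilinear h" and f: "abs_continuous_on_interval a b f" and g: "abs_continuous_on_interval a b g"
  shows "abs_continuous_on_interval a b (\<lambda>x. h (f x) (g x))"
proof -
  interpret bounded_bilinear h by (rule h)
  obtain M1 where M1: "M1 > 0" "\<And>x. x \<in> {a..b} \<Longrightarrow> norm (f x) \<le> M1" using abs_continuous_bounded[OF f] by blast
  obtain M2 where M2: "M2 > 0" "\<And>x. x \<in> {a..b} \<Longrightarrow> norm (g x) \<le> M2" using abs_continuous_bounded[OF g] by blast
  obtain K where K: "K > 0" "\<And>x y. norm (h x y) \<le> norm x * norm y * K" using pos_bounded by blast
  show ?thesis
  proof (rule abs_continuous_dominated[OF f g])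
    fix u v assume uv: "u \<in> {a..b}" "v \<in> {a..b}"
    have "h (f v) (g v) - h (f u) (g u) = h (f v - f u) (g v) + h (f u) (g v - g u)"
      by (simp add: diff_left diff_right)
    then have "norm (h (f v) (g v) - h (f u) (g u)) \<le> norm (f v - f u) * norm (g v) * K + norm (f u) * norm (g v - g u) * K"
      using norm_triangle_ineq[of "h (f v - f u) (g v)" "h (f u) (g v - g u)"]
        K(2)[of "f v - f u" "g v"] K(2)[of "f u" "g v - g u"] by simp
    also have "\<dots> \<le> norm (f v - f u) * max M1 M2 * K + max M1 M2 * norm (g v - g u) * K"
      using M1 M2 uv K(1) by (intro add_mono mult_right_mono mult_left_mono) (auto simp: le_max_iff_disj)
    finally show "norm (h (f v) (g v) - h (f u) (g u)) \<le> (max M1 M2 * K) * (norm (f v - f u) + norm (g v - g u))"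
      by (simp add: algebra_simps)
  qed
qed

lemma abs_continuous_exp:
  fixes f :: "real \<Rightarrow> real"
  assumes f: "abs_continuous_on_interval a b f"
  shows "abs_continuous_on_interval a b (\<lambda>x. exp (f x))"
proof -
  obtain M where M: "M > 0" "\<And>x. x \<in> {a..b} \<Longrightarrow> norm (f x) \<le> M" using abs_continuous_bounded[OF f] by blast
  have *: "exp t - exp s \<le> exp M * \<bar>t - s\<bar>" if "\<bar>s\<bar> \<le> M" "\<bar>t\<bar> \<le> M" for s t :: real
  proof (cases "s \<le> t")
    case True
    have "exp t * (1 + (s - t)) \<le> exp t * exp (s - t)" by (intro mult_left_mono exp_ge_add_one_self) auto
    then have "exp t - exp s \<le> exp t * (t - s)" by (simp add: algebra_simps exp_diff)
    also have "\<dots> \<le> exp M * (t - s)" using that True by (intro mult_right_mono) auto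
    finally show ?thesis using True by simp
  next
    case False
    then have "exp t - exp s \<le> 0" by simp
    also have "0 \<le> exp M * \<bar>t - s\<bar>" by simp
    finally show ?thesis .
  qed
  show ?thesis
  proof (rule abs_continuous_dominated[OF f f])
    fix u v assume uv: "u \<in> {a..b}" "v \<in> {a..b}"
    have "norm (exp (f v) - exp (f u)) \<le> exp M * norm (f v - f u)"
      using *[of "f u" "f v"] *[of "f v" "f u"] M(2)[OF uv(1)] M(2)[OF uv(2)]
      by (simp add: abs_le_iff abs_minus_commute)
    then show "norm (exp (f v) - exp (f u)) \<le> exp M * (norm (f v - f u) + norm (f v - f u))"
      by (rule order_trans) auto
  qed
qed

lemma abs_continuous_bounded_linear:
  assumes h: "bounded_linear h" and f: "abs_continuous_on_interval a b f"
  shows "abs_continuous_on_interval a b (\<lambda>x. h (f x))"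
proof -
  obtain K where K: "\<And>x. norm (h x) \<le> norm x * K" using bounded_linear.bounded[OF h] by blast
  show ?thesis
  proof (rule abs_continuous_dominated[OF f f])
    fix u v assume "u \<in> {a..b}" "v \<in> {a..b}"
    have "norm (h (f v) - h (f u)) \<le> norm (f v - f u) * K"
      using K[of "f v - f u"] by (simp add: bounded_linear.linear h linear_diff)
    also have "\<dots> = (K/2) * (norm (f v - f u) + norm (f v - f u))" by simp
    finally show "norm (h (f v) - h (f u)) \<le> (K/2) * (norm (f v - f u) + norm (f v - f u))" .
  qed
qed

lemma AE_lebesgue_iff_negligible:
  "(AE x in lebesgue. P x) \<longleftrightarrow> negligible {x. \<not> P x}"
proof
  assume "AE x in lebesgue. P x"
  then obtain N where N: "N \<in> null_sets lebesgue" "{x. \<not> P x} \<subseteq> N"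
    unfolding eventually_ae_filter by auto
  then have "negligible N" by (simp add: negligible_iff_null_sets)
  then show "negligible {x. \<not> P x}" using N(2) by (rule negligible_subset)
next
  assume "negligible {x. \<not> P x}"
  then show "AE x in lebesgue. P x" by (intro AE_I'[of "{x. \<not> P x}"]) (auto simp: negligible_iff_null_sets)
qed

lemma has_integral_AE_cong:
  fixes f g :: "real \<Rightarrow> 'a::euclidean_space"
  assumes "AE x\<in>S in lebesgue. f x = g x"
  shows "(f has_integral I) S \<longleftrightarrow> (g has_integral I) S"
proof -
  have n: "negligible {x. \<not> (x \<in> S \<longrightarrow> f x = g x)}" using assms by (simp add: AE_lebesgue_iff_negligible)
  show ?thesis by (rule has_integral_spike_eq[OF n]) auto
qed

lemma abs_continuous_density:
  fixes f :: "real \<Rightarrow> 'a::euclidean_space"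
  assumes ab: "a < b" and f: "abs_continuous_on_interval a b f"
  shows "\<exists>g. g absolutely_integrable_on {a..b} \<and> (\<forall>x\<in>{a..b}. (g has_integral (f x - f a)) {a..x})"
proof -
  have "\<exists>g. g absolutely_integrable_on {a..b} \<and> (\<forall>x\<in>{a..b}. integral {a..x} g = f x \<bullet> i - f a \<bullet> i)" for i
    by (rule abs_continuous_real_density[OF ab abs_continuous_bounded_linear[OF bounded_linear_inner_left f]])
  then obtain g where g: "\<And>i. g i absolutely_integrable_on {a..b}"
    "\<And>i x. x \<in> {a..b} \<Longrightarrow> integral {a..x} (g i) = f x \<bullet> i - f a \<bullet> i" by metis
  define G where "G x = (\<Sum>i\<in>Basis. g i x *\<^sub>R i)" for x
  show ?thesis
  proof (intro exI[of _ G] conjI ballI)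
    show "G absolutely_integrable_on {a..b}"
      unfolding G_def by (intro absolutely_integrable_sum finite_Basis absolutely_integrable_scaleR_right) (use g in auto)
    fix x assume x: "x \<in> {a..b}"
    have "(g i has_integral (f x \<bullet> i - f a \<bullet> i)) {a..x}" for i
    proof -
      have "g i integrable_on {a..x}"
        using g(1)[of i] x by (auto intro: integrable_subinterval_real simp: absolutely_integrable_on_def)
      then show ?thesis using g(2)[OF x] by (metis integrable_integral)
    qed
    then have "(G has_integral (\<Sum>i\<in>Basis. (f x \<bullet> i - f a \<bullet> i) *\<^sub>R i)) {a..x}"
      unfolding G_def by (intro has_integral_sum has_integral_scaleR_left finite_Basis)
    moreover have "(\<Sum>i\<in>Basis. (f x \<bullet> i - f a \<bullet> i) *\<^sub>R i) = f x - f a"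
      by (simp add: inner_diff_left[symmetric] euclidean_representation)
    ultimately show "(G has_integral (f x - f a)) {a..x}" by simp
  qed
qed

text \<open>The Radon-Nikodym density is also a derivative almost everywhere, by differentiation of
  indefinite integrals, and therefore agrees with the total operator
  \<open>vector_derivative\<close> up to a null set.\<close>

lemma
  fixes f :: "real \<Rightarrow> 'a::euclidean_space"
  assumes ab: "a \<le> b" and f: "abs_continuous_on_interval a b f"
  shows abs_continuous_differentiable_AE: "AE x\<in>{a..b} in lebesgue. (f has_vector_derivative vector_derivative f (at x)) (at x)"
    and abs_continuous_FTC: "((\<lambda>x. vector_derivative f (at x)) has_integral (f b - f a)) {a..b}"
proof -
  have *: "(AE x\<in>{a..b} in lebesgue. (f has_vector_derivative vector_derivative f (at x)) (at x)) \<and>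
    ((\<lambda>x. vector_derivative f (at x)) has_integral (f b - f a)) {a..b}"
  proof (cases "a = b")
    case True
    have "AE x in lebesgue. x \<noteq> b" by (simp add: AE_lebesgue_iff_negligible)
    then have "AE x\<in>{b} in lebesgue. (f has_vector_derivative vector_derivative f (at x)) (at x)"
      by eventually_elim auto
    then show ?thesis using True by auto
  next
    case False
    then have lt: "a < b" using ab by simp
    obtain g where g: "g absolutely_integrable_on {a..b}" "\<And>x. x\<in>{a..b} \<Longrightarrow> (g has_integral (f x - f a)) {a..x}"
      using abs_continuous_density[OF lt f] by blast
    \<comment> \<open>The end points join the exceptional set: the two-sided derivative there
      depends on values of \<open>f\<close> outside \<open>{a..b}\<close>.\<close>
    define N where "N = {x\<in>{a<..<b}. \<not> ((\<lambda>u. integral {a..u} g) has_vector_derivative g x) (at x)} \<union> {a,b}"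
    have "negligible N"
      unfolding N_def using has_vector_derivative_indefinite_integral_AE[of g a b] g(1)
      by (auto simp: absolutely_integrable_on_def intro!: negligible_Un)
    moreover have der: "(f has_vector_derivative g x) (at x)" if "x \<in> {a..b} - N" for x
    proof -
      have x: "x \<in> {a<..<b}" "((\<lambda>u. integral {a..u} g) has_vector_derivative g x) (at x)"
        using that by (auto simp: N_def)
      have "((\<lambda>u. f a + integral {a..u} g) has_vector_derivative 0 + g x) (at x)"
        by (intro has_vector_derivative_add has_vector_derivative_const x)
      then have "((\<lambda>u. f a + integral {a..u} g) has_vector_derivative g x) (at x)" by simp
      then show ?thesis
        by (rule has_vector_derivative_transform_within_open[OF _ open_greaterThanLessThan x(1)])
           (use integral_unique[OF g(2)] in auto)
    qed
    moreover have "{x. \<not> (x \<in> {a..b} \<longrightarrow> (f has_vector_derivative g x) (at x))} \<subseteq> N"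
      using der by blast
    ultimately have A: "AE x\<in>{a..b} in lebesgue. (f has_vector_derivative g x) (at x)"
      unfolding AE_lebesgue_iff_negligible by (metis (no_types, lifting) negligible_subset)
    then have B: "AE x\<in>{a..b} in lebesgue. vector_derivative f (at x) = g x"
      by eventually_elim (auto intro: vector_derivative_at)
    from A B have "AE x\<in>{a..b} in lebesgue. (f has_vector_derivative vector_derivative f (at x)) (at x)"
      by eventually_elim auto
    then show ?thesis using has_integral_AE_cong[OF B] g(2)[of b] ab by auto
  qed
  then show "AE x\<in>{a..b} in lebesgue. (f has_vector_derivative vector_derivative f (at x)) (at x)"
   "((\<lambda>x. vector_derivative f (at x)) has_integral (f b - f a)) {a..b}" by auto
qed

lemma abs_continuous_FTC_AE:
  fixes f :: "real \<Rightarrow> 'a::euclidean_space"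
  assumes ab: "a \<le> b" and f: "abs_continuous_on_interval a b f"
    and g: "AE x\<in>{a..b} in lebesgue. (f has_vector_derivative vector_derivative f (at x)) (at x) \<longrightarrow> (f has_vector_derivative g x) (at x)"
  shows "(g has_integral (f b - f a)) {a..b}"
proof -
  have eq: "AE x\<in>{a..b} in lebesgue. vector_derivative f (at x) = g x"
    using g abs_continuous_differentiable_AE[OF ab f] by eventually_elim (auto intro: vector_derivative_at)
  show ?thesis using abs_continuous_FTC[OF ab f] unfolding has_integral_AE_cong[OF eq] .
qed

text \<open>The exceptional point \<open>c\<close> admits exhaustions of a half-line by compact
  intervals in its interior, which never reach the end point \<open>0\<close>.\<close>

lemma AE_all_intervals:
  fixes P :: "real \<Rightarrow> bool"
  assumes "\<And>n::nat. AE x\<in>S n in lebesgue. P x" "\<And>x. x \<in> I \<Longrightarrow> x \<noteq> c \<Longrightarrow> \<exists>n. x \<in> S n"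
  shows "AE x\<in>I in lebesgue. P x"
proof -
  have "AE x in lebesgue. \<forall>n. x \<in> S n \<longrightarrow> P x" unfolding AE_all_countable using assms(1) by blast
  moreover have "AE x in lebesgue. x \<noteq> c" by (simp add: AE_lebesgue_iff_negligible)
  ultimately show ?thesis
  proof eventually_elim
    case (elim x)
    then show ?case using assms(2) by blast
  qed
qed

section \<open>Primitives of locally integrable functions\<close>

lemma
  fixes g :: "real \<Rightarrow> 'a::euclidean_space"
  assumes g: "g \<in> L1_loc" and F: "\<And>u v. u \<le> v \<Longrightarrow> F v - F u = integral {u..v} g"
  shows AC_indefinite_integral: "F \<in> AC I"
    and indefinite_integral_derivative_AE: "AE x in lebesgue. (F has_vector_derivative g x) (at x)"
proof -
  show "F \<in> AC I" unfolding AC_def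
    using abs_continuous_indefinite_integral[where g=g and F=F] g F unfolding L1_loc_def by auto
  have "AE x\<in>{-real n<..<real n} in lebesgue. (F has_vector_derivative g x) (at x)" for n
  proof -
    have "g integrable_on {-real n..real n}" using g by (simp add: L1_loc_def absolutely_integrable_on_def)
    from has_vector_derivative_indefinite_integral_AE[OF this]
    have "AE x\<in>{-real n<..<real n} in lebesgue. ((\<lambda>u. integral {-real n..u} g) has_vector_derivative g x) (at x)"
      unfolding AE_lebesgue_iff_negligible by (simp add: conj_ac)
    then show ?thesis
    proof eventually_elim
      case (elim x)
      show ?case
      proof
        assume x: "x \<in> {-real n<..<real n}"
        have "((\<lambda>u. F (-real n) + integral {-real n..u} g) has_vector_derivative 0 + g x) (at x)"
          using elim x by (intro has_vector_derivative_add has_vector_derivative_const) auto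
        then have "((\<lambda>u. F (-real n) + integral {-real n..u} g) has_vector_derivative g x) (at x)" by simp
        then show "(F has_vector_derivative g x) (at x)"
          by (rule has_vector_derivative_transform_within_open[OF _ open_greaterThanLessThan x])
             (simp add: F[of "-real n", symmetric])
      qed
    qed
  qed
  then have "AE x\<in>UNIV in lebesgue. (F has_vector_derivative g x) (at x)"
  proof (rule AE_all_intervals)
    fix x :: real
    obtain n where "\<bar>x\<bar> < real n" using reals_Archimedean2 by blast
    then show "\<exists>n. x \<in> {-real n<..<real n}" by (intro exI[of _ n]) auto
  qed
  then show "AE x in lebesgue. (F has_vector_derivative g x) (at x)" by simp
qed

definition signed_integral :: "(real \<Rightarrow> 'a::euclidean_space) \<Rightarrow> real \<Rightarrow> 'a" where
  "signed_integral g x = (if 0 \<le> x then integral {0..x} g else - integral {x..0} g)"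

lemma signed_integral_diff:
  assumes g: "g \<in> L1_loc" and "u \<le> v"
  shows "signed_integral g v - signed_integral g u = integral {u..v} g"
proof -
  have i: "g integrable_on {a..b}" for a b using g by (simp add: L1_loc_def absolutely_integrable_on_def)
  note c = Henstock_Kurzweil_Integration.integral_combine[OF _ _ i]
  consider "0 \<le> u" | "u < 0" "0 \<le> v" | "v < 0" by linarith
  then show ?thesis
  proof cases
    case 1 then show ?thesis using c[of 0 u v] \<open>u \<le> v\<close> by (simp add: signed_integral_def algebra_simps)
  next
    case 2 then show ?thesis using c[of u 0 v] by (simp add: signed_integral_def algebra_simps)
  next
    case 3 then show ?thesis using c[of u v 0] \<open>u \<le> v\<close> by (simp add: signed_integral_def algebra_simps)
  qed
qed

lemma signed_integral_0 [simp]: "signed_integral g 0 = 0"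
  by (simp add: signed_integral_def)

section \<open>Linear differential equations with locally integrable coefficients\<close>

lemma L1_loc_integrable: "g \<in> L1_loc \<Longrightarrow> g integrable_on {a..b::real}"
  by (simp add: L1_loc_def absolutely_integrable_on_def)

lemma L1_loc_bilinear_continuous:
  fixes h :: "'b::euclidean_space \<Rightarrow> 'a::euclidean_space \<Rightarrow> 'c::euclidean_space"
  assumes h: "bounded_bilinear h" and A: "A \<in> L1_loc" and c: "continuous_on UNIV c"
  shows "(\<lambda>x. h (A x) (c x)) \<in> L1_loc"
  unfolding L1_loc_def
proof (intro CollectI allI)
  fix a b :: real
  have "bilinear (\<lambda>x y. h y x)"
    using h by (simp add: bilinear_conv_bounded_bilinear bounded_bilinear.flip)
  moreover have cab: "continuous_on {a..b} c" using c continuous_on_subset by blast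
  then have "c \<in> borel_measurable (lebesgue_on {a..b})"
    by (intro continuous_imp_measurable_on_sets_lebesgue) auto
  moreover have "bounded (c ` {a..b})"
    by (intro compact_imp_bounded compact_continuous_image cab) simp
  moreover have "A absolutely_integrable_on {a..b}" using A by (simp add: L1_loc_def)
  ultimately show "(\<lambda>x. h (A x) (c x)) absolutely_integrable_on {a..b}"
    using absolutely_integrable_bounded_measurable_product[where h="\<lambda>x y. h y x" and f=c and g=A] by simp
qed

lemma L1_loc_diff: "f \<in> L1_loc \<Longrightarrow> g \<in> L1_loc \<Longrightarrow> (\<lambda>x. f x - g x) \<in> L1_loc"
  by (auto simp: L1_loc_def)

lemma L1_loc_bounded_linear: "bounded_linear h \<Longrightarrow> f \<in> L1_loc \<Longrightarrow> (\<lambda>x. h (f x)) \<in> L1_loc"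
  unfolding L1_loc_def using absolutely_integrable_linear[where f=f and h=h] by (auto simp: o_def)

lemma AC_imp_continuous_on_UNIV:
  assumes "f \<in> AC UNIV"
  shows "continuous_on UNIV f"
proof -
  have "isCont f x" for x
  proof -
    have "continuous_on {x - 1..x + 1} f"
      by (rule abs_continuous_imp_continuous) (use assms in \<open>auto simp: AC_def\<close>)
    then show ?thesis
      by (rule continuous_on_interior) auto
  qed
  then show ?thesis by (simp add: continuous_on_eq_continuous_at)
qed

lemma signed_integral_AC: "g \<in> L1_loc \<Longrightarrow> signed_integral g \<in> AC I"
  by (rule AC_indefinite_integral) (use signed_integral_diff in auto)

text \<open>With \<open>s\<close> the primitive of \<open>a\<close>, the integrand is up to
  orientation the derivative of \<open>exp (2 * \<bar>s\<bar>) / 2\<close>. The factor 2 in the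
  exponent is the source of the contraction constant \<open>1/2\<close> in Picard iteration.\<close>

lemma weight_integral:
  fixes a :: "real \<Rightarrow> real"
  assumes a: "a \<in> L1_loc" "\<And>x. 0 \<le> a x"
  shows "0 \<le> x \<Longrightarrow> ((\<lambda>t. a t * exp (2 * \<bar>signed_integral a t\<bar>)) has_integral (exp (2 * \<bar>signed_integral a x\<bar>) - 1) / 2) {0..x}"
    and "x \<le> 0 \<Longrightarrow> ((\<lambda>t. a t * exp (2 * \<bar>signed_integral a t\<bar>)) has_integral (exp (2 * \<bar>signed_integral a x\<bar>) - 1) / 2) {x..0}"
proof -
  let ?s = "signed_integral a"
  have mono: "?s u \<le> ?s v" if "u \<le> v" for u v
    using signed_integral_diff[OF a(1) that] integral_nonneg[OF L1_loc_integrable[OF a(1)], of u v] a(2) by simp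
  have der: "AE t in lebesgue. (?s has_vector_derivative a t) (at t)"
    by (rule indefinite_integral_derivative_AE[OF a(1)]) (use signed_integral_diff[OF a(1)] in auto)
  have gen: "((\<lambda>t. c * a t * exp (c * ?s t)) has_integral (exp (c * ?s v) - exp (c * ?s u))) {u..v}" if "u \<le> v" for c u v
  proof (rule abs_continuous_FTC_AE[OF that])
    have "abs_continuous_on_interval u v ?s" using signed_integral_AC[OF a(1), of UNIV] that by (auto simp: AC_def)
    then show "abs_continuous_on_interval u v (\<lambda>t. exp (c * ?s t))"
      by (intro abs_continuous_exp abs_continuous_bounded_linear[OF bounded_linear_mult_right])
    show "AE t\<in>{u..v} in lebesgue. ((\<lambda>t. exp (c * ?s t)) has_vector_derivative vector_derivative (\<lambda>t. exp (c * ?s t)) (at t)) (at t) \<longrightarrow>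
        ((\<lambda>t. exp (c * ?s t)) has_vector_derivative c * a t * exp (c * ?s t)) (at t)"
      using der by eventually_elim
        (auto simp: has_real_derivative_iff_has_vector_derivative[symmetric] intro!: derivative_eq_intros)
  qed
  show "((\<lambda>t. a t * exp (2 * \<bar>?s t\<bar>)) has_integral (exp (2 * \<bar>?s x\<bar>) - 1) / 2) {0..x}" if "0 \<le> x"
  proof -
    have p: "0 \<le> ?s t" if "0 \<le> t" for t using mono[OF that] by simp
    have "((\<lambda>t. (1/2) * (2 * a t * exp (2 * ?s t))) has_integral (1/2) * (exp (2 * ?s x) - exp (2 * ?s 0))) {0..x}"
      by (rule has_integral_mult_right[OF gen[OF that]])
    then show ?thesis using p that
      by (subst has_integral_cong[where g="\<lambda>t. (1/2) * (2 * a t * exp (2 * ?s t))"]) auto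
  qed
  show "((\<lambda>t. a t * exp (2 * \<bar>?s t\<bar>)) has_integral (exp (2 * \<bar>?s x\<bar>) - 1) / 2) {x..0}" if "x \<le> 0"
  proof -
    have p: "?s t \<le> 0" if "t \<le> 0" for t using mono[OF that] by simp
    have "((\<lambda>t. (-1/2) * (-2 * a t * exp (-2 * ?s t))) has_integral (-1/2) * (exp (-2 * ?s 0) - exp (-2 * ?s x))) {x..0}"
      by (rule has_integral_mult_right[OF gen[OF that]])
    moreover have "(-1/2) * (exp (-2 * ?s 0) - exp (-2 * ?s x)) = (exp (2 * \<bar>?s x\<bar>) - 1) / 2"
    proof -
      have "(-1/2) * (1 - e) = (e - 1) / 2" for e :: real by (simp add: field_simps)
      moreover have "\<bar>?s x\<bar> = - ?s x" using p[OF that] by simp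
      ultimately show ?thesis by (simp only: signed_integral_0 mult_zero_right exp_zero mult_minus_left mult_minus_right)
    qed
    ultimately have "((\<lambda>t. (-1/2) * (-2 * a t * exp (-2 * ?s t))) has_integral (exp (2 * \<bar>?s x\<bar>) - 1) / 2) {x..0}"
      by metis
    then show ?thesis
      by (rule has_integral_eq[rotated]) (use p in auto)
  qed
qed

lemma norm_signed_integral_le:
  fixes g :: "real \<Rightarrow> 'a::euclidean_space"
  assumes g: "g \<in> L1_loc" and a: "a \<in> L1_loc" "\<And>x. 0 \<le> a x"
    and le: "\<And>x. norm (g x) \<le> a x * exp (2 * \<bar>signed_integral a x\<bar>) * M"
  shows "norm (signed_integral g x) \<le> (exp (2 * \<bar>signed_integral a x\<bar>) - 1) / 2 * M"
proof -
  note w = weight_integral[OF a, THEN has_integral_mult_left[where c=M]]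
  show ?thesis
  proof (cases "0 \<le> x")
    case True
    have "norm (integral {0..x} g) \<le> integral {0..x} (\<lambda>t. a t * exp (2 * \<bar>signed_integral a t\<bar>) * M)"
      using w(1)[OF True] by (intro integral_norm_bound_integral L1_loc_integrable[OF g] le) (auto simp: integrable_on_def)
    also have "\<dots> = (exp (2 * \<bar>signed_integral a x\<bar>) - 1) / 2 * M" by (rule integral_unique[OF w(1)[OF True]])
    finally show ?thesis using True by (simp add: signed_integral_def[of g])
  next
    case False
    then have x: "x \<le> 0" by simp
    have "norm (integral {x..0} g) \<le> integral {x..0} (\<lambda>t. a t * exp (2 * \<bar>signed_integral a t\<bar>) * M)"
      using w(2)[OF x] by (intro integral_norm_bound_integral L1_loc_integrable[OF g] le) (auto simp: integrable_on_def)
    also have "\<dots> = (exp (2 * \<bar>signed_integral a x\<bar>) - 1) / 2 * M" by (rule integral_unique[OF w(2)[OF x]])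
    finally show ?thesis using False by (simp add: signed_integral_def[of g])
  qed
qed

lemma signed_integral_sub:
  assumes "f \<in> L1_loc" "g \<in> L1_loc"
  shows "signed_integral (\<lambda>x. f x - g x) x = signed_integral f x - signed_integral g x"
  using integral_diff[OF L1_loc_integrable[OF assms(1)] L1_loc_integrable[OF assms(2)]]
  by (simp add: signed_integral_def)

text \<open>Picard iteration is a contraction for the sup norm weighted with \<open>exp (-2 \<bar>\<integral>a\<bar>)\<close>, which gives a
  solution on the whole line at once.\<close>

theorem linear_ode_solution:
  fixes h :: "'b::euclidean_space \<Rightarrow> 'a::euclidean_space \<Rightarrow> 'a"
  assumes h: "bounded_bilinear h" and A: "A \<in> L1_loc"
  obtains y where "y 0 = y0" "y \<in> AC UNIV" "AE x in lebesgue. (y has_vector_derivative h (A x) (y x)) (at x)"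
proof -
  interpret bounded_bilinear h by (rule h)
  obtain K where K: "K > 0" "\<And>x y. norm (h x y) \<le> norm x * norm y * K" using pos_bounded by blast
  define a where "a x = norm (A x) * K" for x
  have a: "a \<in> L1_loc" "\<And>x. 0 \<le> a x"
    using A K(1) unfolding L1_loc_def a_def by (auto intro!: set_integrable_mult_left set_integrable_norm)
  define w where "w x = exp (2 * \<bar>signed_integral a x\<bar>)" for x
  have w: "1 \<le> w x" for x by (simp add: w_def)
  have w': "w x > 0" "w x \<noteq> 0" for x using w[of x] by auto
  have contw: "continuous_on UNIV w"
    unfolding w_def by (intro continuous_intros AC_imp_continuous_on_UNIV signed_integral_AC a)
  \<comment> \<open>The unknown is stored as the quotient \<open>Z = y / w\<close>, which is bounded
    and continuous; Banach's theorem can then be used in the type of bounded continuous functions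
    with its unweighted norm.\<close>
  define G where "G Z x = h (A x) (w x *\<^sub>R apply_bcontfun Z x)" for Z :: "real \<Rightarrow>\<^sub>C 'a" and x
  have G: "G Z \<in> L1_loc" for Z
    unfolding G_def by (intro L1_loc_bilinear_continuous[OF h A] continuous_intros contw) auto
  define T where "T Z x = (1 / w x) *\<^sub>R (y0 + signed_integral (G Z) x)" for Z x
  have bound: "norm (signed_integral (\<lambda>x. G Z x - G Z' x) x) \<le> (w x - 1) / 2 * dist Z Z'" for Z Z' x
    unfolding w_def
  proof (rule norm_signed_integral_le[OF L1_loc_diff[OF G G] a])
    fix x
    have "G Z x - G Z' x = h (A x) (w x *\<^sub>R (apply_bcontfun Z x - apply_bcontfun Z' x))"
      by (simp add: G_def diff_right[symmetric] scaleR_diff_right)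
    then have "norm (G Z x - G Z' x) \<le> norm (A x) * norm (w x *\<^sub>R (apply_bcontfun Z x - apply_bcontfun Z' x)) * K"
      using K(2) by metis
    also have "\<dots> = a x * w x * dist (apply_bcontfun Z x) (apply_bcontfun Z' x)"
      using w'(1)[of x] by (simp add: a_def dist_norm)
    also have "\<dots> \<le> a x * w x * dist Z Z'"
      using dist_bounded[of Z x Z'] a(2)[of x] w'(1)[of x] by (intro mult_left_mono) auto
    finally show "norm (G Z x - G Z' x) \<le> a x * exp (2 * \<bar>signed_integral a x\<bar>) * dist Z Z'" by (simp add: w_def)
  qed
  have G0: "G 0 = (\<lambda>x. 0)" by (auto simp: G_def zero_right)
  have bound0: "norm (signed_integral (G Z) x) \<le> (w x - 1) / 2 * norm Z" for Z x
    using bound[of Z 0 x] by (simp add: G0)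
  have TZ: "T Z \<in> bcontfun" for Z
  proof (rule bcontfun_normI)
    show "continuous_on UNIV (T Z)"
      unfolding T_def using w'(2) by (intro continuous_intros contw AC_imp_continuous_on_UNIV signed_integral_AC G) auto
    fix x
    have "norm (y0 + signed_integral (G Z) x) \<le> norm y0 + (w x - 1) / 2 * norm Z"
      using norm_triangle_ineq[of y0 "signed_integral (G Z) x"] bound0[of Z x] by simp
    also have "\<dots> \<le> norm y0 * w x + w x * norm Z"
      using w[of x] by (intro add_mono mult_right_mono) (auto simp: mult_le_cancel_left1)
    also have "\<dots> = w x * (norm y0 + norm Z)" by (simp add: algebra_simps)
    finally have "norm (y0 + signed_integral (G Z) x) / w x \<le> norm y0 + norm Z"
      using w'(1)[of x] by (simp add: divide_le_eq mult.commute)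
    then show "norm (T Z x) \<le> norm y0 + norm Z"
      using w'(1)[of x] by (simp add: T_def)
  qed
  define TT where "TT Z = Bcontfun (T Z)" for Z
  have TT: "apply_bcontfun (TT Z) = T Z" for Z unfolding TT_def by (rule Bcontfun_inverse[OF TZ])
  have "\<exists>!Z. TT Z = Z"
  proof (rule banach_fix_type[where c="1/2"])
    show "\<forall>Z Z'. dist (TT Z) (TT Z') \<le> 1/2 * dist Z Z'"
    proof (intro allI dist_bound)
      fix Z Z' x
      have "T Z x - T Z' x = (1 / w x) *\<^sub>R signed_integral (\<lambda>x. G Z x - G Z' x) x"
        unfolding T_def signed_integral_sub[OF G G] by (simp add: scaleR_diff_right[symmetric])
      then have "norm (T Z x - T Z' x) = norm (signed_integral (\<lambda>x. G Z x - G Z' x) x) / w x"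
        using w'(1)[of x] by simp
      also have "\<dots> \<le> ((w x - 1) / 2 * dist Z Z') / w x"
        using w'(1)[of x] by (intro divide_right_mono bound) auto
      also have "\<dots> \<le> (w x / 2 * dist Z Z') / w x"
        using w'(1)[of x] by (intro divide_right_mono mult_right_mono) auto
      also have "\<dots> = 1/2 * dist Z Z'" using w'(2)[of x] by simp
      finally show "dist (apply_bcontfun (TT Z) x) (apply_bcontfun (TT Z') x) \<le> 1/2 * dist Z Z'"
        by (simp add: TT dist_norm)
    qed
  qed auto
  then obtain Z where Z: "TT Z = Z" by blast
  define y where "y x = w x *\<^sub>R apply_bcontfun Z x" for x
  have y: "y x = y0 + signed_integral (\<lambda>x. h (A x) (y x)) x" for x
  proof -
    have "apply_bcontfun Z x = T Z x" by (metis Z TT)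
    then have "y x = w x *\<^sub>R T Z x" by (simp add: y_def)
    then show ?thesis using w'(2)[of x] unfolding T_def G_def[abs_def] y_def by simp
  qed
  have L: "(\<lambda>x. h (A x) (y x)) \<in> L1_loc" using G[of Z] unfolding G_def y_def .
  have d: "y v - y u = integral {u..v} (\<lambda>x. h (A x) (y x))" if "u \<le> v" for u v
    using signed_integral_diff[OF L that] y[of u] y[of v] by simp
  show thesis
  proof (rule that)
    show "y 0 = y0" using y[of 0] by simp
    show "y \<in> AC UNIV" by (rule AC_indefinite_integral[OF L d])
    show "AE x in lebesgue. (y has_vector_derivative h (A x) (y x)) (at x)"
      by (rule indefinite_integral_derivative_AE[OF L d])
  qed
qed

section \<open>Semi-definite Hermitian forms and matrices\<close>

lemma bounded_bilinear_cinner: "bounded_bilinear (cinner :: complex^'n \<Rightarrow> complex^'n \<Rightarrow> complex)"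
  unfolding bilinear_conv_bounded_bilinear[symmetric] bilinear_def cinner_def
  by (auto intro!: linearI simp: algebra_simps sum.distrib sum_distrib_left scaleR_sum_right)

lemma bounded_bilinear_matrix_vector: "bounded_bilinear ((*v) :: complex^'n^'m \<Rightarrow> complex^'n \<Rightarrow> complex^'m)"
  unfolding bilinear_conv_bounded_bilinear[symmetric] bilinear_def
  by (auto intro!: linearI simp: vec_eq_iff matrix_vector_mult_def algebra_simps sum.distrib scaleR_sum_right)

lemma bounded_bilinear_matrix_matrix: "bounded_bilinear ((**) :: complex^'n^'m \<Rightarrow> complex^'k^'n \<Rightarrow> complex^'k^'m)"
  unfolding bilinear_conv_bounded_bilinear[symmetric] bilinear_def
  by (auto intro!: linearI simp: vec_eq_iff matrix_matrix_mult_def algebra_simps sum.distrib scaleR_sum_right)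

interpretation cinner: bounded_bilinear "cinner :: complex^'n \<Rightarrow> complex^'n \<Rightarrow> complex"
  by (rule bounded_bilinear_cinner)

interpretation mv: bounded_bilinear "(*v) :: complex^'n^'m \<Rightarrow> complex^'n \<Rightarrow> complex^'m"
  by (rule bounded_bilinear_matrix_vector)

lemma cinner_scale_right [simp]: "cinner u (c *s v) = c * cinner u v"
  by (simp add: cinner_def sum_distrib_left algebra_simps)

lemma cinner_scale_left [simp]: "cinner (c *s u) v = cnj c * cinner u v"
  by (simp add: cinner_def sum_distrib_left algebra_simps)

lemma cnj_cinner: "cnj (cinner u v) = cinner v u"
  by (simp add: cinner_def algebra_simps)

lemma cinner_self: "cinner u u = of_real ((norm u)\<^sup>2)"
proof -
  have "cinner u u = (\<Sum>i\<in>UNIV. of_real ((norm (u $ i))\<^sup>2))"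
    unfolding cinner_def by (intro sum.cong refl) (simp add: mult.commute complex_norm_square[symmetric])
  also have "\<dots> = of_real ((norm u)\<^sup>2)"
    by (simp add: norm_vec_def L2_set_def sum_nonneg)
  finally show ?thesis .
qed

lemma cinner_eq_zeroI: "(\<And>u. cinner u v = 0) \<Longrightarrow> v = 0"
  using cinner_self[of v] by simp

lemma cinner_adjoint: "cinner (conj_transpose A *v u) v = cinner u (A *v v)"
proof -
  have "cinner (conj_transpose A *v u) v = (\<Sum>i\<in>UNIV. \<Sum>j\<in>UNIV. cnj (u $ j) * (A $ j $ i * v $ i))"
    by (simp add: cinner_def conj_transpose_def matrix_vector_mult_def map_matrix_def transpose_def
        sum_distrib_right sum_distrib_left algebra_simps)
  also have "\<dots> = (\<Sum>j\<in>UNIV. \<Sum>i\<in>UNIV. cnj (u $ j) * (A $ j $ i * v $ i))" by (rule sum.swap)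
  also have "\<dots> = cinner u (A *v v)" by (simp add: cinner_def matrix_vector_mult_def sum_distrib_left)
  finally show ?thesis .
qed

lemma conj_transpose_conj_transpose [simp]: "conj_transpose (conj_transpose A) = A"
  by (simp add: conj_transpose_def vec_eq_iff map_matrix_def transpose_def)

lemma cinner_adjoint': "cinner (A *v u) v = cinner u (conj_transpose A *v v)"
  using cinner_adjoint[of "conj_transpose A" u v] by simp

lemma matrix_vector_scale: "A *v (c *s v) = c *s (A *v (v :: complex^'n))"
  by (simp add: vec_eq_iff matrix_vector_mult_def sum_distrib_left algebra_simps)

lemma matrix_vector_sum: "A *v (\<Sum>i\<in>I. c i *s f i) = (\<Sum>i\<in>I. c i *s (A *v (f i :: complex^'n)))"
  by (simp add: mv.sum_right matrix_vector_scale)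

lemma mat_matrix_vector: "(mat c ** A) *v v = c *s (A *v (v :: complex^'n))"
proof -
  have "mat c *v w = c *s w" for w :: "complex^'m"
    by (simp add: vec_eq_iff matrix_vector_mult_def mat_def if_distrib[of "\<lambda>x. x * _"] cong: if_cong)
  then show ?thesis by (simp add: matrix_vector_mul_assoc[symmetric])
qed

lemma
  assumes "pos_semidef A"
  shows pos_semidef_hermitian: "cinner u (A *v v) = cnj (cinner v (A *v u))"
    and pos_semidef_nonneg: "0 \<le> Re (cinner u (A *v u))"
    and pos_semidef_real: "cinner u (A *v u) = of_real (Re (cinner u (A *v u)))"
proof -
  have A: "conj_transpose A = A" using assms by (simp add: pos_semidef_def)
  show h: "cinner u (A *v v) = cnj (cinner v (A *v u))" for u v
    using cinner_adjoint[of A u v] by (simp add: A cnj_cinner)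
  show "0 \<le> Re (cinner u (A *v u))" using assms by (simp add: pos_semidef_def)
  show "cinner u (A *v u) = of_real (Re (cinner u (A *v u)))"
    using h[of u u] by (simp add: complex_eq_iff)
qed

text \<open>The core of Cauchy-Schwarz for possibly degenerate forms. With \<open>s\<close> the
  product of \<open>v\<close> and \<open>u\<close>, and \<open>q\<close> the square of its modulus,
  the polynomial is the form at \<open>u - t s v\<close>; the optimal \<open>t\<close> is
  \<open>1 / r\<close>, and for \<open>r = 0\<close> large \<open>t\<close> force
  \<open>q = 0\<close>.\<close>

lemma real_quadratic_nonneg_discriminant:
  fixes p q r :: real
  assumes "\<And>t. 0 \<le> p - 2 * t * q + t\<^sup>2 * q * r" "0 \<le> p" "0 \<le> q" "0 \<le> r"
  shows "q \<le> p * r"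
proof (cases "r = 0")
  case True
  have "q = 0"
  proof (rule ccontr)
    assume "q \<noteq> 0"
    then have "q > 0" using assms(3) by simp
    then show False using assms(1)[of "(p + 1) / (2 * q)"] True by simp
  qed
  then show ?thesis using True by simp
next
  case False
  then have r: "r > 0" using assms(4) by simp
  have "0 \<le> p - q / r" using assms(1)[of "1 / r"] r by (simp add: power2_eq_square field_simps)
  then show ?thesis using r by (simp add: field_simps)
qed

lemma pos_semidef_Cauchy_Schwarz:
  assumes A: "pos_semidef A"
  shows "(cmod (cinner u (A *v v)))\<^sup>2 \<le> Re (cinner u (A *v u)) * Re (cinner v (A *v v))"
proof (rule real_quadratic_nonneg_discriminant)
  fix t :: real
  define s where "s = cinner v (A *v u)"
  have uv: "cinner u (A *v v) = cnj s" unfolding s_def by (rule pos_semidef_hermitian[OF A])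
  have "0 \<le> Re (cinner (u - (of_real t * s) *s v) (A *v (u - (of_real t * s) *s v)))" by (rule pos_semidef_nonneg[OF A])
  also have "cinner (u - (of_real t * s) *s v) (A *v (u - (of_real t * s) *s v)) =
     cinner u (A *v u) - of_real t * s * cnj s - of_real t * cnj s * s + of_real t * of_real t * s * cnj s * cinner v (A *v v)"
    by (simp add: cinner.diff_left cinner.diff_right mv.diff_right matrix_vector_scale uv s_def[symmetric] algebra_simps)
  also have "\<dots> = cinner u (A *v u) - 2 * of_real t * of_real ((cmod s)\<^sup>2) + of_real (t\<^sup>2) * of_real ((cmod s)\<^sup>2) * cinner v (A *v v)"
    unfolding complex_norm_square by (simp add: power2_eq_square algebra_simps)
  also have "Re \<dots> = Re (cinner u (A *v u)) - 2 * t * (cmod (cinner u (A *v v)))\<^sup>2 + t\<^sup>2 * (cmod (cinner u (A *v v)))\<^sup>2 * Re (cinner v (A *v v))"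
    using uv by (simp add: power2_eq_square)
  finally show "0 \<le> Re (cinner u (A *v u)) - 2 * t * (cmod (cinner u (A *v v)))\<^sup>2 + t\<^sup>2 * (cmod (cinner u (A *v v)))\<^sup>2 * Re (cinner v (A *v v))" .
qed (use pos_semidef_nonneg[OF A] in auto)

lemma pos_semidef_null:
  assumes A: "pos_semidef A" and "Re (cinner v (A *v v)) = 0"
  shows "A *v v = 0"
proof (rule cinner_eq_zeroI)
  fix u show "cinner u (A *v v) = 0"
    using pos_semidef_Cauchy_Schwarz[OF A, of u v] assms(2) by simp
qed

lemma pos_semidef_arith_mean:
  assumes A: "pos_semidef A"
  shows "2 * cmod (cinner u (A *v v)) \<le> Re (cinner u (A *v u)) + Re (cinner v (A *v v))"
proof -
  let ?p = "Re (cinner u (A *v u))" and ?q = "Re (cinner v (A *v v))"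
  have p: "0 \<le> ?p" "0 \<le> ?q" using pos_semidef_nonneg[OF A] by auto
  have "cmod (cinner u (A *v v)) \<le> sqrt (?p * ?q)"
    using pos_semidef_Cauchy_Schwarz[OF A, of u v] by (rule real_le_rsqrt)
  also have "\<dots> \<le> (?p + ?q) / 2" by (rule arith_geo_mean_sqrt[OF p])
  finally show ?thesis by simp
qed

text \<open>Each component of \<open>A v\<close> is a product with a unit vector, to which the
  arithmetic-mean inequality applies. The bound is linear in the quadratic form, so
  \<open>H h\<close> is locally integrable for \<open>h\<close> in \<open>L2H\<close> although
  \<open>H\<close> itself is only locally integrable.\<close>

lemma pos_semidef_norm_le:
  fixes A :: "complex^'n^'n"
  assumes A: "pos_semidef A"
  shows "norm (A *v v) \<le> (\<Sum>i\<in>UNIV. norm (A $ i $ i)) + real CARD('n) * Re (cinner v (A *v v))"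
proof -
  have c: "cinner (axis i 1) w = w $ i" for i and w :: "complex^'n"
    by (simp add: cinner_def axis_def if_distrib[of "\<lambda>x. cnj x * _"] cong: if_cong)
  have d: "(A *v axis i 1) $ i = A $ i $ i" for i
    by (simp add: matrix_vector_mult_def axis_def if_distrib[of "\<lambda>x. _ * x"] cong: if_cong)
  have "norm (A *v v) \<le> (\<Sum>i\<in>UNIV. norm ((A *v v) $ i))" unfolding norm_vec_def by (rule L2_set_le_sum) simp
  also have "\<dots> \<le> (\<Sum>i\<in>UNIV. norm (A $ i $ i) + Re (cinner v (A *v v)))"
  proof (rule sum_mono)
    fix i :: 'n
    have "2 * norm ((A *v v) $ i) \<le> Re (A $ i $ i) + Re (cinner v (A *v v))"
      using pos_semidef_arith_mean[OF A, of "axis i 1" v] by (simp add: c d)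
    also have "Re (A $ i $ i) \<le> norm (A $ i $ i)" by (rule complex_Re_le_cmod)
    finally show "norm ((A *v v) $ i) \<le> norm (A $ i $ i) + Re (cinner v (A *v v))"
      using pos_semidef_nonneg[OF A, of v] norm_ge_zero[of "(A *v v) $ i"] by linarith
  qed
  also have "\<dots> = (\<Sum>i\<in>UNIV. norm (A $ i $ i)) + real CARD('n) * Re (cinner v (A *v v))"
    by (simp add: sum.distrib)
  finally show ?thesis .
qed

lemma
  assumes "invertible A"
  shows matrix_inv_right: "A ** matrix_inv A = mat 1" and matrix_inv_left: "matrix_inv A ** A = mat 1"
  using assms someI_ex[of "\<lambda>A'. A ** A' = mat 1 \<and> A' ** A = mat 1"]
  unfolding invertible_def matrix_inv_def by auto

lemma continuous_on_det:
  fixes A :: "real \<Rightarrow> complex^'n^'n"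
  assumes "\<And>i j. continuous_on S (\<lambda>x. A x $ i $ j)"
  shows "continuous_on S (\<lambda>x. det (A x))"
  unfolding det_def by (intro continuous_intros assms)

text \<open>By Cramer's rule the entries of the inverse are quotients of determinants in the entries
  of \<open>A\<close>.\<close>

lemma continuous_on_matrix_inv:
  fixes A :: "real \<Rightarrow> complex^'n^'n"
  assumes A: "continuous_on S A" and nz: "\<And>x. x \<in> S \<Longrightarrow> det (A x) \<noteq> 0"
  shows "continuous_on S (\<lambda>x. matrix_inv (A x))"
proof -
  have comp: "continuous_on S (\<lambda>x. A x $ i $ j)" for i j
    by (intro continuous_on_component A)
  have eq: "matrix_inv (A x) $ k $ l = det (\<chi> i j. if j = k then axis l 1 $ i else A x $ i $ j) / det (A x)" if "x \<in> S" for x k l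
  proof -
    have inv: "A x ** matrix_inv (A x) = mat 1"
      using nz[OF that] by (simp add: invertible_det_nz[symmetric] matrix_inv_right)
    have "A x *v (matrix_inv (A x) *v axis l 1) = axis l 1"
      by (simp add: matrix_vector_mul_assoc inv)
    then have "matrix_inv (A x) *v axis l 1 = (\<chi> k. det (\<chi> i j. if j = k then axis l 1 $ i else A x $ i $ j) / det (A x))"
      by (simp only: cramer[OF nz[OF that]])
    moreover have "(matrix_inv (A x) *v axis l 1) $ k = matrix_inv (A x) $ k $ l"
      by (simp add: matrix_vector_mult_def axis_def if_distrib[of "\<lambda>x. _ * x"] cong: if_cong)
    ultimately show ?thesis by simp
  qed
  have "continuous_on S (\<lambda>x. matrix_inv (A x) $ k $ l)" for k l
  proof -
    have "continuous_on S (\<lambda>x. det (\<chi> i j. if j = k then axis l 1 $ i else A x $ i $ j) / det (A x))"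
    proof (intro continuous_on_divide continuous_on_det)
      show "continuous_on S (\<lambda>x. (\<chi> i j. if j = k then axis l 1 $ i else A x $ i $ j) $ i $ j)" for i j
        by (cases "j = k") (simp_all add: comp)
    qed (use nz comp in auto)
    then show ?thesis by (rule continuous_on_eq) (simp add: eq)
  qed
  then have "continuous_on S (\<lambda>x. \<chi> k l. matrix_inv (A x) $ k $ l)"
    by (intro continuous_on_vec_lambda)
  then show ?thesis by simp
qed

section \<open>First order systems\<close>

locale first_order_system =
  fixes J B H :: "real \<Rightarrow> complex^'n^'n"
  assumes sys: "symmetric_system J B H"
begin

lemma J_AC: "J \<in> AC UNIV" and J_skew: "conj_transpose (J x) = - J x" and det_J: "det (J x) \<noteq> 0"
  and B_loc: "B \<in> L1_loc" and B_adjoint: "AE x in lebesgue. conj_transpose (B x) = B x - vector_derivative J (at x)"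
  and H_loc: "H \<in> L1_loc" and H_pos: "AE x in lebesgue. pos_semidef (H x)"
  using sys by (auto simp: symmetric_system_def)

lemma cinner_J: "cinner (J x *v u) v = - cinner u (J x *v v)"
  by (simp add: cinner_adjoint' J_skew mv.minus_left cinner.minus_right)

lemma J_inj: "J x *v v = 0 \<Longrightarrow> v = 0"
  using det_J[of x] matrix_vector_mul_assoc[of "matrix_inv (J x)" "J x" v]
  by (simp add: invertible_det_nz[symmetric] matrix_inv_left)

text \<open>In the derivative of \<open>cinner f (J g)\<close>, skewness of \<open>J\<close> turns
  the term with \<open>f'\<close> into one with \<open>J f'\<close>, and the relation between
  \<open>B\<close>, its adjoint and \<open>J'\<close> absorbs the derivative of \<open>J\<close>.
  The terms with \<open>B\<close> then cancel.\<close>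

lemma Lagrange:
  assumes ab: "a \<le> b" and f: "abs_continuous_on_interval a b f" and g: "abs_continuous_on_interval a b g"
    and fp: "AE x\<in>{a..b} in lebesgue. J x *v vector_derivative f (at x) + B x *v f x = H x *v p x"
    and gq: "AE x\<in>{a..b} in lebesgue. J x *v vector_derivative g (at x) + B x *v g x = H x *v q x"
  shows "((\<lambda>x. cinner (f x) (H x *v q x) - cinner (p x) (H x *v g x)) has_integral
    (cinner (f b) (J b *v g b) - cinner (f a) (J a *v g a))) {a..b}"
proof (rule abs_continuous_FTC_AE[OF ab])
  have J: "abs_continuous_on_interval a b J" using J_AC ab by (auto simp: AC_def)
  show "abs_continuous_on_interval a b (\<lambda>x. cinner (f x) (J x *v g x))"
    by (rule abs_continuous_bilinear[OF bounded_bilinear_cinner f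
          abs_continuous_bilinear[OF bounded_bilinear_matrix_vector J g]])
  show "AE x\<in>{a..b} in lebesgue. ((\<lambda>x. cinner (f x) (J x *v g x)) has_vector_derivative
         vector_derivative (\<lambda>x. cinner (f x) (J x *v g x)) (at x)) (at x) \<longrightarrow>
       ((\<lambda>x. cinner (f x) (J x *v g x)) has_vector_derivative
         cinner (f x) (H x *v q x) - cinner (p x) (H x *v g x)) (at x)"
    using fp gq abs_continuous_differentiable_AE[OF ab f] abs_continuous_differentiable_AE[OF ab g]
      abs_continuous_differentiable_AE[OF ab J] B_adjoint H_pos
  proof eventually_elim
    case (elim x)
    show ?case
    proof (intro impI)
      assume x: "x \<in> {a..b}"
      define f' g' J' where "f' = vector_derivative f (at x)" and "g' = vector_derivative g (at x)"
        and "J' = vector_derivative J (at x)"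
      have "((\<lambda>x. cinner (f x) (J x *v g x)) has_vector_derivative
        (cinner (f x) (J x *v g' + J' *v g x) + cinner f' (J x *v g x))) (at x)"
        unfolding f'_def g'_def J'_def using elim x
        by (intro cinner.has_vector_derivative mv.has_vector_derivative) auto
      moreover have "J x *v g' = H x *v q x - B x *v g x" "J x *v f' = H x *v p x - B x *v f x"
        using elim(1,2) x by (auto simp: f'_def g'_def algebra_simps)
      moreover have "cinner f' (J x *v g x) = - cinner (J x *v f') (g x)" by (simp add: cinner_J)
      moreover have "cinner (B x *v f x) (g x) = cinner (f x) (B x *v g x) - cinner (f x) (J' *v g x)"
        using elim(6) by (simp add: cinner_adjoint' J'_def mv.diff_left cinner.diff_right)
      moreover have "cinner (H x *v p x) (g x) = cinner (p x) (H x *v g x)"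
        using elim(7) by (simp add: cinner_adjoint' pos_semidef_def)
      ultimately show "((\<lambda>x. cinner (f x) (J x *v g x)) has_vector_derivative
         cinner (f x) (H x *v q x) - cinner (p x) (H x *v g x)) (at x)"
        by (simp add: cinner.diff_right cinner.diff_left cinner.add_right algebra_simps)
    qed
  qed
qed

section \<open>Fundamental matrix, conserved pairing and uniqueness\<close>

definition coeff :: "complex \<Rightarrow> real \<Rightarrow> complex^'n^'n" where
  "coeff z x = matrix_inv (J x) ** (mat z ** H x - B x)"

lemma coeff_loc: "coeff z \<in> L1_loc"
proof -
  have "(\<lambda>x. mat z ** H x - B x) \<in> L1_loc"
    by (intro L1_loc_diff B_loc L1_loc_bounded_linear[OF _ H_loc]
        bounded_bilinear.bounded_linear_right[OF bounded_bilinear_matrix_matrix])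
  then show ?thesis
    unfolding coeff_def
    using L1_loc_bilinear_continuous[OF bounded_bilinear.flip[OF bounded_bilinear_matrix_matrix] _
        continuous_on_matrix_inv[OF AC_imp_continuous_on_UNIV[OF J_AC] det_J]] by blast
qed

definition fund :: "complex \<Rightarrow> real \<Rightarrow> complex^'n^'n" where
  "fund z = (SOME Y. Y 0 = mat 1 \<and> Y \<in> AC UNIV \<and>
     (AE x in lebesgue. (Y has_vector_derivative coeff z x ** Y x) (at x)))"

lemma fund: "fund z 0 = mat 1" "fund z \<in> AC UNIV"
  "AE x in lebesgue. (fund z has_vector_derivative coeff z x ** fund z x) (at x)"
proof -
  obtain Y :: "real \<Rightarrow> complex^'n^'n" where "Y 0 = mat 1" "Y \<in> AC UNIV"
     "AE x in lebesgue. (Y has_vector_derivative coeff z x ** Y x) (at x)"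
    using linear_ode_solution[OF bounded_bilinear_matrix_matrix coeff_loc[of z], of "mat 1"] by blast
  then have "\<exists>Y. Y 0 = mat 1 \<and> Y \<in> AC UNIV \<and>
     (AE x in lebesgue. (Y has_vector_derivative coeff z x ** Y x) (at x))" by blast
  from someI_ex[OF this] show "fund z 0 = mat 1" "fund z \<in> AC UNIV"
    "AE x in lebesgue. (fund z has_vector_derivative coeff z x ** fund z x) (at x)"
    unfolding fund_def by auto
qed

definition sol :: "complex \<Rightarrow> complex^'n \<Rightarrow> real \<Rightarrow> complex^'n" where
  "sol z v x = fund z x *v v"

lemma sol_0 [simp]: "sol z v 0 = v"
  by (simp add: sol_def fund)

lemma sol_sum: "sol z (\<Sum>i\<in>I. c i *s f i) x = (\<Sum>i\<in>I. c i *s sol z (f i) x)"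
  by (simp add: sol_def matrix_vector_sum)

lemma sol_diff: "sol z (u - v) x = sol z u x - sol z v x"
  by (simp add: sol_def mv.diff_right)

lemma sol_add: "sol z (u + v) x = sol z u x + sol z v x"
  by (simp add: sol_def mv.add_right)

lemma sol_scale: "sol z (c *s v) x = c *s sol z v x"
  by (simp add: sol_def matrix_vector_scale)

lemma sol_abs_continuous: "abs_continuous_on_interval a b (sol z v)"
proof (cases "a \<le> b")
  case True
  then have "abs_continuous_on_interval a b (fund z)" using fund(2)[of z] by (auto simp: AC_def)
  then show ?thesis
    unfolding sol_def by (rule abs_continuous_bounded_linear[OF mv.bounded_linear_left])
next
  case False
  then have "nonoverlapping a b D \<Longrightarrow> D = {}" for D by (auto simp: nonoverlapping_def)
  then show ?thesis unfolding abs_continuous_alt by (metis sum.empty zero_less_one)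
qed

lemma sol_AC: "sol z v \<in> AC I"
  using sol_abs_continuous by (auto simp: AC_def)

lemma sol_continuous: "continuous_on UNIV (sol z v)"
  by (rule AC_imp_continuous_on_UNIV[OF sol_AC])

lemma sol_eq_AE: "AE x in lebesgue. (sol z v has_vector_derivative vector_derivative (sol z v) (at x)) (at x) \<and>
    J x *v vector_derivative (sol z v) (at x) + B x *v sol z v x = H x *v (z *s sol z v x)"
  using fund(3)[of z]
proof eventually_elim
  case (elim x)
  have "(sol z v has_vector_derivative (coeff z x ** fund z x) *v v) (at x)"
    unfolding sol_def by (rule bounded_linear.has_vector_derivative[OF mv.bounded_linear_left elim])
  then have d: "(sol z v has_vector_derivative coeff z x *v sol z v x) (at x)"
    by (simp add: sol_def matrix_vector_mul_assoc)
  have "J x ** coeff z x = mat z ** H x - B x"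
    using det_J[of x] by (simp add: coeff_def matrix_mul_assoc matrix_inv_right invertible_det_nz[symmetric])
  then have "J x *v (coeff z x *v sol z v x) = z *s (H x *v sol z v x) - B x *v sol z v x"
    by (simp add: matrix_vector_mul_assoc mv.diff_left mat_matrix_vector)
  then show ?case using d vector_derivative_at[OF d] by (simp add: matrix_vector_scale)
qed

lemma sol_system_eq: "system_eq J B H I (sol z v) (\<lambda>x. z *s sol z v x)"
  unfolding system_eq_def using sol_eq_AE[of z v] by eventually_elim auto

lemma system_eqD: "system_eq J B H I f g \<Longrightarrow> S \<subseteq> I \<Longrightarrow>
   AE x\<in>S in lebesgue. J x *v vector_derivative f (at x) + B x *v f x = H x *v g x"
proof -
  assume eq: "system_eq J B H I f g" and sub: "S \<subseteq> I"
  show "AE x\<in>S in lebesgue. J x *v vector_derivative f (at x) + B x *v f x = H x *v g x"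
    using eq unfolding system_eq_def by eventually_elim (use sub in auto)
qed

lemma sol_Lagrange:
  assumes ab: "a \<le> b" and f: "abs_continuous_on_interval a b f"
    and fp: "AE x\<in>{a..b} in lebesgue. J x *v vector_derivative f (at x) + B x *v f x = H x *v p x"
  shows "((\<lambda>x. cinner (sol z v x) (H x *v p x) - cnj z * cinner (sol z v x) (H x *v f x)) has_integral
    (cinner (sol z v b) (J b *v f b) - cinner (sol z v a) (J a *v f a))) {a..b}"
  using Lagrange[OF ab sol_abs_continuous f system_eqD[OF sol_system_eq subset_refl] fp] by simp

text \<open>For conjugate spectral parameters the two integrands in Lagrange's identity
  cancel.\<close>

lemma sol_wronskian_const:
  assumes ab: "a \<le> b" and f: "abs_continuous_on_interval a b f"
    and fp: "AE x\<in>{a..b} in lebesgue. J x *v vector_derivative f (at x) + B x *v f x = H x *v (cnj z *s f x)"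
  shows "cinner (sol z v b) (J b *v f b) = cinner (sol z v a) (J a *v f a)"
  using has_integral_unique[OF sol_Lagrange[OF assms, where v=v and z=z]] by (simp add: matrix_vector_scale)

text \<open>This conservation law takes over the part of Liouville's formula and Gronwall's
  inequality: as \<open>J 0\<close> is invertible, it yields the invertibility of
  \<open>fund z x\<close> and then uniqueness.\<close>

lemma sol_wronskian: "cinner (sol z u x) (J x *v sol (cnj z) v x) = cinner u (J 0 *v v)"
proof (cases "0 \<le> x")
  case True
  show ?thesis
    using sol_wronskian_const[OF True sol_abs_continuous system_eqD[OF sol_system_eq subset_refl], of z u v] by simp
next
  case False
  then have "x \<le> 0" by simp
  from sol_wronskian_const[OF this sol_abs_continuous system_eqD[OF sol_system_eq subset_refl], of z u v]
  show ?thesis by simp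
qed

lemma sol_inj: "sol z v x = 0 \<Longrightarrow> v = 0"
proof -
  assume s: "sol z v x = 0"
  have "cinner u (J 0 *v v) = 0" for u using sol_wronskian[of "cnj z" u x v] s by (simp add: mv.zero_right cinner.zero_right)
  then show "v = 0" using cinner_eq_zeroI J_inj by blast
qed

lemma fund_invertible: "invertible (fund z x)"
proof -
  have "inj ((*v) (fund z x))"
  proof (rule injI)
    fix u v assume "fund z x *v u = fund z x *v v"
    then have "sol z (u - v) x = 0" by (simp add: sol_diff) (simp add: sol_def)
    then have "u - v = 0" by (rule sol_inj)
    then show "u = v" by simp
  qed
  then show ?thesis using matrix_left_invertible_injective invertible_left_inverse by blast
qed

lemma sol_surj: "\<exists>v. sol z v x = u"
proof -
  have "sol z (matrix_inv (fund z x) *v u) x = u"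
    by (simp add: sol_def matrix_vector_mul_assoc matrix_inv_right[OF fund_invertible])
  then show ?thesis by blast
qed

text \<open>Both \<open>f\<close> and \<open>sol z (f 0)\<close> have the same pairing at
  \<open>x\<close> with every solution for \<open>cnj z\<close>, and those solutions take all values
  at \<open>x\<close>. The condition on \<open>{a,b}\<close> treats both sides of \<open>0\<close>
  at once.\<close>

lemma sol_unique_aux:
  assumes ab: "a \<le> b" "{a,b} = {0,x}" and f: "abs_continuous_on_interval a b f"
    and fz: "AE x\<in>{a..b} in lebesgue. J x *v vector_derivative f (at x) + B x *v f x = H x *v (z *s f x)"
  shows "f x = sol z (f 0) x"
proof -
  have "cinner (sol (cnj z) u x) (J x *v (f x - sol z (f 0) x)) = 0" for u
  proof -
    have "cinner (sol (cnj z) u b) (J b *v f b) = cinner (sol (cnj z) u a) (J a *v f a)"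
      by (rule sol_wronskian_const[OF ab(1) f]) (use fz in simp)
    then have "cinner (sol (cnj z) u x) (J x *v f x) = cinner u (J 0 *v f 0)"
      using ab(2) by (auto simp: doubleton_eq_iff)
    then show ?thesis using sol_wronskian[of "cnj z" u x "f 0"]
      by (simp add: mv.diff_right cinner.diff_right)
  qed
  then have "cinner u (J x *v (f x - sol z (f 0) x)) = 0" for u
    using sol_surj[of "cnj z" x u] by metis
  then have "f x - sol z (f 0) x = 0" using cinner_eq_zeroI J_inj by blast
  then show ?thesis by simp
qed

lemma sol_unique:
  assumes I: "is_interval I" "0 \<in> I" and f: "f \<in> AC I" and fz: "system_eq J B H I f (\<lambda>x. z *s f x)"
    and x: "x \<in> I"
  shows "f x = sol z (f 0) x"
proof -
  have sub: "{min 0 x..max 0 x} \<subseteq> I"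
  proof
    fix y assume y: "y \<in> {min 0 x..max 0 x}"
    have "min 0 x \<in> I" "max 0 x \<in> I" using I(2) x by (auto simp: min_def max_def)
    then show "y \<in> I" using I(1) y unfolding is_interval_1 by (meson atLeastAtMost_iff)
  qed
  show ?thesis
  proof (rule sol_unique_aux[where a="min 0 x" and b="max 0 x"])
    show "min 0 x \<le> max 0 x" by simp
    show "{min 0 x, max 0 x} = {0, x}" by (cases "0 \<le> x") (simp_all add: insert_commute min_def max_def)
    show "abs_continuous_on_interval (min 0 x) (max 0 x) f" using f sub by (auto simp: AC_def)
    show "AE y\<in>{min 0 x..max 0 x} in lebesgue. J y *v vector_derivative f (at y) + B y *v f y = H y *v (z *s f y)"
      by (rule system_eqD[OF fz sub])
  qed
qed

end

section \<open>The semi-inner product of L2H\<close>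

lemma L1_loc_borel_measurable:
  assumes "f \<in> L1_loc"
  shows "f \<in> borel_measurable lebesgue"
proof (rule borel_measurable_LIMSEQ_metric)
  show "(\<lambda>x. indicator {- real n..real n} x *\<^sub>R f x) \<in> borel_measurable lebesgue" for n :: nat
    using assms unfolding L1_loc_def set_integrable_def by (auto intro: borel_measurable_integrable)
  show "(\<lambda>n. indicator {- real n..real n} x *\<^sub>R f x) \<longlonglongrightarrow> f x" if "x \<in> space lebesgue" for x
  proof (rule tendsto_eventually)
    obtain N where "\<bar>x\<bar> \<le> real N" using real_arch_simple by blast
    then show "\<forall>\<^sub>F n in sequentially. indicator {- real n..real n} x *\<^sub>R f x = f x"
      unfolding eventually_sequentially by (intro exI[of _ N]) (auto simp: indicator_def)
  qed
qed

lemma AC_continuous_on: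
  assumes I: "I \<in> {UNIV, {0..}, {..0}}" and f: "f \<in> AC I"
  shows "continuous_on I f"
  unfolding continuous_on_eq_continuous_within
proof
  fix x assume x: "x \<in> I"
  obtain a b where ab: "I \<inter> {x - 1..x + 1} = {a..b}" "a \<le> b" "{a..b} \<subseteq> I"
  proof -
    consider "I = UNIV" | "I = {0..}" | "I = {..0}" using I by blast
    then show thesis
    proof cases
      case 1 show thesis by (rule that[of "x-1" "x+1"]) (use 1 in auto)
    next
      case 2 show thesis by (rule that[of "max 0 (x-1)" "x+1"]) (use 2 x in auto)
    next
      case 3 show thesis by (rule that[of "x-1" "min 0 (x+1)"]) (use 3 x in auto)
    qed
  qed
  have "continuous_on {a..b} f"
    by (rule abs_continuous_imp_continuous) (use f ab in \<open>auto simp: AC_def\<close>)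
  moreover have "x \<in> {a..b}" using ab(1) x by auto
  ultimately have "continuous (at x within I \<inter> {x - 1..x + 1}) f"
    unfolding ab(1) continuous_on_eq_continuous_within by blast
  moreover have "at x within I \<inter> {x - 1..x + 1} = at x within I"
    by (rule at_within_nhd[of x "{x - 1<..<x + 1}"]) auto
  ultimately show "continuous (at x within I) f" by simp
qed

lemma compact_in_interior_interval:
  assumes I: "I \<in> {UNIV, {0..}, {..0::real}}" and K: "compact K" "K \<subseteq> interior I"
  obtains a b where "a < b" "{a..b} \<subseteq> I" "K \<subseteq> {a<..<b}"
proof -
  obtain R where R: "R > 0" "\<And>x. x \<in> K \<Longrightarrow> \<bar>x\<bar> < R"
  proof -
    obtain r where r: "\<forall>x\<in>K. norm x \<le> r" using K(1) compact_imp_bounded bounded_iff by blast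
    show thesis by (rule that[of "\<bar>r\<bar> + 1"]) (use r in force)+
  qed
  consider "I = UNIV" | "I = {0..}" | "I = {..0}" using I by blast
  then show thesis
  proof cases
    case 1 show thesis by (rule that[of "-R" R]) (use 1 R in \<open>force simp: abs_less_iff\<close>)+
  next
    case 2
    then have "\<And>x. x \<in> K \<Longrightarrow> 0 < x" using K(2) by (auto simp: interior_real_atLeast)
    then show thesis by (intro that[of 0 R]) (use 2 R in \<open>force simp: abs_less_iff\<close>)+
  next
    case 3
    then have "\<And>x. x \<in> K \<Longrightarrow> x < 0" using K(2) by (auto simp: interior_real_atMost)
    then show thesis by (intro that[of "-R" 0]) (use 3 R in \<open>force simp: abs_less_iff\<close>)+
  qed
qed

context first_order_system
begin

definition hform :: "(real \<Rightarrow> complex^'n) \<Rightarrow> (real \<Rightarrow> complex^'n) \<Rightarrow> real \<Rightarrow> complex" where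
  "hform f g x = cinner (f x) (H x *v g x)"

text \<open>The quantifier over \<open>f\<close> and \<open>g\<close> stands inside the almost
  everywhere statement: the exceptional set is where \<open>H x\<close> fails to be positive
  semi-definite, and it depends on no function.\<close>

lemma hform_AE: "AE x in lebesgue. \<forall>f g. hform f g x = cnj (hform g f x) \<and> 0 \<le> Re (hform f f x) \<and>
    hform f f x = of_real (Re (hform f f x)) \<and>
    2 * cmod (hform f g x) \<le> Re (hform f f x) + Re (hform g g x) \<and>
    (hform f f x = 0 \<longleftrightarrow> H x *v f x = 0)"
  using H_pos
proof eventually_elim
  case (elim x)
  then show ?case unfolding hform_def
    using pos_semidef_hermitian[OF elim] pos_semidef_nonneg[OF elim] pos_semidef_real[OF elim]
      pos_semidef_arith_mean[OF elim] pos_semidef_null[OF elim] by (metis cinner.zero_right zero_complex.simps(1))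
qed

lemma hform_add_left: "hform (\<lambda>x. f x + g x) k x = hform f k x + hform g k x"
  and hform_add_right: "hform k (\<lambda>x. f x + g x) x = hform k f x + hform k g x"
  and hform_diff_left: "hform (\<lambda>x. f x - g x) k x = hform f k x - hform g k x"
  and hform_diff_right: "hform k (\<lambda>x. f x - g x) x = hform k f x - hform k g x"
  and hform_scale_left: "hform (\<lambda>x. c *s f x) k x = cnj c * hform f k x"
  and hform_scale_right: "hform k (\<lambda>x. c *s f x) x = c * hform k f x"
  by (simp_all add: hform_def cinner.add_left cinner.add_right cinner.diff_left cinner.diff_right
      mv.add_right mv.diff_right matrix_vector_scale)

lemma hform_measurable:
  assumes I: "I \<in> sets borel" and f: "f \<in> borel_measurable (restrict_space borel I)"
    and g: "g \<in> borel_measurable (restrict_space borel I)"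
  shows "(\<lambda>x. indicator I x *\<^sub>R hform f g x) \<in> borel_measurable lebesgue"
proof -
  have *: "(\<lambda>x. indicator I x *\<^sub>R f x) \<in> borel_measurable lebesgue"
    if "f \<in> borel_measurable (restrict_space borel I)" for f :: "real \<Rightarrow> complex^'n"
  proof -
    have "(\<lambda>x. indicator I x *\<^sub>R f x) \<in> borel_measurable borel"
      using that I by (subst (asm) borel_measurable_restrict_space_iff) (auto simp: mult.commute)
    then have "(\<lambda>x. indicator I x *\<^sub>R f x) \<in> borel_measurable lborel" by simp
    then show ?thesis by (rule measurable_completion)
  qed
  have c1: "continuous_on UNIV (\<lambda>p. fst p *v snd p :: complex^'n)" for p :: "(complex^'n^'n) \<times> (complex^'n)"
    by (intro mv.continuous_on continuous_intros)
  have c2: "continuous_on UNIV (\<lambda>p. cinner (fst p) (snd p :: complex^'n))"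
    by (intro cinner.continuous_on continuous_intros)
  have "(\<lambda>x. H x *v (indicator I x *\<^sub>R g x)) \<in> borel_measurable lebesgue"
    by (rule borel_measurable_continuous_Pair[OF L1_loc_borel_measurable[OF H_loc] *[OF g] c1])
  from borel_measurable_continuous_Pair[OF *[OF f] this c2]
  have "(\<lambda>x. cinner (indicator I x *\<^sub>R f x) (H x *v (indicator I x *\<^sub>R g x))) \<in> borel_measurable lebesgue" .
  also have "(\<lambda>x. cinner (indicator I x *\<^sub>R f x) (H x *v (indicator I x *\<^sub>R g x))) = (\<lambda>x. indicator I x *\<^sub>R hform f g x)"
    by (auto simp: indicator_def hform_def cinner.zero_left)
  finally show ?thesis .
qed

lemma L2H_iff: "f \<in> L2H H I \<longleftrightarrow> f \<in> borel_measurable (restrict_space borel I) \<and> set_integrable lebesgue I (hform f f)"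
  by (simp add: L2H_def hform_def[abs_def])

lemma innerH_eq: "innerH H I f g = (LINT x:I|lebesgue. hform f g x)"
  by (simp add: innerH_def hform_def)

lemma L2H_hform_integrable:
  assumes I: "I \<in> sets borel" and f: "f \<in> L2H H I" and g: "g \<in> L2H H I"
  shows "set_integrable lebesgue I (hform f g)"
  unfolding set_integrable_def
proof (rule Bochner_Integration.integrable_bound)
  have "set_integrable lebesgue I (\<lambda>x. hform f f x + hform g g x)"
    using f g by (simp add: L2H_iff)
  then show "integrable lebesgue (\<lambda>x. indicator I x *\<^sub>R (hform f f x + hform g g x))"
    by (simp add: set_integrable_def)
  show "(\<lambda>x. indicator I x *\<^sub>R hform f g x) \<in> borel_measurable lebesgue"
    using hform_measurable[OF I] f g by (simp add: L2H_iff)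
  show "AE x in lebesgue. norm (indicator I x *\<^sub>R hform f g x) \<le> norm (indicator I x *\<^sub>R (hform f f x + hform g g x))"
    using hform_AE
  proof eventually_elim
    case (elim x)
    have "cmod (hform f g x) \<le> Re (hform f f x) + Re (hform g g x)"
      using elim norm_ge_zero[of "hform f g x"] by (smt (verit))
    also have "\<dots> = Re (hform f f x + hform g g x)" by simp
    also have "\<dots> \<le> cmod (hform f f x + hform g g x)" by (rule complex_Re_le_cmod)
    finally show ?case by (auto simp: indicator_def)
  qed
qed

lemma L2H_add:
  assumes "I \<in> sets borel" "f \<in> L2H H I" "g \<in> L2H H I"
  shows "(\<lambda>x. f x + g x) \<in> L2H H I"
proof -
  have "hform (\<lambda>x. f x + g x) (\<lambda>x. f x + g x) = (\<lambda>x. (hform f f x + hform f g x) + (hform g f x + hform g g x))"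
    by (rule ext) (simp add: hform_add_left hform_add_right)
  then show ?thesis
    using L2H_hform_integrable[of I f g] L2H_hform_integrable[of I g f] assms
    by (auto simp: L2H_iff)
qed

lemma L2H_scale:
  assumes "f \<in> L2H H I" shows "(\<lambda>x. c *s f x) \<in> L2H H I"
proof -
  have "bounded_linear (\<lambda>v. c *s v :: complex^'n)"
  proof -
    have "linear (\<lambda>v. c *s v :: complex^'n)"
      by (rule linearI) (simp_all add: vec_eq_iff algebra_simps)
    then show ?thesis by (simp add: linear_conv_bounded_linear)
  qed
  then have "continuous_on UNIV (\<lambda>v. c *s v :: complex^'n)"
    by (intro linear_continuous_on)
  then have "(\<lambda>v. c *s v :: complex^'n) \<in> borel_measurable borel" by (rule borel_measurable_continuous_onI)
  moreover have "f \<in> borel_measurable (restrict_space borel I)" using assms by (simp add: L2H_iff)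
  ultimately have "(\<lambda>x. c *s f x) \<in> borel_measurable (restrict_space borel I)"
    by (rule measurable_compose[rotated])
  moreover have "hform (\<lambda>x. c *s f x) (\<lambda>x. c *s f x) = (\<lambda>x. cnj c * (c * hform f f x))"
    by (rule ext) (simp add: hform_scale_left hform_scale_right)
  ultimately show ?thesis
    using assms by (simp add: L2H_iff)
qed

lemma L2H_diff: "I \<in> sets borel \<Longrightarrow> f \<in> L2H H I \<Longrightarrow> g \<in> L2H H I \<Longrightarrow> (\<lambda>x. f x - g x) \<in> L2H H I"
  using L2H_add[of I f "\<lambda>x. (-1) *s g x"] L2H_scale[of g I "-1"] by (simp add: vec_eq_iff)

lemma L2H_zero: "(\<lambda>x. 0) \<in> L2H H I"
  by (simp add: L2H_iff set_integrable_def hform_def cinner.zero_left)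

lemma L2H_sum:
  "I \<in> sets borel \<Longrightarrow> (\<And>f. f \<in> F \<Longrightarrow> r f \<in> L2H H I) \<Longrightarrow> (\<lambda>x. \<Sum>f\<in>F. r f x) \<in> L2H H I"
  by (induction F rule: infinite_finite_induct) (auto simp: L2H_zero intro!: L2H_add)

context
  fixes I :: "real set"
  assumes I: "I \<in> sets borel"
begin

lemma innerH_add_left: "f \<in> L2H H I \<Longrightarrow> g \<in> L2H H I \<Longrightarrow> k \<in> L2H H I \<Longrightarrow>
    innerH H I (\<lambda>x. f x + g x) k = innerH H I f k + innerH H I g k"
  and innerH_add_right: "f \<in> L2H H I \<Longrightarrow> g \<in> L2H H I \<Longrightarrow> k \<in> L2H H I \<Longrightarrow>
    innerH H I k (\<lambda>x. f x + g x) = innerH H I k f + innerH H I k g"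
  and innerH_diff_left: "f \<in> L2H H I \<Longrightarrow> g \<in> L2H H I \<Longrightarrow> k \<in> L2H H I \<Longrightarrow>
    innerH H I (\<lambda>x. f x - g x) k = innerH H I f k - innerH H I g k"
  and innerH_diff_right: "f \<in> L2H H I \<Longrightarrow> g \<in> L2H H I \<Longrightarrow> k \<in> L2H H I \<Longrightarrow>
    innerH H I k (\<lambda>x. f x - g x) = innerH H I k f - innerH H I k g"
  by (simp_all add: innerH_eq hform_add_left hform_add_right hform_diff_left hform_diff_right
      set_integral_add set_integral_diff L2H_hform_integrable[OF I])

lemma innerH_scale_left: "innerH H I (\<lambda>x. c *s f x) k = cnj c * innerH H I f k"
  and innerH_scale_right: "innerH H I k (\<lambda>x. c *s f x) = c * innerH H I k f"
  by (simp_all add: innerH_eq hform_scale_left hform_scale_right)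

lemma innerH_cnj:
  assumes "f \<in> L2H H I" "g \<in> L2H H I"
  shows "innerH H I f g = cnj (innerH H I g f)"
proof -
  have "innerH H I f g = (LINT x:I|lebesgue. cnj (hform g f x))"
    unfolding innerH_eq set_lebesgue_integral_def
  proof (rule integral_cong_AE)
    show "(\<lambda>x. indicator I x *\<^sub>R hform f g x) \<in> borel_measurable lebesgue"
      using hform_measurable[OF I] assms by (simp add: L2H_iff)
    have "(\<lambda>x. cnj (indicator I x *\<^sub>R hform g f x)) \<in> borel_measurable lebesgue"
      using hform_measurable[OF I, of g f] assms
      by (intro measurable_compose[OF _ borel_measurable_continuous_onI[OF continuous_on_cnj[OF continuous_on_id]]])
        (simp add: L2H_iff)
    then show "(\<lambda>x. indicator I x *\<^sub>R cnj (hform g f x)) \<in> borel_measurable lebesgue" by simp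
    show "AE x in lebesgue. indicator I x *\<^sub>R hform f g x = indicator I x *\<^sub>R cnj (hform g f x)"
      using hform_AE
    proof eventually_elim
      case (elim x) then have "hform f g x = cnj (hform g f x)" by blast
      then show ?case by simp
    qed
  qed
  also have "\<dots> = (LINT x|lebesgue. cnj (indicator I x *\<^sub>R hform g f x))"
    by (simp add: set_lebesgue_integral_def)
  also have "\<dots> = cnj (innerH H I g f)"
    unfolding innerH_eq set_lebesgue_integral_def by (rule Bochner_Integration.integral_cnj)
  finally show ?thesis .
qed

lemma innerH_self_nonneg: "f \<in> L2H H I \<Longrightarrow> 0 \<le> Re (innerH H I f f)"
  and innerH_self_zero_iff: "f \<in> L2H H I \<Longrightarrow> Re (innerH H I f f) = 0 \<longleftrightarrow> (AE x\<in>I in lebesgue. H x *v f x = 0)"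
proof -
  assume f: "f \<in> L2H H I"
  have int: "integrable lebesgue (\<lambda>x. indicator I x *\<^sub>R hform f f x)"
    using f by (simp add: L2H_iff set_integrable_def)
  have eq: "Re (innerH H I f f) = (LINT x|lebesgue. Re (indicator I x *\<^sub>R hform f f x))"
    unfolding innerH_eq set_lebesgue_integral_def by (rule integral_Re[OF int, symmetric])
  have nn: "AE x in lebesgue. 0 \<le> Re (indicator I x *\<^sub>R hform f f x)"
    using hform_AE
  proof eventually_elim
    case (elim x)
    then have "0 \<le> Re (hform f f x)" by blast
    then show ?case by (simp add: indicator_def)
  qed
  show "0 \<le> Re (innerH H I f f)" unfolding eq by (rule integral_nonneg_AE[OF nn])
  have intr: "integrable lebesgue (\<lambda>x. Re (indicator I x *\<^sub>R hform f f x))"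
    by (rule integrable_Re[OF int])
  have "Re (innerH H I f f) = 0 \<longleftrightarrow> (AE x in lebesgue. Re (indicator I x *\<^sub>R hform f f x) = 0)"
    unfolding eq by (rule integral_nonneg_eq_0_iff_AE[OF intr nn])
  also have "\<dots> \<longleftrightarrow> (AE x\<in>I in lebesgue. H x *v f x = 0)"
  proof
    assume "AE x in lebesgue. Re (indicator I x *\<^sub>R hform f f x) = 0"
    then show "AE x\<in>I in lebesgue. H x *v f x = 0"
      using hform_AE
    proof eventually_elim
      case (elim x)
      show ?case
      proof
        assume "x \<in> I"
        then have "Re (hform f f x) = 0" using elim(1) by simp
        then have "hform f f x = 0" using elim(2) by (metis of_real_0)
        then show "H x *v f x = 0" using elim(2) by blast
      qed
    qed
  next
    assume "AE x\<in>I in lebesgue. H x *v f x = 0"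
    then show "AE x in lebesgue. Re (indicator I x *\<^sub>R hform f f x) = 0"
      by eventually_elim (auto simp: indicator_def hform_def cinner.zero_right)
  qed
  finally show "Re (innerH H I f f) = 0 \<longleftrightarrow> (AE x\<in>I in lebesgue. H x *v f x = 0)" .
qed

lemma normH_zero_iff: "f \<in> L2H H I \<Longrightarrow> normH H I f = 0 \<longleftrightarrow> (AE x\<in>I in lebesgue. H x *v f x = 0)"
  by (simp add: normH_def innerH_self_zero_iff)

lemma normH_nonneg: "f \<in> L2H H I \<Longrightarrow> 0 \<le> normH H I f"
  using innerH_self_nonneg by (simp add: normH_def)

lemma innerH_Cauchy_Schwarz:
  assumes f: "f \<in> L2H H I" and g: "g \<in> L2H H I"
  shows "cmod (innerH H I f g) \<le> normH H I f * normH H I g"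
proof -
  have "(cmod (innerH H I f g))\<^sup>2 \<le> Re (innerH H I f f) * Re (innerH H I g g)"
  proof (rule real_quadratic_nonneg_discriminant)
    fix t :: real
    define s where "s = innerH H I g f"
    have fg: "innerH H I f g = cnj s" unfolding s_def by (rule innerH_cnj[OF f g])
    have gg: "innerH H I g g = of_real (Re (innerH H I g g))"
      using innerH_cnj[OF g g] by (simp add: complex_eq_iff)
    have tg: "(\<lambda>x. (of_real t * s) *s g x) \<in> L2H H I" by (rule L2H_scale[OF g])
    have "0 \<le> Re (innerH H I (\<lambda>x. f x - (of_real t * s) *s g x) (\<lambda>x. f x - (of_real t * s) *s g x))"
      by (rule innerH_self_nonneg[OF L2H_diff[OF I f tg]])
    also have "innerH H I (\<lambda>x. f x - (of_real t * s) *s g x) (\<lambda>x. f x - (of_real t * s) *s g x) =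
       innerH H I f f - of_real t * s * cnj s - of_real t * cnj s * s + of_real t * of_real t * s * cnj s * innerH H I g g"
      using f g tg L2H_diff[OF I f tg]
      by (simp add: innerH_diff_left innerH_diff_right innerH_scale_left innerH_scale_right fg s_def[symmetric] algebra_simps)
    also have "\<dots> = innerH H I f f - 2 * of_real t * of_real ((cmod s)\<^sup>2) + of_real (t\<^sup>2) * of_real ((cmod s)\<^sup>2) * innerH H I g g"
      unfolding complex_norm_square by (simp add: power2_eq_square algebra_simps)
    also have "Re \<dots> = Re (innerH H I f f) - 2 * t * (cmod (innerH H I f g))\<^sup>2 + t\<^sup>2 * (cmod (innerH H I f g))\<^sup>2 * Re (innerH H I g g)"
      using fg by (simp add: power2_eq_square)
    finally show "0 \<le> Re (innerH H I f f) - 2 * t * (cmod (innerH H I f g))\<^sup>2 + t\<^sup>2 * (cmod (innerH H I f g))\<^sup>2 * Re (innerH H I g g)" .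
  qed (use innerH_self_nonneg f g in auto)
  then have "cmod (innerH H I f g) \<le> sqrt (Re (innerH H I f f) * Re (innerH H I g g))" by (rule real_le_rsqrt)
  then show ?thesis by (simp add: normH_def real_sqrt_mult)
qed

lemma L2_class_self: "f \<in> L2H H I \<Longrightarrow> f \<in> L2_class H I f"
  using L2H_zero normH_zero_iff[OF L2H_zero] by (simp add: L2_class_def mv.zero_right)

lemma L2_class_iff:
  assumes "f \<in> L2H H I" "g \<in> L2H H I"
  shows "g \<in> L2_class H I f \<longleftrightarrow> (AE x\<in>I in lebesgue. H x *v g x = H x *v f x)"
  using normH_zero_iff[OF L2H_diff[OF I assms(2,1)]] assms by (simp add: L2_class_def mv.diff_right)

lemma innerH_cong_class:
  assumes "f \<in> L2H H I" "f' \<in> L2H H I" "g \<in> L2H H I" "g' \<in> L2H H I"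
    and "L2_class H I f = L2_class H I f'" "L2_class H I g = L2_class H I g'"
  shows "innerH H I f g = innerH H I f' g'"
proof -
  have n: "normH H I (\<lambda>x. f x - f' x) = 0" "normH H I (\<lambda>x. g x - g' x) = 0"
    using L2_class_self assms by (auto simp: L2_class_def)
  have "innerH H I (\<lambda>x. f x - f' x) g = 0"
    using innerH_Cauchy_Schwarz[OF L2H_diff[OF I assms(1,2)] assms(3)] n by simp
  moreover have "innerH H I f' (\<lambda>x. g x - g' x) = 0"
    using innerH_Cauchy_Schwarz[OF assms(2) L2H_diff[OF I assms(3,4)]] n by simp
  ultimately show ?thesis using assms by (simp add: innerH_diff_left innerH_diff_right)
qed

end

lemma L2H_compact_support:
  assumes I: "I \<in> sets borel" and f: "continuous_on I f" and K: "compact K" "K \<subseteq> I" "\<And>x. x \<in> I - K \<Longrightarrow> f x = 0"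
  shows "f \<in> L2H H I"
  unfolding L2H_iff
proof
  show fm: "f \<in> borel_measurable (restrict_space borel I)"
    using f by (rule borel_measurable_continuous_on_restrict)
  have "compact (f ` K)" using compact_continuous_image K(1) f K(2) continuous_on_subset by blast
  then obtain M where M: "M \<ge> 0" "\<And>x. x \<in> K \<Longrightarrow> norm (f x) \<le> M"
    by (metis compact_imp_bounded bounded_pos imageI less_imp_le)
  obtain K1 where K1: "K1 > 0" "\<And>u v :: complex^'n. norm (cinner u v) \<le> norm u * norm v * K1"
    using cinner.pos_bounded by blast
  obtain K2 where K2: "K2 > 0" "\<And>A (v :: complex^'n). norm ((A :: complex^'n^'n) *v v) \<le> norm A * norm v * K2"
    using mv.pos_bounded by blast
  obtain R where R: "K \<subseteq> {-R..R}"
  proof -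
    obtain r where "\<forall>x\<in>K. norm x \<le> r" using K(1) compact_imp_bounded bounded_iff by blast
    then show thesis by (intro that[of r]) (auto simp: abs_le_iff)
  qed
  show "set_integrable lebesgue I (hform f f)"
    unfolding set_integrable_def
  proof (rule Bochner_Integration.integrable_bound)
    have "set_integrable lebesgue {-R..R} (\<lambda>x. (M * M * K2 * K1) *\<^sub>R H x)"
      using H_loc by (simp add: L1_loc_def)
    then show "integrable lebesgue (\<lambda>x. indicator {-R..R} x *\<^sub>R ((M * M * K2 * K1) *\<^sub>R H x))"
      by (simp add: set_integrable_def)
    show "(\<lambda>x. indicator I x *\<^sub>R hform f f x) \<in> borel_measurable lebesgue"
      by (rule hform_measurable[OF I fm fm])
    show "AE x in lebesgue. norm (indicator I x *\<^sub>R hform f f x) \<le> norm (indicator {-R..R} x *\<^sub>R ((M * M * K2 * K1) *\<^sub>R H x))"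
    proof (rule AE_I2)
      fix x
      show "norm (indicator I x *\<^sub>R hform f f x) \<le> norm (indicator {-R..R} x *\<^sub>R ((M * M * K2 * K1) *\<^sub>R H x))"
      proof (cases "x \<in> K")
        case True
        have "norm (hform f f x) \<le> norm (f x) * norm (H x *v f x) * K1" unfolding hform_def by (rule K1)
        also have "\<dots> \<le> M * (norm (H x) * M * K2) * K1"
        proof (intro mult_right_mono mult_mono)
          have "norm (H x *v f x) \<le> norm (H x) * norm (f x) * K2" by (rule K2)
          also have "\<dots> \<le> norm (H x) * M * K2" using M True K2(1) by (intro mult_right_mono mult_left_mono) auto
          finally show "norm (H x *v f x) \<le> norm (H x) * M * K2" .
        qed (use M True K1 K2 in auto)
        finally have "norm (hform f f x) \<le> (M * M * K2 * K1) * norm (H x)" by (simp add: algebra_simps)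
        moreover have "x \<in> I" "x \<in> {-R..R}" using True R K(2) by auto
        moreover have "0 \<le> M * M * K2 * K1" using M(1) K1(1) K2(1) by simp
        ultimately show ?thesis by (simp add: indicator_def)
      next
        case False
        then have "indicator I x *\<^sub>R hform f f x = 0"
          using K(3)[of x] by (auto simp: indicator_def hform_def cinner.zero_left)
        then show ?thesis by (simp only: norm_zero norm_ge_zero)
      qed
    qed
  qed
qed

end

section \<open>Square integrable solutions\<close>

text \<open>The map \<open>r\<close> need only be linear modulo \<open>N\<close>, with kernel \<open>N\<close>.\<close>

lemma quotient_dim_eq_dim:
  fixes r :: "(real \<Rightarrow> complex^'n) \<Rightarrow> complex^'n"
  assumes V: "\<And>f. f \<in> A \<Longrightarrow> r f \<in> V" "\<And>v. v \<in> V \<Longrightarrow> \<exists>f\<in>A. r f = v"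
    and N: "\<And>F c. finite F \<Longrightarrow> F \<subseteq> A \<Longrightarrow> (\<lambda>x. \<Sum>f\<in>F. c f *s f x) \<in> N \<longleftrightarrow> (\<Sum>f\<in>F. c f *s r f) = 0"
  shows "quotient_dim A N = enat (vec.dim V)"
  unfolding quotient_dim_def
proof (rule antisym)
  show "(SUP F\<in>{F. finite F \<and> F \<subseteq> A \<and> (\<forall>c. (\<lambda>x. \<Sum>f\<in>F. c f *s f x) \<in> N \<longrightarrow> (\<forall>f\<in>F. c f = 0))}. enat (card F)) \<le> enat (vec.dim V)"
  proof (rule SUP_least)
    fix F assume "F \<in> {F. finite F \<and> F \<subseteq> A \<and> (\<forall>c. (\<lambda>x. \<Sum>f\<in>F. c f *s f x) \<in> N \<longrightarrow> (\<forall>f\<in>F. c f = 0))}"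
    then have F: "finite F" "F \<subseteq> A" and ind: "\<And>c. (\<Sum>f\<in>F. c f *s r f) = 0 \<Longrightarrow> \<forall>f\<in>F. c f = 0"
      using N by auto
    have inj: "inj_on r F"
    proof (rule inj_onI, rule ccontr)
      fix f g assume fg: "f \<in> F" "g \<in> F" "r f = r g" "f \<noteq> g"
      \<comment> \<open>Two different elements with the same image would satisfy a relation with
        coefficients \<open>1\<close> and \<open>-1\<close>.\<close>
      define c :: "(real \<Rightarrow> complex^'n) \<Rightarrow> complex" where "c h = (if h = f then 1 else 0) - (if h = g then 1 else 0)" for h
      have "(\<Sum>h\<in>F. c h *s r h) = (\<Sum>h\<in>F. if h = f then r h else 0) - (\<Sum>h\<in>F. if h = g then r h else 0)"
        unfolding sum_subtractf[symmetric] by (intro sum.cong refl) (auto simp: c_def vec_eq_iff)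
      also have "\<dots> = 0" using fg F(1) by (simp add: sum.delta)
      finally have "c f = 0" using ind fg(1) by blast
      then show False using fg(4) by (simp add: c_def)
    qed
    have "vec.independent (r ` F)"
      unfolding vec.dependent_finite[OF finite_imageI[OF F(1)]]
    proof
      assume "\<exists>u. (\<exists>v\<in>r ` F. u v \<noteq> 0) \<and> (\<Sum>v\<in>r ` F. u v *s v) = 0"
      then obtain u f where u: "f \<in> F" "u (r f) \<noteq> 0" "(\<Sum>v\<in>r ` F. u v *s v) = 0" by blast
      then have "(\<Sum>f\<in>F. u (r f) *s r f) = 0" by (simp add: sum.reindex[OF inj])
      then show False using ind[of "\<lambda>f. u (r f)"] u by blast
    qed
    then have "card (r ` F) \<le> vec.dim V"
      using V(1) F(2) by (intro vec.independent_card_le_dim) auto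
    then show "enat (card F) \<le> enat (vec.dim V)" by (simp add: card_image[OF inj])
  qed
  obtain B where B: "B \<subseteq> V" "vec.independent B" "card B = vec.dim V"
    using vec.basis_exists[of V] by metis
  have finB: "finite B" using B(2) by (rule vec.finiteI_independent)
  have "\<forall>b\<in>B. \<exists>f. f \<in> A \<and> r f = b" using V(2) B(1) by blast
  then obtain g where g: "\<And>b. b \<in> B \<Longrightarrow> g b \<in> A" "\<And>b. b \<in> B \<Longrightarrow> r (g b) = b" by metis
  have inj: "inj_on g B" using g(2) by (metis inj_onI)
  have "\<forall>f\<in>g ` B. c f = 0" if "(\<lambda>x. \<Sum>f\<in>g ` B. c f *s f x) \<in> N" for c
  proof -
    have "(\<Sum>f\<in>g ` B. c f *s r f) = 0"
      using N[of "g ` B" c] that finB g(1) by auto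
    then have s: "(\<Sum>b\<in>B. c (g b) *s b) = 0" using g(2) by (simp add: sum.reindex[OF inj])
    have "c (g b) = 0" if b: "b \<in> B" for b
    proof (rule ccontr)
      assume "c (g b) \<noteq> 0"
      then have "\<exists>u. (\<exists>v\<in>B. u v \<noteq> 0) \<and> (\<Sum>v\<in>B. u v *s v) = 0"
        using b s by (intro exI[of _ "\<lambda>b. c (g b)"]) blast
      then show False using B(2) by (simp add: vec.dependent_finite[OF finB])
    qed
    then show ?thesis by blast
  qed
  then have "g ` B \<in> {F. finite F \<and> F \<subseteq> A \<and> (\<forall>c. (\<lambda>x. \<Sum>f\<in>F. c f *s f x) \<in> N \<longrightarrow> (\<forall>f\<in>F. c f = 0))}"
    using finB g(1) by auto
  then have "enat (card (g ` B)) \<le> (SUP F\<in>{F. finite F \<and> F \<subseteq> A \<and> (\<forall>c. (\<lambda>x. \<Sum>f\<in>F. c f *s f x) \<in> N \<longrightarrow> (\<forall>f\<in>F. c f = 0))}. enat (card F))"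
    by (rule SUP_upper)
  then show "enat (vec.dim V) \<le> (SUP F\<in>{F. finite F \<and> F \<subseteq> A \<and> (\<forall>c. (\<lambda>x. \<Sum>f\<in>F. c f *s f x) \<in> N \<longrightarrow> (\<forall>f\<in>F. c f = 0))}. enat (card F))"
    by (simp add: card_image[OF inj] B(3))
qed

context first_order_system
begin

lemma sol_measurable: "sol z v \<in> borel_measurable (restrict_space borel I)"
  by (intro measurable_restrict_space1 borel_measurable_continuous_onI sol_continuous)

lemma sol_L2H_Icc: "sol z v \<in> L2H H {a..b}"
  by (rule L2H_compact_support[where K="{a..b}"]) (auto intro: continuous_on_subset[OF sol_continuous])

lemma L2H_subset:
  assumes "f \<in> L2H H L" "K \<subseteq> L" "K \<in> sets borel"
  shows "f \<in> L2H H K"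
  unfolding L2H_iff
proof
  show "f \<in> borel_measurable (restrict_space borel K)"
    by (rule measurable_restrict_mono[of f borel L]) (use assms(1,2) in \<open>auto simp: L2H_iff\<close>)
  show "set_integrable lebesgue K (hform f f)"
    by (rule set_integrable_subset[of _ L]) (use assms in \<open>auto simp: L2H_iff\<close>)
qed

lemma innerH_self_eq:
  assumes "K \<in> sets borel" "f \<in> L2H H K"
  shows "innerH H K f f = of_real (Re (innerH H K f f))"
  using innerH_cnj[OF assms(1,2,2)] by (simp add: complex_eq_iff)

lemma Re_innerH_self:
  assumes "f \<in> L2H H K"
  shows "Re (innerH H K f f) = (LINT x|lebesgue. indicator K x *\<^sub>R Re (hform f f x))"
    and "integrable lebesgue (\<lambda>x. indicator K x *\<^sub>R Re (hform f f x))"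
proof -
  have int: "integrable lebesgue (\<lambda>x. indicator K x *\<^sub>R hform f f x)"
    using assms by (simp add: L2H_iff set_integrable_def)
  have eq: "(\<lambda>x. Re (indicator K x *\<^sub>R hform f f x)) = (\<lambda>x. indicator K x *\<^sub>R Re (hform f f x))" by simp
  show "Re (innerH H K f f) = (LINT x|lebesgue. indicator K x *\<^sub>R Re (hform f f x))"
    unfolding innerH_eq set_lebesgue_integral_def eq[symmetric] by (rule integral_Re[OF int, symmetric])
  show "integrable lebesgue (\<lambda>x. indicator K x *\<^sub>R Re (hform f f x))"
    unfolding eq[symmetric] by (rule integrable_Re[OF int])
qed

lemma hform_nonneg_AE: "AE x in lebesgue. 0 \<le> Re (hform f f x)"
  using hform_AE by eventually_elim blast

lemma innerH_mono:
  assumes "f \<in> L2H H L" "K \<subseteq> L" "K \<in> sets borel"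
  shows "Re (innerH H K f f) \<le> Re (innerH H L f f)"
  unfolding Re_innerH_self(1)[OF assms(1)] Re_innerH_self(1)[OF L2H_subset[OF assms]]
proof (rule integral_mono_AE)
  show "integrable lebesgue (\<lambda>x. indicator K x *\<^sub>R Re (hform f f x))"
    by (rule Re_innerH_self(2)[OF L2H_subset[OF assms]])
  show "integrable lebesgue (\<lambda>x. indicator L x *\<^sub>R Re (hform f f x))"
    by (rule Re_innerH_self(2)[OF assms(1)])
  show "AE x in lebesgue. indicator K x *\<^sub>R Re (hform f f x) \<le> indicator L x *\<^sub>R Re (hform f f x)"
    using hform_nonneg_AE by eventually_elim (use assms(2) in \<open>auto simp: indicator_def\<close>)
qed

text \<open>Monotone convergence. It turns energy bounds on compact intervals that are uniform in
  the interval into square integrability on a half-line.\<close>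

lemma L2H_exhaust:
  assumes I: "I \<in> sets borel" and f: "f \<in> borel_measurable (restrict_space borel I)"
    and K: "incseq K" "\<And>n. K n \<in> sets borel" "(\<Union>n. K n) = I"
    and fK: "\<And>n::nat. f \<in> L2H H (K n)" "\<And>n. Re (innerH H (K n) f f) \<le> M"
  shows "f \<in> L2H H I"
proof -
  define u where "u x = indicator I x *\<^sub>R Re (hform f f x)" for x
  have um: "u \<in> borel_measurable lebesgue"
  proof -
    have "(\<lambda>x. Re (indicator I x *\<^sub>R hform f f x)) \<in> borel_measurable lebesgue"
      using hform_measurable[OF I f f] by measurable
    then show ?thesis by (simp add: u_def[abs_def])
  qed
  have "integrable lebesgue u"
  proof (rule integrableI_nonneg[OF um])
    show "AE x in lebesgue. 0 \<le> u x"
      using hform_nonneg_AE[of f] by eventually_elim (simp add: u_def)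
    have "(\<integral>\<^sup>+x. ennreal (u x) \<partial>lebesgue) \<le> (\<integral>\<^sup>+x. (SUP n. ennreal (indicator (K n) x *\<^sub>R Re (hform f f x))) \<partial>lebesgue)"
    proof (rule nn_integral_mono)
      fix x
      show "ennreal (u x) \<le> (SUP n. ennreal (indicator (K n) x *\<^sub>R Re (hform f f x)))"
      proof (cases "x \<in> I")
        case True
        then obtain n where "x \<in> K n" using K(3) by blast
        then have "ennreal (u x) = ennreal (indicator (K n) x *\<^sub>R Re (hform f f x))" using True by (simp add: u_def)
        then show ?thesis by (intro SUP_upper2[of n]) (simp_all only: UNIV_I order_refl)
      qed (simp add: u_def)
    qed
    also have "\<dots> = (SUP n. \<integral>\<^sup>+x. ennreal (indicator (K n) x *\<^sub>R Re (hform f f x)) \<partial>lebesgue)"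
    proof (rule nn_integral_monotone_convergence_SUP_AE)
      show "AE x in lebesgue. ennreal (indicator (K n) x *\<^sub>R Re (hform f f x)) \<le> ennreal (indicator (K (Suc n)) x *\<^sub>R Re (hform f f x))" for n
        using hform_nonneg_AE by eventually_elim (use incseq_SucD[OF K(1)] in \<open>auto simp: indicator_def\<close>)
      show "(\<lambda>x. ennreal (indicator (K n) x *\<^sub>R Re (hform f f x))) \<in> borel_measurable lebesgue" for n
        using borel_measurable_integrable[OF Re_innerH_self(2)[OF fK(1)[of n]]] by simp
    qed
    also have "\<dots> \<le> ennreal M"
    proof (rule SUP_least)
      fix n
      have "(\<integral>\<^sup>+x. ennreal (indicator (K n) x *\<^sub>R Re (hform f f x)) \<partial>lebesgue) = ennreal (Re (innerH H (K n) f f))"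
        unfolding Re_innerH_self(1)[OF fK(1)]
      proof (rule nn_integral_eq_integral[OF Re_innerH_self(2)[OF fK(1)]])
        show "AE x in lebesgue. 0 \<le> indicator (K n) x *\<^sub>R Re (hform f f x)"
          using hform_nonneg_AE[of f] by eventually_elim simp
      qed
      also have "\<dots> \<le> ennreal M" using fK(2) by (rule ennreal_leI)
      finally show "(\<integral>\<^sup>+x. ennreal (indicator (K n) x *\<^sub>R Re (hform f f x)) \<partial>lebesgue) \<le> ennreal M" .
    qed
    finally show "(\<integral>\<^sup>+x. ennreal (u x) \<partial>lebesgue) < \<infinity>" by (rule le_less_trans) simp
  qed
  then have "integrable lebesgue (\<lambda>x. complex_of_real (u x))" by simp
  moreover have "integrable lebesgue (\<lambda>x. complex_of_real (u x)) \<longleftrightarrow> integrable lebesgue (\<lambda>x. indicator I x *\<^sub>R hform f f x)"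
  proof (rule integrable_cong_AE)
    show "(\<lambda>x. complex_of_real (u x)) \<in> borel_measurable lebesgue" using um by measurable
    show "(\<lambda>x. indicator I x *\<^sub>R hform f f x) \<in> borel_measurable lebesgue" by (rule hform_measurable[OF I f f])
    show "AE x in lebesgue. complex_of_real (u x) = indicator I x *\<^sub>R hform f f x"
      using hform_AE
    proof eventually_elim
      case (elim x)
      then have "hform f f x = of_real (Re (hform f f x))" by blast
      then show ?case by (simp add: u_def indicator_def)
    qed
  qed
  ultimately show ?thesis using f by (simp add: L2H_iff set_integrable_def)
qed

section \<open>Energy of solutions on compact intervals\<close>

definition energy :: "complex \<Rightarrow> real set \<Rightarrow> complex^'n \<Rightarrow> real" where
  "energy z K v = Re (innerH H K (sol z v) (sol z v))"

text \<open>The energy is the diagonal of a real bilinear form on a finite-dimensional space, and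
  such forms are bounded.\<close>

lemma continuous_energy: "continuous_on UNIV (energy z {a..b})"
proof -
  let ?K = "{a..b}"
  have K: "?K \<in> sets borel" by simp
  define \<beta> where "\<beta> u v = innerH H ?K (sol z u) (sol z v)" for u v
  have scaleR: "r *\<^sub>R v = complex_of_real r *s v" for r and v :: "complex^'n"
    by (simp add: vec_eq_iff scaleR_conv_of_real[where 'a=complex])
  have sol: "sol z (u + v) = (\<lambda>x. sol z u x + sol z v x)" "sol z (r *\<^sub>R v) = (\<lambda>x. complex_of_real r *s sol z v x)" for u v r
    by (auto simp: sol_add scaleR sol_scale)
  have "bilinear \<beta>"
    unfolding bilinear_def \<beta>_def
    by (auto intro!: linearI simp: sol innerH_add_left[OF K] innerH_add_right[OF K] sol_L2H_Icc
        innerH_scale_left[OF K] innerH_scale_right[OF K] scaleR_conv_of_real[where 'a=complex])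
  then interpret \<beta>: bounded_bilinear \<beta> by (simp add: bilinear_conv_bounded_bilinear)
  show ?thesis
    unfolding energy_def \<beta>_def[symmetric] by (intro continuous_intros \<beta>.continuous_on)
qed

lemma energy_nonneg: "0 \<le> energy z {a..b} v"
  unfolding energy_def by (intro innerH_self_nonneg sol_L2H_Icc) simp

lemma energy_mono: "{a..b} \<subseteq> {c..d} \<Longrightarrow> energy z {a..b} v \<le> energy z {c..d} v"
  unfolding energy_def by (rule innerH_mono[OF sol_L2H_Icc]) auto

lemma energy_scaleR: "energy z K (r *\<^sub>R v) = r\<^sup>2 * energy z K v"
proof -
  have "r *\<^sub>R v = complex_of_real r *s v" by (simp add: vec_eq_iff scaleR_conv_of_real[where 'a=complex])
  then have "sol z (r *\<^sub>R v) = (\<lambda>x. complex_of_real r *s sol z v x)" by (simp add: sol_scale fun_eq_iff)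
  then show ?thesis
    by (simp add: energy_def innerH_eq hform_scale_left hform_scale_right power2_eq_square algebra_simps)
qed

text \<open>If \<open>H\<close> annihilates \<open>sol z v\<close>, the right side
  \<open>z H f\<close> vanishes too, so this function also solves the homogeneous equation to which
  \<open>definite_on\<close> refers.\<close>

lemma definite_sol_zero:
  assumes "definite_on J B H I" "0 \<in> I" "AE x\<in>I in lebesgue. H x *v sol z v x = 0"
  shows "v = 0"
proof -
  have "system_eq J B H I (sol z v) (\<lambda>x. 0)"
    using sol_system_eq[of I z v] assms(3) unfolding system_eq_def
    by eventually_elim (auto simp: matrix_vector_scale mv.zero_right)
  then have "\<forall>x\<in>I. sol z v x = 0" using assms(1,3) sol_AC unfolding definite_on_def by blast
  then show ?thesis using assms(2) sol_0 by metis
qed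

text \<open>If the nonnegative forms \<open>energy z {a n..b n}\<close> all had an isotropic unit vector, then, by
  compactness of the unit sphere, they would have a common one.\<close>

lemma energy_coercive:
  assumes def: "definite_on J B H I" "0 \<in> I"
    and K: "\<And>n m. n \<le> m \<Longrightarrow> {a n..b n} \<subseteq> {a m..b (m::nat)}" "\<And>x. x \<in> I \<Longrightarrow> x \<noteq> 0 \<Longrightarrow> \<exists>n. x \<in> {a n..b n}"
  obtains n c where "c > 0" "\<And>v. c * (norm v)\<^sup>2 \<le> energy z {a n..b n} v"
proof -
  define C where "C n = sphere 0 1 \<inter> {v. energy z {a n..b n} v \<le> 0}" for n
  have "\<exists>n. C n = {}"
  proof (rule ccontr)
    assume "\<nexists>n. C n = {}"
    then have ne: "C n \<noteq> {}" for n by blast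
    have "compact (C n)" for n
      unfolding C_def by (intro compact_Int_closed closed_Collect_le continuous_energy continuous_intros) auto
    moreover have "C m \<subseteq> C n" if "n \<le> m" for n m
      using energy_mono[OF K(1)[OF that]] order_trans unfolding C_def by blast
    ultimately have "\<Inter>(range C) \<noteq> {}" using ne by (intro compact_nest) auto
    then obtain v where v: "\<And>n. v \<in> C n" by auto
    have "AE x\<in>{a n..b n} in lebesgue. H x *v sol z v x = 0" for n
    proof -
      have "energy z {a n..b n} v = 0" using v[of n] energy_nonneg[of z "a n" "b n" v] by (simp add: C_def)
      then show ?thesis
        using innerH_self_zero_iff[of "{a n..b n}" "sol z v"] sol_L2H_Icc by (simp add: energy_def)
    qed
    then have "AE x\<in>I in lebesgue. H x *v sol z v x = 0" by (rule AE_all_intervals) (use K(2) in auto)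
    then have "v = 0" by (rule definite_sol_zero[OF def])
    then show False using v[of 0] by (simp add: C_def)
  qed
  then obtain n where n: "C n = {}" by blast
  \<comment> \<open>The coercivity constant is the minimum of the energy on the unit sphere,
    positive because \<open>C n\<close> is empty; quadratic homogeneity extends the bound to all
    vectors.\<close>
  have "\<exists>u\<in>sphere 0 1. \<forall>v\<in>sphere 0 1. energy z {a n..b n} u \<le> energy z {a n..b n} v"
  proof (rule continuous_attains_inf)
    show "sphere 0 1 \<noteq> ({} :: (complex^'n) set)"
    proof -
      have "axis undefined 1 \<in> (sphere 0 1 :: (complex^'n) set)" by (simp add: norm_axis_1)
      then show ?thesis by blast
    qed
    show "continuous_on (sphere 0 1) (energy z {a n..b n})"
      by (rule continuous_on_subset[OF continuous_energy]) simp
  qed simp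
  then obtain u where u: "u \<in> sphere 0 1" "\<And>v. v \<in> sphere 0 1 \<Longrightarrow> energy z {a n..b n} u \<le> energy z {a n..b n} v" by blast
  show thesis
  proof (rule that)
    show "energy z {a n..b n} u > 0" using n u(1) unfolding C_def by force
    fix v
    show "energy z {a n..b n} u * (norm v)\<^sup>2 \<le> energy z {a n..b n} v"
    proof (cases "v = 0")
      case True
      then show ?thesis using energy_nonneg by simp
    next
      case False
      then have "energy z {a n..b n} u \<le> energy z {a n..b n} ((1 / norm v) *\<^sub>R v)" by (intro u(2)) simp
      also have "\<dots> = energy z {a n..b n} v / (norm v)\<^sup>2" by (simp only: energy_scaleR power_one_over) simp
      finally show ?thesis using False by (simp add: pos_le_divide_eq)
    qed
  qed
qed

section \<open>Coupled solutions and the decomposition of initial values\<close>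

lemma sol_Green:
  assumes "a \<le> b"
  shows "cinner (sol z u b) (J b *v sol z v b) - cinner (sol z u a) (J a *v sol z v a) =
    (z - cnj z) * innerH H {a..b} (sol z u) (sol z v)"
proof -
  have "((\<lambda>x. (z - cnj z) * hform (sol z u) (sol z v) x) has_integral
     (cinner (sol z u b) (J b *v sol z v b) - cinner (sol z u a) (J a *v sol z v a))) {a..b}"
    using sol_Lagrange[OF assms sol_abs_continuous system_eqD[OF sol_system_eq subset_refl], of z u z v]
    by (simp add: hform_def matrix_vector_scale algebra_simps)
  moreover have "(hform (sol z u) (sol z v) has_integral innerH H {a..b} (sol z u) (sol z v)) {a..b}"
    unfolding innerH_eq using L2H_hform_integrable[OF _ sol_L2H_Icc sol_L2H_Icc]
    by (intro has_integral_set_lebesgue) auto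
  then have "((\<lambda>x. (z - cnj z) * hform (sol z u) (sol z v) x) has_integral (z - cnj z) * innerH H {a..b} (sol z u) (sol z v)) {a..b}"
    by (rule has_integral_mult_right)
  ultimately show ?thesis by (rule has_integral_unique)
qed

lemma innerH_sol_energy: "innerH H {a..b} (sol z v) (sol z v) = of_real (energy z {a..b} v)"
  unfolding energy_def by (rule innerH_self_eq) (auto simp: sol_L2H_Icc)

text \<open>Green's identity is added over \<open>{0..R}\<close> and \<open>{-R..0}\<close>. The
  values at \<open>R\<close> and \<open>-R\<close> both equal \<open>cinner c (J 0 *v c)\<close>,
  because \<open>sol 0 c\<close> has a constant pairing with itself.\<close>

lemma coupled_energy:
  assumes R: "0 \<le> R" and a: "sol z a R = sol 0 c R" and b: "sol z b (-R) = sol 0 c (-R)"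
  shows "cinner b (J 0 *v b) - cinner a (J 0 *v a) = (z - cnj z) * of_real (energy z {0..R} a + energy z {-R..0} b)"
proof -
  have 1: "cinner c (J 0 *v c) - cinner a (J 0 *v a) = (z - cnj z) * of_real (energy z {0..R} a)"
    using sol_Green[OF R, of z a a] sol_wronskian[of 0 c R c] by (simp add: a innerH_sol_energy)
  have 2: "cinner b (J 0 *v b) - cinner c (J 0 *v c) = (z - cnj z) * of_real (energy z {-R..0} b)"
    using sol_Green[of "-R" 0 z b b] sol_wronskian[of 0 c "-R" c] R by (simp add: b innerH_sol_energy)
  have "cinner b (J 0 *v b) - cinner a (J 0 *v a) =
      (cinner c (J 0 *v c) - cinner a (J 0 *v a)) + (cinner b (J 0 *v b) - cinner c (J 0 *v c))" by simp
  then show ?thesis unfolding 1 2 by (simp only: distrib_left of_real_add)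
qed

text \<open>The boundary conditions at \<open>R\<close> and \<open>-R\<close> are coupled through the solutions for the
  spectral parameter \<open>0\<close>, which conserve the form \<open>cinner f (J f)\<close>: no signature of \<open>J\<close> enters.\<close>

lemma coupled_solution:
  assumes z: "Im z \<noteq> 0" and R: "0 \<le> R"
    and pos: "\<And>a. energy z {0..R} a + energy z {-R..0} a = 0 \<Longrightarrow> a = 0"
  obtains a b c where "a - b = v" "sol z a R = sol 0 c R" "sol z b (-R) = sol 0 c (-R)"
proof -
  \<comment> \<open>With \<open>a = M1 c\<close> and \<open>b = M2 c\<close> the condition
    \<open>a - b = v\<close> is a square linear system for \<open>c\<close>, so injectivity
    suffices. If \<open>a = b\<close>, the left side of \<open>coupled_energy\<close> vanishes, and
    with it the energy.\<close>
  define M1 where "M1 = matrix_inv (fund z R) ** fund 0 R"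
  define M2 where "M2 = matrix_inv (fund z (-R)) ** fund 0 (-R)"
  have M1: "sol z (M1 *v c) R = sol 0 c R" for c
    by (simp add: sol_def M1_def matrix_vector_mul_assoc matrix_mul_assoc matrix_inv_right[OF fund_invertible])
  have M2: "sol z (M2 *v c) (-R) = sol 0 c (-R)" for c
    by (simp add: sol_def M2_def matrix_vector_mul_assoc matrix_mul_assoc matrix_inv_right[OF fund_invertible])
  have nz: "z - cnj z \<noteq> 0" using z by (simp add: complex_eq_iff)
  have "inj ((*v) (M1 - M2))"
  proof (rule injI)
    fix c d assume "(M1 - M2) *v c = (M1 - M2) *v d"
    then have eq: "M1 *v (c - d) = M2 *v (c - d)" by (simp add: mv.diff_left mv.diff_right algebra_simps)
    have "energy z {0..R} (M1 *v (c - d)) + energy z {-R..0} (M1 *v (c - d)) = 0"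
      using coupled_energy[OF R M1 M2, of "c - d"] nz by (simp add: eq del: of_real_add)
    then have "M1 *v (c - d) = 0" by (rule pos)
    then have "sol 0 (c - d) R = 0" using M1[of "c - d"] by (simp add: sol_def mv.zero_right)
    then have "c - d = 0" by (rule sol_inj)
    then show "c = d" by simp
  qed
  then have inv: "invertible (M1 - M2)"
    using matrix_left_invertible_injective invertible_left_inverse by blast
  define c where "c = matrix_inv (M1 - M2) *v v"
  have "(M1 - M2) *v c = v" by (simp add: c_def matrix_vector_mul_assoc matrix_inv_right[OF inv])
  then show thesis using that[OF _ M1 M2] by (simp add: mv.diff_left)
qed

text \<open>For the coupled solution with \<open>a = b + v\<close>, \<open>coupled_energy\<close>
  bounds the energy by an expression linear in \<open>norm b\<close>, whereas coercivity bounds it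
  below by a multiple of the square of \<open>norm b\<close>. Thus \<open>b\<close> and the energy
  stay bounded as \<open>R\<close> grows, and a limit of such \<open>b\<close> serves both
  half-lines.\<close>

lemma half_line_decomposition:
  assumes z: "Im z \<noteq> 0" and def: "definite_on J B H {0..}" "definite_on J B H {..0}"
  obtains a b where "a - b = v" "sol z a \<in> L2H H {0..}" "sol z b \<in> L2H H {..0}"
proof -
  obtain m1 c1 where c1: "c1 > 0" "\<And>v. c1 * (norm v)\<^sup>2 \<le> energy z {0..real m1} v"
  proof (rule energy_coercive[OF def(1), where a="\<lambda>_. 0" and b=real])
    show "\<exists>n. x \<in> {0..real n}" if "x \<in> {0..}" for x using real_arch_simple[of x] that by auto
  qed auto
  obtain m2 c2 where c2: "c2 > 0" "\<And>v. c2 * (norm v)\<^sup>2 \<le> energy z {-real m2..0} v"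
  proof (rule energy_coercive[OF def(2), where a="\<lambda>n. - real n" and b="\<lambda>_. 0"])
    show "\<exists>n. x \<in> {-real n..0}" if "x \<in> {..0}" for x using real_arch_simple[of "-x"] that by (auto simp: minus_le_iff)
  qed auto
  define y where "y = 2 * \<bar>Im z\<bar>"
  have "z - cnj z = of_real (2 * Im z) * \<i>" by (simp add: complex_eq_iff)
  then have y: "y > 0" "cmod (z - cnj z) = y"
    using z by (simp_all add: norm_mult y_def abs_mult)
  interpret form: bounded_bilinear "\<lambda>u w. cinner u (J 0 *v w)"
    by (rule cinner.comp[OF bounded_linear_ident mv.bounded_linear_right])
  obtain C where C: "C > 0" "\<And>u w. cmod (cinner u (J 0 *v w)) \<le> norm u * norm w * C"
    using form.pos_bounded by blast
  \<comment> \<open>If \<open>norm b\<close> is at least 1, then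
    \<open>y * c2 * (norm b)\<^sup>2\<close> is at most \<open>D * norm b\<close>; this gives the
    radius \<open>r\<close>, the maximum with 1 covering small \<open>b\<close>. Inserting
    \<open>r\<close> into the linear bound gives the energy bound \<open>M\<close>.\<close>
  define D where "D = (2 * norm v + (norm v)\<^sup>2) * C"
  define r where "r = max 1 (D / (y * c2))"
  define M where "M = D * r / y"
  \<comment> \<open>The initial values that are admissible up to \<open>k\<close>: compact sets
    decreasing in \<open>k\<close>, so nonempty ones have a common point.\<close>
  define F where "F k = cball 0 r \<inter> {b. energy z {0..real k} (b + v) + energy z {-real k..0} b \<le> M}" for k
  have r: "1 \<le> r" by (simp add: r_def)
  have D: "0 \<le> D" using C(1) by (simp add: D_def)
  have mono: "F l \<subseteq> F k" if "k \<le> l" for k l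
  proof
    fix b assume "b \<in> F l"
    moreover have "energy z {0..real k} (b + v) \<le> energy z {0..real l} (b + v)"
      by (rule energy_mono) (use that in auto)
    moreover have "energy z {-real k..0} b \<le> energy z {-real l..0} b"
      by (rule energy_mono) (use that in auto)
    ultimately show "b \<in> F k" by (auto simp: F_def)
  qed
  have ne: "F k \<noteq> {}" for k
  proof -
    \<comment> \<open>The coupling may be imposed further out than \<open>k\<close>, since energies
      on smaller intervals are smaller; coercivity holds from \<open>m1\<close> and
      \<open>m2\<close> on.\<close>
    define R where "R = max k (max m1 m2)"
    have Rm: "real m1 \<le> real R" "real m2 \<le> real R" by (simp_all add: R_def)
    have R1: "c1 * (norm a)\<^sup>2 \<le> energy z {0..real R} a" for a
      using c1(2)[of a] energy_mono[of 0 "real m1" 0 "real R" z a] Rm by simp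
    have R2: "c2 * (norm a)\<^sup>2 \<le> energy z {-real R..0} a" for a
      using c2(2)[of a] energy_mono[of "-real m2" 0 "-real R" 0 z a] Rm by simp
    obtain a b c where abc: "a - b = v" "sol z a (real R) = sol 0 c (real R)" "sol z b (- real R) = sol 0 c (- real R)"
    proof (rule coupled_solution[OF z, of "real R" v])
      fix a assume "energy z {0..real R} a + energy z {-real R..0} a = 0"
      then have "c1 * (norm a)\<^sup>2 \<le> 0" using R1[of a] energy_nonneg[of z "-real R" 0 a] by simp
      then show "a = 0" using c1(1) by (simp add: mult_le_0_iff)
    qed auto
    have av: "a = b + v" using abc(1) by (simp add: algebra_simps)
    let ?E = "energy z {0..real R} a + energy z {-real R..0} b"
    have E0: "0 \<le> ?E" using energy_nonneg by (simp add: add_nonneg_nonneg)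
    have zE: "(z - cnj z) * of_real ?E = - (cinner b (J 0 *v v) + cinner v (J 0 *v b) + cinner v (J 0 *v v))"
    proof -
      have "cinner b (J 0 *v b) - cinner a (J 0 *v a) = - (cinner b (J 0 *v v) + cinner v (J 0 *v b) + cinner v (J 0 *v v))"
        unfolding av by (simp add: cinner.add_left cinner.add_right mv.add_right)
      then show ?thesis using coupled_energy[OF _ abc(2,3)] by simp
    qed
    have "y * ?E = cmod ((z - cnj z) * of_real ?E)"
      using E0 y(2) by (simp only: norm_mult norm_of_real abs_of_nonneg)
    also have "\<dots> = cmod (cinner b (J 0 *v v) + cinner v (J 0 *v b) + cinner v (J 0 *v v))"
      unfolding zE by (rule norm_minus_cancel)
    also have "\<dots> \<le> cmod (cinner b (J 0 *v v)) + cmod (cinner v (J 0 *v b)) + cmod (cinner v (J 0 *v v))"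
      by (intro norm_triangle_le add_right_mono norm_triangle_ineq)
    also have "\<dots> \<le> norm b * norm v * C + norm v * norm b * C + norm v * norm v * C"
      by (intro add_mono C)
    also have "\<dots> = (2 * norm v * norm b + (norm v)\<^sup>2) * C" by (simp add: power2_eq_square algebra_simps)
    finally have yE: "y * ?E \<le> (2 * norm v * norm b + (norm v)\<^sup>2) * C" .
    have br: "norm b \<le> r"
    proof (cases "norm b \<le> 1")
      case True then show ?thesis using r by simp
    next
      case False
      then have b1: "1 \<le> norm b" by simp
      have "y * c2 * (norm b)\<^sup>2 \<le> y * ?E"
        using R2[of b] energy_nonneg[of z 0 "real R" a] y(1) by (simp add: mult.assoc)
      also have "\<dots> \<le> (2 * norm v * norm b + (norm v)\<^sup>2) * C" by (rule yE)
      also have "\<dots> \<le> (2 * norm v * norm b + (norm v)\<^sup>2 * norm b) * C"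
        using b1 C(1) by (intro mult_right_mono add_left_mono) (auto simp: mult_le_cancel_left1)
      also have "\<dots> = D * norm b" by (simp add: D_def algebra_simps)
      finally have "(y * c2 * norm b) * norm b \<le> D * norm b" by (simp add: power2_eq_square mult.assoc)
      then have "y * c2 * norm b \<le> D" by (rule mult_right_le_imp_le) (use b1 in linarith)
      then have "norm b \<le> D / (y * c2)" using y(1) c2(1) by (simp add: pos_le_divide_eq mult.commute)
      then show ?thesis by (simp add: r_def)
    qed
    have "(2 * norm v * norm b + (norm v)\<^sup>2) * C \<le> (2 * norm v * r + (norm v)\<^sup>2 * r) * C"
      using br r C(1) by (intro mult_right_mono add_mono mult_left_mono) (auto simp: mult_le_cancel_left1)
    also have "\<dots> = D * r" by (simp add: D_def algebra_simps)
    finally have "?E \<le> M" using yE y(1) by (simp add: M_def pos_le_divide_eq mult.commute)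
    then have "b \<in> F R" using br by (simp add: F_def av)
    then show ?thesis using mono[of k R] by (auto simp: R_def)
  qed
  have "compact (F k)" for k
  proof -
    have "continuous_on UNIV (\<lambda>b. energy z {0..real k} (b + v))"
      by (rule continuous_on_compose2[OF continuous_energy]) (auto intro!: continuous_intros)
    then show ?thesis
      unfolding F_def by (intro compact_Int_closed closed_Collect_le continuous_on_add continuous_energy continuous_on_const) auto
  qed
  then have "\<Inter>(range F) \<noteq> {}" using ne mono by (intro compact_nest) auto
  then obtain b where b: "\<And>k. b \<in> F k" by auto
  have E: "energy z {0..real k} (b + v) \<le> M" "energy z {-real k..0} b \<le> M" for k
    using b[of k] energy_nonneg[of z 0 "real k" "b + v"] energy_nonneg[of z "-real k" 0 b] by (auto simp: F_def)
  show thesis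
  proof (rule that[of "b + v" b])
    show "sol z (b + v) \<in> L2H H {0..}"
    proof (rule L2H_exhaust[OF _ sol_measurable, where K="\<lambda>k. {0..real k}" and M=M])
      show "(\<Union>k. {0..real k}) = {0..}" using real_arch_simple by auto
      show "Re (innerH H {0..real k} (sol z (b + v)) (sol z (b + v))) \<le> M" for k
        using E(1)[of k] by (simp add: energy_def)
    qed (auto simp: incseq_def sol_L2H_Icc)
    show "sol z b \<in> L2H H {..0}"
    proof (rule L2H_exhaust[OF _ sol_measurable, where K="\<lambda>k. {-real k..0}" and M=M])
      show "(\<Union>k. {-real k..0}) = {..0}" using real_arch_simple by (auto simp: minus_le_iff)
      show "Re (innerH H {-real k..0} (sol z b) (sol z b)) \<le> M" for k
        using E(2)[of k] by (simp add: energy_def)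
    qed (auto simp: incseq_def sol_L2H_Icc)
  qed simp
qed

section \<open>Initial values of square integrable solutions\<close>

definition sol_space :: "complex \<Rightarrow> real set \<Rightarrow> (complex^'n) set" where
  "sol_space z I = {v. sol z v \<in> L2H H I}"

lemma subspace_sol_space:
  assumes "I \<in> sets borel"
  shows "vec.subspace (sol_space z I)"
proof (rule vec.subspaceI)
  have "sol z 0 = (\<lambda>x. 0)" by (auto simp: sol_def mv.zero_right)
  then show "0 \<in> sol_space z I" by (simp add: sol_space_def L2H_zero)
  fix u v assume "u \<in> sol_space z I" "v \<in> sol_space z I"
  moreover have "sol z (u + v) = (\<lambda>x. sol z u x + sol z v x)" by (auto simp: sol_add)
  ultimately show "u + v \<in> sol_space z I" using L2H_add[OF assms] by (simp add: sol_space_def)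
next
  fix c v assume "v \<in> sol_space z I"
  moreover have "sol z (c *s v) = (\<lambda>x. c *s sol z v x)" by (auto simp: sol_scale)
  ultimately show "c *s v \<in> sol_space z I" using L2H_scale by (simp add: sol_space_def)
qed

lemma sol_space_UNIV: "sol_space z UNIV = sol_space z {0..} \<inter> sol_space z {..0}"
proof -
  have "sol z v \<in> L2H H UNIV" if "sol z v \<in> L2H H {0..}" "sol z v \<in> L2H H {..0}" for v
  proof -
    have "set_integrable lebesgue ({0..} \<union> {..0}) (hform (sol z v) (sol z v))"
      using that by (intro set_integrable_Un) (auto simp: L2H_iff)
    moreover have "{0..} \<union> {..0} = (UNIV :: real set)" by auto
    ultimately show ?thesis using sol_measurable by (simp add: L2H_iff)
  qed
  moreover have "sol z v \<in> L2H H {0..} \<and> sol z v \<in> L2H H {..0}" if "sol z v \<in> L2H H UNIV" for v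
    using L2H_subset[OF that] by simp
  ultimately show ?thesis by (auto simp: sol_space_def)
qed

lemma dim_sol_space:
  assumes z: "Im z \<noteq> 0" and def: "definite_on J B H {0..}" "definite_on J B H {..0}"
  shows "vec.dim (sol_space z UNIV) + CARD('n) = vec.dim (sol_space z {0..}) + vec.dim (sol_space z {..0})"
proof -
  let ?P = "sol_space z {0..}" and ?N = "sol_space z {..0}"
  have sub: "vec.subspace ?P" "vec.subspace ?N" by (simp_all add: subspace_sol_space)
  have "v \<in> {x + y |x y. x \<in> ?P \<and> y \<in> ?N}" for v
  proof -
    obtain a b where ab: "a - b = v" "sol z a \<in> L2H H {0..}" "sol z b \<in> L2H H {..0}"
      using half_line_decomposition[OF z def] by metis
    have "- b \<in> ?N" using vec.subspace_neg[OF sub(2)] ab(3) by (simp add: sol_space_def)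
    moreover have "a \<in> ?P" using ab(2) by (simp add: sol_space_def)
    moreover have "v = a + - b" using ab(1) by simp
    ultimately show ?thesis by blast
  qed
  then have "{x + y |x y. x \<in> ?P \<and> y \<in> ?N} = UNIV" by blast
  then have "vec.dim {x + y |x y. x \<in> ?P \<and> y \<in> ?N} = CARD('n)"
    using card_cart_basis by (simp add: vec.dim_UNIV)
  then show ?thesis using vec.dim_sums_Int[OF sub] by (simp add: sol_space_UNIV)
qed

end

section \<open>Formal deficiency indices\<close>

lemma abs_continuous_cong:
  assumes "abs_continuous_on_interval a b f" "\<And>x. x \<in> {a..b} \<Longrightarrow> f x = g x"
  shows "abs_continuous_on_interval a b g"
  by (rule abs_continuous_dominated[OF assms(1,1), where C=1]) (use assms(2) in auto)

lemma AC_cong: "f \<in> AC I \<Longrightarrow> (\<And>x. x \<in> I \<Longrightarrow> f x = g x) \<Longrightarrow> g \<in> AC I"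
  unfolding AC_def by (blast intro: abs_continuous_cong[of _ _ f g])

lemma interior_half_line:
  assumes "I \<in> {UNIV, {0..}, {..0::real}}" "x \<in> I" "x \<noteq> 0"
  shows "x \<in> interior I"
  using assms by (auto simp: interior_real_atLeast interior_real_atMost)

text \<open>Test functions must be supported in the interior, so on a half-line the compact
  intervals have to stay away from \<open>0\<close>; the reciprocals \<open>1 / (1 + real n)\<close>
  approach it.\<close>

lemma interior_exhaustion:
  assumes "I \<in> {UNIV, {0..}, {..0::real}}"
  obtains a b :: "nat \<Rightarrow> real" where "\<And>n m. n \<le> m \<Longrightarrow> {a n..b n} \<subseteq> {a m..b m}" "\<And>n. a n \<le> b n"
    "\<And>n. {a n..b n} \<subseteq> interior I" "\<And>x. x \<in> I \<Longrightarrow> x \<noteq> 0 \<Longrightarrow> \<exists>n. x \<in> {a n..b n}"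
proof -
  have arch: "\<exists>n::nat. 1 / (1 + real n) \<le> x \<and> x \<le> 1 + real n" if "x > 0" for x
  proof -
    obtain n where n: "1 / x \<le> real n" "x \<le> real n"
      using real_arch_simple[of "max (1 / x) x"] by auto
    have "1 / (1 + real n) \<le> x" using that n(1) by (simp add: field_simps)
    then show ?thesis using n(2) by (intro exI[of _ n]) auto
  qed
  have one: "1 / (1 + real n) \<le> 1 + real n" for n
    by (rule order_trans[of _ 1]) auto
  have inv: "1 / (1 + real m) \<le> 1 / (1 + real n)" if "n \<le> m" for n m
    using that by (intro divide_left_mono) auto
  consider "I = UNIV" | "I = {0..}" | "I = {..0}" using assms by blast
  then show thesis
  proof cases
    case 1
    show thesis
    proof (rule that[of "\<lambda>n. - real n" real])
      show "\<exists>n. x \<in> {- real n..real n}" for x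
        using real_arch_simple[of "\<bar>x\<bar>"] by (auto simp: abs_le_iff minus_le_iff)
    qed (use 1 in auto)
  next
    case 2
    show thesis
    proof (rule that[of "\<lambda>n. 1 / (1 + real n)" "\<lambda>n. 1 + real n"])
      show "{1 / (1 + real n)..1 + real n} \<subseteq> interior I" for n
      proof
        fix x assume x: "x \<in> {1 / (1 + real n)..1 + real n}"
        have "0 < 1 / (1 + real n)" by simp
        also have "\<dots> \<le> x" using x by simp
        finally show "x \<in> interior I" using 2 by (simp add: interior_real_atLeast)
      qed
      show "\<exists>n. x \<in> {1 / (1 + real n)..1 + real n}" if "x \<in> I" "x \<noteq> 0" for x
        using arch[of x] that 2 by auto
      show "{1 / (1 + real n)..1 + real n} \<subseteq> {1 / (1 + real m)..1 + real m}" if "n \<le> m" for n m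
        using inv[OF that] that by (intro atLeastatMost_subset_iff[THEN iffD2]) auto
    qed (rule one)
  next
    case 3
    show thesis
    proof (rule that[of "\<lambda>n. - (1 + real n)" "\<lambda>n. - (1 / (1 + real n))"])
      show "{- (1 + real n)..- (1 / (1 + real n))} \<subseteq> interior I" for n
      proof
        fix x assume x: "x \<in> {- (1 + real n)..- (1 / (1 + real n))}"
        have "0 < 1 / (1 + real n)" by simp
        also have "\<dots> \<le> - x" using x by simp
        finally show "x \<in> interior I" using 3 by (simp add: interior_real_atMost)
      qed
      show "\<exists>n. x \<in> {- (1 + real n)..- (1 / (1 + real n))}" if x: "x \<in> I" "x \<noteq> 0" for x
      proof -
        have "- x > 0" using x 3 by simp
        from arch[OF this] obtain n where n: "1 / (1 + real n) \<le> - x" "- x \<le> 1 + real n" by blast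
        then show ?thesis by (intro exI[of _ n]) (simp add: le_minus_iff minus_le_iff)
      qed
      show "{- (1 + real n)..- (1 / (1 + real n))} \<subseteq> {- (1 + real m)..- (1 / (1 + real m))}" if "n \<le> m" for n m
        using inv[OF that] that by (intro atLeastatMost_subset_iff[THEN iffD2]) auto
      show "- (1 + real n) \<le> - (1 / (1 + real n))" for n using one[of n] by simp
    qed
  qed
qed

context first_order_system
begin

lemma L2H_cong:
  assumes "f \<in> L2H H I" "\<And>x. x \<in> I \<Longrightarrow> f x = g x"
  shows "g \<in> L2H H I"
  unfolding L2H_iff
proof
  have "f \<in> borel_measurable (restrict_space borel I) \<longleftrightarrow> g \<in> borel_measurable (restrict_space borel I)"
    by (rule measurable_cong) (use assms(2) in \<open>simp add: space_restrict_space\<close>)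
  then show "g \<in> borel_measurable (restrict_space borel I)" using assms(1) by (simp add: L2H_iff)
  have "set_integrable lebesgue I (hform f f) = set_integrable lebesgue I (hform g g)"
    by (rule set_integrable_cong) (use assms(2) in \<open>auto simp: hform_def\<close>)
  then show "set_integrable lebesgue I (hform g g)" using assms(1) by (simp add: L2H_iff)
qed

text \<open>A solution is determined by its value at \<open>0\<close>, which may be any element of
  \<open>sol_space z I\<close>: evaluation at \<open>0\<close> is the map required by
  \<open>quotient_dim_eq_dim\<close>.\<close>

lemma formal_deficiency_index_eq:
  assumes I: "I \<in> {UNIV, {0..}, {..0}}"
  shows "formal_deficiency_index J B H I z = enat (vec.dim (sol_space z I))"
  unfolding formal_deficiency_index_def
proof (rule quotient_dim_eq_dim[where r="\<lambda>f. f 0"])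
  let ?A = "{f. f \<in> AC I \<and> f \<in> L2H H I \<and> system_eq J B H I f (\<lambda>x. z *s f x) \<and> (\<forall>x. x \<notin> I \<longrightarrow> f x = 0)}"
  have int: "is_interval I" "0 \<in> I" using I by (auto simp: is_interval_1)
  have eq: "f x = sol z (f 0) x" if "f \<in> ?A" "x \<in> I" for f x
    using that by (intro sol_unique[OF int]) auto
  show "f 0 \<in> sol_space z I" if "f \<in> ?A" for f
    using L2H_cong[of f I "sol z (f 0)"] eq[OF that] that by (simp add: sol_space_def)
  show "\<exists>f\<in>?A. f 0 = v" if v: "v \<in> sol_space z I" for v
  proof -
    define f where "f x = (if x \<in> I then sol z v x else 0)" for x
    have "f \<in> AC I" by (rule AC_cong[OF sol_AC]) (simp add: f_def)
    moreover have "f \<in> L2H H I" by (rule L2H_cong[of "sol z v"]) (use v in \<open>auto simp: sol_space_def f_def\<close>)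
    moreover have "system_eq J B H I f (\<lambda>x. z *s f x)"
    proof -
      \<comment> \<open>At an end point \<open>0\<close> the extension by zero may jump, so its
        two-sided derivative there says nothing about the solution. Away from \<open>0\<close>,
        \<open>f\<close> agrees with \<open>sol z v\<close> in a neighbourhood.\<close>
      have ne: "AE x in lebesgue. x \<noteq> (0::real)" by (simp add: AE_lebesgue_iff_negligible)
      show ?thesis
        using sol_system_eq[of I z v] ne unfolding system_eq_def
      proof eventually_elim
        case (elim x)
        show ?case
        proof
          assume x: "x \<in> I"
          then have xi: "x \<in> interior I" using interior_half_line[OF I x] elim(2) by simp
          have "\<forall>\<^sub>F y in nhds x. y \<in> interior I" by (rule eventually_nhds_in_open[OF open_interior xi])
          then have "\<forall>\<^sub>F y in nhds x. y \<in> UNIV \<longrightarrow> f y = sol z v y"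
            by eventually_elim (use interior_subset f_def in auto)
          then have "vector_derivative f (at x) = vector_derivative (sol z v) (at x)"
            by (rule vector_derivative_cong_eq) auto
          then show "J x *v vector_derivative f (at x) + B x *v f x = H x *v (z *s f x)"
            using elim(1) x by (simp add: f_def)
        qed
      qed
    qed
    moreover have "f 0 = v" using int by (simp add: f_def)
    ultimately show ?thesis by (intro bexI[of _ f]) (auto simp: f_def)
  qed
  fix F c assume F: "finite F" "F \<subseteq> ?A"
  have comb: "(\<Sum>f\<in>F. c f *s f x) = 0" if s: "(\<Sum>f\<in>F. c f *s f 0) = 0" for x
  proof -
    show "(\<Sum>f\<in>F. c f *s f x) = 0"
    proof (cases "x \<in> I")
      case True
      have "(\<Sum>f\<in>F. c f *s f x) = (\<Sum>f\<in>F. c f *s sol z (f 0) x)"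
      proof (rule sum.cong[OF refl])
        fix f assume "f \<in> F"
        then have "f \<in> ?A" using F(2) by (rule subsetD[rotated])
        from eq[OF this True] show "c f *s f x = c f *s sol z (f 0) x" by simp
      qed
      also have "\<dots> = sol z (\<Sum>f\<in>F. c f *s f 0) x" by (rule sol_sum[symmetric])
      finally show ?thesis unfolding s by (simp add: sol_def mv.zero_right)
    next
      case False
      then have "f x = 0" if "f \<in> F" for f using F(2) that by auto
      then have "\<forall>f\<in>F. c f *s f x = 0" by (simp add: vec.scale_zero_right)
      then show ?thesis by (rule sum.neutral)
    qed
  qed
  show "(\<lambda>x. \<Sum>f\<in>F. c f *s f x) \<in> {\<lambda>x. 0} \<longleftrightarrow> (\<Sum>f\<in>F. c f *s f 0) = 0"
    unfolding singleton_iff fun_eq_iff using comb by blast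
qed

section \<open>Test functions and the inverse of the fundamental matrix\<close>

lemma innerH_restrict:
  assumes "K \<subseteq> L" "\<And>x. x \<in> L - K \<Longrightarrow> g x = 0"
  shows "innerH H L f g = innerH H K f g"
proof -
  have "(\<lambda>x. indicator L x *\<^sub>R hform f g x) = (\<lambda>x. indicator K x *\<^sub>R hform f g x)"
  proof
    fix x show "indicator L x *\<^sub>R hform f g x = indicator K x *\<^sub>R hform f g x"
      using assms by (cases "x \<in> K"; cases "x \<in> L") (auto simp: hform_def mv.zero_right cinner.zero_right)
  qed
  then show ?thesis by (simp add: innerH_eq set_lebesgue_integral_def)
qed

lemma hform_has_integral:
  assumes "f \<in> L2H H {a..b}" "g \<in> L2H H {a..b}"
  shows "(hform f g has_integral innerH H {a..b} f g) {a..b}"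
  unfolding innerH_eq using L2H_hform_integrable[OF _ assms] by (intro has_integral_set_lebesgue) auto

text \<open>The test function vanishes at both ends of an interval containing the supports, so the
  boundary terms in Lagrange's identity disappear.\<close>

lemma sol_adjoint:
  assumes I: "I \<in> {UNIV, {0..}, {..0}}" and f: "f \<in> AC I" and g: "g \<in> L2H H I"
    and supp: "compactly_supported_in_interior I f" "compactly_supported_in_interior I g"
    and eq: "system_eq J B H I f g"
  shows "innerH H I (sol z v) g = cnj z * innerH H I (sol z v) f"
proof -
  obtain K1 K2 where K: "compact K1" "K1 \<subseteq> interior I" "\<And>x. x \<in> I - K1 \<Longrightarrow> f x = 0"
    "compact K2" "K2 \<subseteq> interior I" "\<And>x. x \<in> I - K2 \<Longrightarrow> g x = 0"
    using supp unfolding compactly_supported_in_interior_def by metis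
  obtain a b where ab: "a < b" "{a..b} \<subseteq> I" "K1 \<union> K2 \<subseteq> {a<..<b}"
    using compact_in_interior_interval[OF I, of "K1 \<union> K2"] K by (metis compact_Un Un_least)
  have zero: "f x = 0" "g x = 0" if "x \<in> I - {a<..<b}" for x
  proof -
    have "x \<in> I" "x \<notin> K1" "x \<notin> K2" using that ab(3) by blast+
    then show "f x = 0" "g x = 0" using K(3,6) by blast+
  qed
  have f2: "f \<in> L2H H {a..b}"
    by (rule L2H_compact_support[where K="{a..b}"])
      (use AC_continuous_on[OF I f] ab(2) continuous_on_subset in auto)
  have g2: "g \<in> L2H H {a..b}" by (rule L2H_subset[OF g ab(2)]) simp
  have ac: "abs_continuous_on_interval a b f" using f ab by (auto simp: AC_def)
  have "((\<lambda>x. hform (sol z v) g x - cnj z * hform (sol z v) f x) has_integral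
      (cinner (sol z v b) (J b *v f b) - cinner (sol z v a) (J a *v f a))) {a..b}"
    unfolding hform_def by (rule sol_Lagrange[OF _ ac system_eqD[OF eq ab(2)]]) (use ab in simp)
  moreover have ends: "a \<in> {a..b}" "b \<in> {a..b}" using ab(1) by auto
  have "f a = 0" "f b = 0" using ends ab(2) by (intro zero(1); auto)+
  ultimately have "((\<lambda>x. hform (sol z v) g x - cnj z * hform (sol z v) f x) has_integral 0) {a..b}"
    by (simp add: mv.zero_right cinner.zero_right)
  moreover have "((\<lambda>x. hform (sol z v) g x - cnj z * hform (sol z v) f x) has_integral
     (innerH H {a..b} (sol z v) g - cnj z * innerH H {a..b} (sol z v) f)) {a..b}"
    by (intro has_integral_diff has_integral_mult_right hform_has_integral sol_L2H_Icc f2 g2)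
  ultimately have "innerH H {a..b} (sol z v) g - cnj z * innerH H {a..b} (sol z v) f = 0"
    by (rule has_integral_unique[symmetric])
  moreover have "innerH H I (sol z v) f = innerH H {a..b} (sol z v) f" "innerH H I (sol z v) g = innerH H {a..b} (sol z v) g"
    by (rule innerH_restrict; use ab(2) zero in auto)+
  ultimately show ?thesis by simp
qed

lemma L2H_extend_zero:
  assumes K: "K \<in> sets borel" and h: "h \<in> L2H H K" and L: "L \<in> sets borel"
  shows "(\<lambda>x. indicator K x *\<^sub>R h x) \<in> L2H H L"
  unfolding L2H_iff
proof
  have "(\<lambda>x. indicator K x *\<^sub>R h x) \<in> borel_measurable borel"
    using h K by (simp add: L2H_iff borel_measurable_restrict_space_iff)
  then show "(\<lambda>x. indicator K x *\<^sub>R h x) \<in> borel_measurable (restrict_space borel L)"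
    by (rule measurable_restrict_space1)
  have "hform (\<lambda>x. indicator K x *\<^sub>R h x) (\<lambda>x. indicator K x *\<^sub>R h x) = (\<lambda>x. indicator K x *\<^sub>R hform h h x)"
    by (auto simp: hform_def indicator_def cinner.zero_left)
  then show "set_integrable lebesgue L (hform (\<lambda>x. indicator K x *\<^sub>R h x) (\<lambda>x. indicator K x *\<^sub>R h x))"
    using h L integrable_mult_indicator[of L lebesgue "\<lambda>x. indicator K x *\<^sub>R hform h h x"]
    by (simp only: L2H_iff set_integrable_def sets_completionI_sets sets_lborel)
qed

lemma H_L2_loc:
  assumes h: "h \<in> L2H H UNIV"
  shows "(\<lambda>x. H x *v h x) \<in> L1_loc"
  unfolding L1_loc_def
proof (intro CollectI allI)
  fix a b :: real
  have hm: "h \<in> borel_measurable lebesgue"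
  proof -
    have "h \<in> borel_measurable lborel" using h by (simp add: L2H_iff borel_measurable_restrict_space_iff)
    then show ?thesis by (rule measurable_completion)
  qed
  have c1: "continuous_on UNIV (\<lambda>p. fst p *v snd p :: complex^'n)" for p :: "(complex^'n^'n) \<times> (complex^'n)"
    by (intro mv.continuous_on continuous_intros)
  have m: "(\<lambda>x. H x *v h x) \<in> borel_measurable lebesgue"
    by (rule borel_measurable_continuous_Pair[OF L1_loc_borel_measurable[OF H_loc] hm c1])
  define u where "u x = (\<Sum>i\<in>UNIV. norm (H x $ i $ i)) + real CARD('n) * Re (hform h h x)" for x
  have "set_integrable lebesgue {a..b} (hform h h)"
    by (rule set_integrable_subset[of _ UNIV]) (use h in \<open>auto simp: L2H_iff\<close>)
  then have "set_integrable lebesgue {a..b} (\<lambda>x. Re (hform h h x))"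
    using absolutely_integrable_linear[where h=Re] bounded_linear_Re by (fastforce simp: o_def)
  moreover have "set_integrable lebesgue {a..b} (\<lambda>x. norm (H x $ i $ i))" for i
  proof -
    have "H absolutely_integrable_on {a..b}" using H_loc by (simp add: L1_loc_def)
    moreover have "bounded_linear (\<lambda>A::complex^'n^'n. A $ i $ i)"
      by (intro bounded_linear_compose[OF bounded_linear_vec_nth] bounded_linear_vec_nth)
    ultimately have "(\<lambda>x. H x $ i $ i) absolutely_integrable_on {a..b}"
      using absolutely_integrable_linear[where f=H and h="\<lambda>A. A $ i $ i"] by (simp add: o_def)
    then show ?thesis by (rule set_integrable_norm)
  qed
  ultimately have u: "set_integrable lebesgue {a..b} u"
    unfolding u_def by (intro set_integral_add set_integrable_mult_right absolutely_integrable_sum) auto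
  show "(\<lambda>x. H x *v h x) absolutely_integrable_on {a..b}"
    unfolding set_integrable_def
  proof (rule Bochner_Integration.integrable_bound)
    show "integrable lebesgue (\<lambda>x. indicator {a..b} x *\<^sub>R u x)" using u by (simp add: set_integrable_def)
    show "(\<lambda>x. indicator {a..b} x *\<^sub>R (H x *v h x)) \<in> borel_measurable lebesgue"
      using m by (intro borel_measurable_scaleR borel_measurable_indicator) auto
    show "AE x in lebesgue. norm (indicator {a..b} x *\<^sub>R (H x *v h x)) \<le> norm (indicator {a..b} x *\<^sub>R u x)"
      using H_pos
    proof eventually_elim
      case (elim x)
      have "norm (H x *v h x) \<le> u x" unfolding u_def hform_def by (rule pos_semidef_norm_le[OF elim])
      then show ?case by (auto simp: indicator_def)
    qed
  qed
qed

text \<open>The conserved pairing in matrix form says that the adjoint of \<open>fund z x\<close>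
  times \<open>J x ** fund (cnj z) x\<close> is \<open>J 0\<close>. Solved for an inverse, it
  verifies the variation of constants formula.\<close>

lemma fund_inverse: "(J x ** fund (cnj z) x ** matrix_inv (J 0)) ** conj_transpose (fund z x) = mat 1"
proof -
  have "cinner u ((conj_transpose (fund z x) ** (J x ** fund (cnj z) x)) *v w) = cinner u (J 0 *v w)" for u w
    using sol_wronskian[of z u x w]
    by (simp add: sol_def matrix_vector_mul_assoc[symmetric] cinner_adjoint'[symmetric] del: matrix_vector_mul_assoc)
  then have "cinner u ((conj_transpose (fund z x) ** (J x ** fund (cnj z) x) - J 0) *v w) = 0" for u w
    by (simp add: mv.diff_left cinner.diff_right)
  then have "(conj_transpose (fund z x) ** (J x ** fund (cnj z) x) - J 0) *v w = 0" for w
    by (intro cinner_eq_zeroI) blast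
  then have "conj_transpose (fund z x) ** (J x ** fund (cnj z) x) - J 0 = 0"
    by (simp add: matrix_eq)
  then have "conj_transpose (fund z x) ** (J x ** fund (cnj z) x) = J 0" by simp
  then have "conj_transpose (fund z x) ** (J x ** fund (cnj z) x ** matrix_inv (J 0)) = mat 1"
    using det_J[of 0] by (simp add: matrix_mul_assoc matrix_inv_right invertible_det_nz[symmetric])
  then show ?thesis by (simp add: matrix_left_right_inverse[of "conj_transpose (fund z x)"])
qed

end

section \<open>Elements of the adjoint relation are solutions\<close>

context first_order_system
begin

text \<open>Variation of constants: the solution \<open>\<phi>\<close> of \<open>J \<phi>' + B \<phi> - cnj z H \<phi> = H h\<close> vanishing at \<open>a\<close>
  also vanishes at \<open>b\<close>, because \<open>h\<close> is orthogonal to all \<open>sol z w\<close>.\<close>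

lemma inhomogeneous_solution:
  assumes ab: "a \<le> b" and h: "h \<in> L2H H UNIV" and supp: "\<And>x. x \<notin> {a..b} \<Longrightarrow> h x = 0"
    and orth: "\<And>w. innerH H {a..b} (sol z w) h = 0"
  obtains \<phi> where "\<phi> \<in> AC UNIV" "\<And>x. x \<notin> {a..b} \<Longrightarrow> \<phi> x = 0"
    "system_eq J B H UNIV \<phi> (\<lambda>x. h x + cnj z *s \<phi> x)"
proof -
  \<comment> \<open>With \<open>s\<close> the primitive of \<open>p\<close> vanishing at
    \<open>a\<close>, the solution will be \<open>fund (cnj z) x\<close> applied to
    \<open>matrix_inv (J 0) *v s x\<close>. Pairing \<open>w\<close> with \<open>p\<close> gives the
    integrand of the product of \<open>sol z w\<close> with \<open>h\<close>, so orthogonality makes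
    \<open>s\<close> vanish at \<open>b\<close> too.\<close>
  define p where "p x = conj_transpose (fund z x) *v (H x *v h x)" for x
  have lin: "bounded_linear (conj_transpose :: complex^'n^'n \<Rightarrow> complex^'n^'n)"
  proof -
    have "linear (conj_transpose :: complex^'n^'n \<Rightarrow> complex^'n^'n)"
      by (rule linearI) (simp_all add: conj_transpose_def vec_eq_iff map_matrix_def transpose_def)
    then show ?thesis by (simp add: linear_conv_bounded_linear)
  qed
  have p: "p \<in> L1_loc"
  proof -
    have "continuous_on UNIV (\<lambda>x. conj_transpose (fund z x))"
      by (rule bounded_linear.continuous_on[OF lin AC_imp_continuous_on_UNIV[OF fund(2)]])
    from L1_loc_bilinear_continuous[OF bounded_bilinear.flip[OF bounded_bilinear_matrix_vector] H_L2_loc[OF h] this]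
    show ?thesis by (simp add: p_def[abs_def])
  qed
  have p0: "p x = 0" if "x \<notin> {a..b}" for x using supp[OF that] by (simp add: p_def mv.zero_right)
  define s where "s x = signed_integral p x - signed_integral p a" for x
  have sd: "s v - s u = integral {u..v} p" if "u \<le> v" for u v
    using signed_integral_diff[OF p that] by (simp add: s_def)
  have int0: "integral {u..v} p = 0" if "v \<le> a \<or> b \<le> u" for u v
  proof -
    have "negligible {a,b}" by simp
    moreover have "p x = 0" if "x \<in> {u..v} - {a,b}" for x
      using that \<open>v \<le> a \<or> b \<le> u\<close> by (intro p0) auto
    ultimately have "integral {u..v} p = integral {u..v} (\<lambda>x. 0)"
      by (intro integral_spike[of "{a,b}"]) auto
    then show ?thesis by simp
  qed
  have h_ab: "h \<in> L2H H {a..b}" by (rule L2H_subset[OF h]) auto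
  have "s b = 0"
  proof (rule cinner_eq_zeroI)
    fix w
    have "((\<lambda>x. cinner w (p x)) has_integral cinner w (integral {a..b} p)) {a..b}"
      using has_integral_linear[OF integrable_integral[OF L1_loc_integrable[OF p]] cinner.bounded_linear_right]
      by (simp add: o_def)
    moreover have "cinner w (p x) = hform (sol z w) h x" for x
      by (simp add: p_def hform_def sol_def cinner_adjoint')
    ultimately have "(hform (sol z w) h has_integral cinner w (integral {a..b} p)) {a..b}" by simp
    with hform_has_integral[OF sol_L2H_Icc h_ab] have "cinner w (integral {a..b} p) = innerH H {a..b} (sol z w) h"
      by (rule has_integral_unique[rotated])
    then show "cinner w (s b) = 0" using orth sd[OF ab] by (simp add: s_def)
  qed
  moreover have "s a = 0" by (simp add: s_def)
  ultimately have s0: "s x = 0" if "x \<notin> {a..b}" for x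
    using that sd[of x a] sd[of b x] int0[of a x] int0[of x b] by (cases "x \<le> a") auto
  define \<phi> where "\<phi> x = fund (cnj z) x *v (matrix_inv (J 0) *v s x)" for x
  have sAC: "s \<in> AC UNIV" by (rule AC_indefinite_integral[OF p sd])
  show thesis
  proof (rule that)
    show "\<phi> \<in> AC UNIV"
      unfolding AC_def
    proof (intro CollectI allI impI)
      fix u v :: real assume uv: "u \<le> v"
      show "abs_continuous_on_interval u v \<phi>"
        unfolding \<phi>_def
        by (intro abs_continuous_bilinear[OF bounded_bilinear_matrix_vector] abs_continuous_bounded_linear[OF mv.bounded_linear_right])
          (use uv fund(2) sAC in \<open>auto simp: AC_def\<close>)
    qed
    show "\<phi> x = 0" if "x \<notin> {a..b}" for x using s0[OF that] by (simp add: \<phi>_def mv.zero_right)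
    have sder: "AE x in lebesgue. (s has_vector_derivative p x) (at x)"
      by (rule indefinite_integral_derivative_AE[OF p sd])
    show "system_eq J B H UNIV \<phi> (\<lambda>x. h x + cnj z *s \<phi> x)"
      unfolding system_eq_def using sder fund(3)[of "cnj z"]
    proof eventually_elim
      case (elim x)
      let ?Y = "fund (cnj z) x" and ?K = "matrix_inv (J 0)"
      have "(\<phi> has_vector_derivative ?Y *v (?K *v p x) + (coeff (cnj z) x ** ?Y) *v (?K *v s x)) (at x)"
        unfolding \<phi>_def
        by (intro mv.has_vector_derivative bounded_linear.has_vector_derivative[OF mv.bounded_linear_right] elim)
      then have d: "vector_derivative \<phi> (at x) = ?Y *v (?K *v p x) + coeff (cnj z) x *v \<phi> x"
        by (simp add: vector_derivative_at \<phi>_def matrix_vector_mul_assoc matrix_mul_assoc)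
      have "J x *v (?Y *v (?K *v p x)) = ((J x ** ?Y ** ?K) ** conj_transpose (fund z x)) *v (H x *v h x)"
        unfolding p_def by (simp add: matrix_vector_mul_assoc matrix_mul_assoc)
      also have "\<dots> = H x *v h x" by (simp add: fund_inverse)
      finally have 1: "J x *v (?Y *v (?K *v p x)) = H x *v h x" .
      have "J x ** coeff (cnj z) x = mat (cnj z) ** H x - B x"
        using det_J[of x] by (simp add: coeff_def matrix_mul_assoc matrix_inv_right invertible_det_nz[symmetric])
      then have 2: "J x *v (coeff (cnj z) x *v \<phi> x) = cnj z *s (H x *v \<phi> x) - B x *v \<phi> x"
        by (simp add: matrix_vector_mul_assoc mv.diff_left mat_matrix_vector)
      show ?case unfolding d by (simp add: mv.add_right 1 2 matrix_vector_scale)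
    qed
  qed
qed

lemma innerH_sol_sum_left:
  assumes K: "K \<in> sets borel" and s: "\<And>v. sol z v \<in> L2H H K" and h: "h \<in> L2H H K" and "finite S"
  shows "innerH H K (sol z (\<Sum>i\<in>S. c i *s f i)) h = (\<Sum>i\<in>S. cnj (c i) * innerH H K (sol z (f i)) h)"
  using \<open>finite S\<close>
proof (induction S)
  case empty
  have "sol z 0 = (\<lambda>x. 0 *s sol z 0 x)" by (auto simp: sol_def mv.zero_right)
  then have "innerH H K (sol z 0) h = cnj 0 * innerH H K (sol z 0) h"
    using innerH_scale_left[OF K, of 0 "sol z 0" h] by metis
  then show ?case by simp
next
  case (insert i S)
  have "sol z (\<Sum>i\<in>insert i S. c i *s f i) = (\<lambda>x. c i *s sol z (f i) x + sol z (\<Sum>i\<in>S. c i *s f i) x)"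
    using insert(1,2) by (auto simp: sol_add sol_scale)
  then show ?case
    using insert innerH_add_left[OF K L2H_scale[OF s] s h] innerH_scale_left[OF K] by simp
qed

text \<open>The energy form on \<open>{a..b}\<close> is a Gram matrix; when it is nondegenerate, \<open>f\<close> can be projected
  orthogonally to the solutions.\<close>

lemma projection_exists:
  assumes c: "c > 0" "\<And>v. c * (norm v)\<^sup>2 \<le> energy z {a..b} v" and f: "f \<in> L2H H {a..b}"
  obtains v where "\<And>w. innerH H {a..b} (sol z w) (\<lambda>x. f x - sol z v x) = 0"
proof -
  let ?K = "{a..b}"
  have K: "?K \<in> sets borel" by simp
  \<comment> \<open>On solutions \<open>L\<close> is the Gram matrix of the basis solutions.
    Coercivity makes it injective, hence surjective in finite dimension, and
    \<open>L (sol z v) = L f\<close> determines the projection.\<close>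
  define L where "L g = (\<chi> i. innerH H ?K (sol z (axis i 1)) g)" for g
  have expand: "innerH H ?K (sol z w) g = (\<Sum>i\<in>UNIV. cnj (w $ i) * L g $ i)" if "g \<in> L2H H ?K" for w g
    using innerH_sol_sum_left[OF K sol_L2H_Icc that finite, where S=UNIV and c="\<lambda>i. w $ i" and f="\<lambda>i. axis i 1"]
    by (simp add: basis_expansion L_def)
  have "Vector_Spaces.linear (*s) (*s) (\<lambda>v. L (sol z v))"
    unfolding Vector_Spaces.linear_iff
  proof (intro conjI allI vec.vector_space_axioms)
    fix u v :: "complex^'n" and d :: complex
    have "sol z (u + v) = (\<lambda>x. sol z u x + sol z v x)" "sol z (d *s v) = (\<lambda>x. d *s sol z v x)"
      by (auto simp: sol_add sol_scale)
    then show "L (sol z (u + v)) = L (sol z u) + L (sol z v)" "L (sol z (d *s v)) = d *s L (sol z v)"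
      by (simp_all add: L_def vec_eq_iff innerH_add_right[OF K] sol_L2H_Icc innerH_scale_right[OF K])
  qed
  moreover have "inj (\<lambda>v. L (sol z v))"
  proof (rule injI)
    fix u v assume eq: "L (sol z u) = L (sol z v)"
    have "sol z (u - v) = (\<lambda>x. sol z u x - sol z v x)" by (auto simp: sol_diff)
    then have "L (sol z (u - v)) = L (sol z u) - L (sol z v)"
      by (simp add: L_def vec_eq_iff innerH_diff_right[OF K] sol_L2H_Icc)
    then have "innerH H ?K (sol z (u - v)) (sol z (u - v)) = 0"
      using expand[OF sol_L2H_Icc] eq by simp
    then have "c * (norm (u - v))\<^sup>2 \<le> 0" using c(2)[of "u - v"] by (simp add: energy_def)
    then show "u = v" using c(1) by (simp add: mult_le_0_iff)
  qed
  ultimately have "surj (\<lambda>v. L (sol z v))" by (rule vec.linear_injective_imp_surjective) simp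
  then obtain v where v: "L (sol z v) = L f" by (metis surjD)
  have fv: "(\<lambda>x. f x - sol z v x) \<in> L2H H ?K" by (rule L2H_diff[OF K f sol_L2H_Icc])
  have "L (\<lambda>x. f x - sol z v x) = 0"
    using v by (simp add: L_def vec_eq_iff innerH_diff_right[OF K] sol_L2H_Icc f)
  then show thesis by (intro that[of v]) (simp add: expand[OF fv])
qed

text \<open>Let \<open>g\<close> be \<open>f\<close> minus its projection. Cut off outside the
  interval, \<open>g\<close> is the inhomogeneity \<open>h\<close> of an admissible pair; in the
  adjoint identity the terms with \<open>cnj z\<close> cancel, so \<open>f\<close> is orthogonal to
  \<open>h\<close>. As solutions are orthogonal to \<open>g\<close> too, \<open>g\<close> has norm
  zero.\<close>

lemma adjoint_is_solution_on_Icc: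
  assumes I: "I \<in> {UNIV, {0..}, {..0}}" and ab: "a \<le> b" "{a..b} \<subseteq> interior I"
    and c: "c > 0" "\<And>v. c * (norm v)\<^sup>2 \<le> energy z {a..b} v"
    and f: "f \<in> L2H H I"
    and adj: "\<And>\<phi> \<psi>. \<phi> \<in> AC I \<Longrightarrow> \<phi> \<in> L2H H I \<Longrightarrow> \<psi> \<in> L2H H I \<Longrightarrow> compactly_supported_in_interior I \<phi> \<Longrightarrow>
       compactly_supported_in_interior I \<psi> \<Longrightarrow> system_eq J B H I \<phi> \<psi> \<Longrightarrow>
       innerH H I f \<psi> = cnj z * innerH H I f \<phi>"
  obtains v where "AE x\<in>{a..b} in lebesgue. H x *v f x = H x *v sol z v x"
proof -
  let ?K = "{a..b}"
  have K: "?K \<in> sets borel" by simp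
  have KI: "?K \<subseteq> I" using ab(2) interior_subset by blast
  have Ib: "I \<in> sets borel" using I by auto
  have fK: "f \<in> L2H H ?K" by (rule L2H_subset[OF f KI K])
  obtain v where v: "\<And>w. innerH H ?K (sol z w) (\<lambda>x. f x - sol z v x) = 0"
    using projection_exists[OF c fK] by blast
  define g where "g x = f x - sol z v x" for x
  define h where "h x = indicator ?K x *\<^sub>R g x" for x
  have gK: "g \<in> L2H H ?K" unfolding g_def by (rule L2H_diff[OF K fK sol_L2H_Icc])
  have hL: "h \<in> L2H H L" if "L \<in> sets borel" for L unfolding h_def by (rule L2H_extend_zero[OF K gK that])
  have hg: "h x = g x" if "x \<in> ?K" for x using that by (simp add: h_def)
  have h0: "h x = 0" if "x \<notin> ?K" for x using that by (simp add: h_def)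
  have cong: "innerH H ?K k h = innerH H ?K k g" for k
    unfolding innerH_eq by (rule set_lebesgue_integral_cong) (auto simp: hform_def hg)
  have vg: "innerH H ?K (sol z w) g = 0" for w using v unfolding g_def[abs_def] .
  have "innerH H ?K (sol z w) h = 0" for w unfolding cong by (rule vg)
  then obtain \<phi> where \<phi>: "\<phi> \<in> AC UNIV" "\<And>x. x \<notin> ?K \<Longrightarrow> \<phi> x = 0"
    "system_eq J B H UNIV \<phi> (\<lambda>x. h x + cnj z *s \<phi> x)"
    using inhomogeneous_solution[OF ab(1) hL h0] by (metis sets.top space_borel)
  have \<phi>L: "\<phi> \<in> L2H H I"
    by (rule L2H_compact_support[OF Ib, where K="?K"])
      (use \<phi>(2) KI continuous_on_subset[OF AC_imp_continuous_on_UNIV[OF \<phi>(1)]] in auto)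
  have "innerH H I f (\<lambda>x. h x + cnj z *s \<phi> x) = cnj z * innerH H I f \<phi>"
  proof (rule adj)
    show "\<phi> \<in> AC I" using \<phi>(1) by (auto simp: AC_def)
    show "(\<lambda>x. h x + cnj z *s \<phi> x) \<in> L2H H I" by (intro L2H_add[OF Ib] L2H_scale hL Ib \<phi>L)
    show "compactly_supported_in_interior I \<phi>"
      unfolding compactly_supported_in_interior_def by (rule exI[of _ ?K]) (use ab \<phi>(2) in auto)
    show "compactly_supported_in_interior I (\<lambda>x. h x + cnj z *s \<phi> x)"
      unfolding compactly_supported_in_interior_def by (rule exI[of _ ?K]) (use ab \<phi>(2) h0 in auto)
    show "system_eq J B H I \<phi> (\<lambda>x. h x + cnj z *s \<phi> x)"
      unfolding system_eq_def by (rule system_eqD[OF \<phi>(3)]) simp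
  qed (rule \<phi>L)
  then have "innerH H I f h = 0"
    using innerH_add_right[OF Ib hL[OF Ib] L2H_scale[OF \<phi>L] f, of "cnj z"] innerH_scale_right[OF Ib] by simp
  moreover have "innerH H I f h = innerH H ?K f h"
    by (rule innerH_restrict) (use KI h0 in auto)
  ultimately have fg: "innerH H ?K f g = 0" by (simp add: cong)
  have "innerH H ?K g g = innerH H ?K f g - innerH H ?K (sol z v) g"
    unfolding g_def by (rule innerH_diff_left[OF K fK sol_L2H_Icc gK[unfolded g_def]])
  also have "\<dots> = 0" using fg vg by simp
  finally have "AE x\<in>?K in lebesgue. H x *v g x = 0"
    using innerH_self_zero_iff[OF K gK] by simp
  then have "AE x\<in>?K in lebesgue. H x *v f x = H x *v sol z v x"
    by eventually_elim (auto simp: g_def mv.diff_right)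
  then show thesis by (rule that)
qed

text \<open>Energies grow with the interval, so coercivity persists beyond \<open>n0\<close>. There
  it permits the projection and makes the initial value of the local solution unique, so the
  solutions on different intervals are restrictions of one.\<close>

lemma adjoint_is_solution:
  assumes I: "I \<in> {UNIV, {0..}, {..0}}" and def: "definite_on J B H I"
    and f: "f \<in> L2H H I"
    and adj: "\<And>\<phi> \<psi>. \<phi> \<in> AC I \<Longrightarrow> \<phi> \<in> L2H H I \<Longrightarrow> \<psi> \<in> L2H H I \<Longrightarrow> compactly_supported_in_interior I \<phi> \<Longrightarrow>
       compactly_supported_in_interior I \<psi> \<Longrightarrow> system_eq J B H I \<phi> \<psi> \<Longrightarrow>
       innerH H I f \<psi> = cnj z * innerH H I f \<phi>"
  obtains v where "v \<in> sol_space z I" "AE x\<in>I in lebesgue. H x *v f x = H x *v sol z v x"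
proof -
  have I0: "0 \<in> I" and Ib: "I \<in> sets borel" using I by auto
  obtain a b :: "nat \<Rightarrow> real" where ab: "\<And>n m. n \<le> m \<Longrightarrow> {a n..b n} \<subseteq> {a m..b m}" "\<And>n. a n \<le> b n"
    "\<And>n. {a n..b n} \<subseteq> interior I" "\<And>x. x \<in> I \<Longrightarrow> x \<noteq> 0 \<Longrightarrow> \<exists>n. x \<in> {a n..b n}"
    using interior_exhaustion[OF I] by metis
  obtain n0 c where c: "c > 0" "\<And>v. c * (norm v)\<^sup>2 \<le> energy z {a n0..b n0} v"
    using energy_coercive[OF def I0 ab(1,4)] by metis
  have ex: "\<exists>v. AE x\<in>{a n..b n} in lebesgue. H x *v f x = H x *v sol z v x" if n: "n0 \<le> n" for n
  proof -
    have cn: "c * (norm v)\<^sup>2 \<le> energy z {a n..b n} v" for v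
      using c(2)[of v] energy_mono[OF ab(1)[OF n]] order_trans by blast
    obtain v where "AE x\<in>{a n..b n} in lebesgue. H x *v f x = H x *v sol z v x"
      using adjoint_is_solution_on_Icc[OF I ab(2,3) c(1) cn f adj] by blast
    then show ?thesis by blast
  qed
  define v where "v n = (SOME v. AE x\<in>{a n..b n} in lebesgue. H x *v f x = H x *v sol z v x)" for n
  have v: "AE x\<in>{a n..b n} in lebesgue. H x *v f x = H x *v sol z (v n) x" if "n0 \<le> n" for n
    unfolding v_def by (rule someI_ex[OF ex[OF that]])
  have veq: "v n = v n0" if n: "n0 \<le> n" for n
  proof -
    have "AE x\<in>{a n0..b n0} in lebesgue. H x *v sol z (v n - v n0) x = 0"
      using v[OF n] v[OF order_refl]
      by eventually_elim (use ab(1)[OF n] in \<open>auto simp: sol_diff mv.diff_right\<close>)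
    then have "energy z {a n0..b n0} (v n - v n0) = 0"
      using innerH_self_zero_iff[of "{a n0..b n0}" "sol z (v n - v n0)"] sol_L2H_Icc by (simp add: energy_def)
    then have "c * (norm (v n - v n0))\<^sup>2 \<le> 0" using c(2)[of "v n - v n0"] by simp
    then show ?thesis using c(1) by (simp add: mult_le_0_iff)
  qed
  have "AE x\<in>{a n..b n} in lebesgue. H x *v f x = H x *v sol z (v n0) x" for n
  proof -
    have "AE x\<in>{a (max n n0)..b (max n n0)} in lebesgue. H x *v f x = H x *v sol z (v n0) x"
      using v[of "max n n0"] veq[of "max n n0"] by simp
    moreover have "{a n..b n} \<subseteq> {a (max n n0)..b (max n n0)}" by (rule ab(1)) simp
    ultimately show ?thesis
      by (elim eventually_mono) blast
  qed
  then have AE: "AE x\<in>I in lebesgue. H x *v f x = H x *v sol z (v n0) x"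
    by (rule AE_all_intervals) (use ab(4) in auto)
  have "sol z (v n0) \<in> L2H H I"
    unfolding L2H_iff
  proof
    show "sol z (v n0) \<in> borel_measurable (restrict_space borel I)" by (rule sol_measurable)
    have "integrable lebesgue (\<lambda>x. indicator I x *\<^sub>R hform f f x) \<longleftrightarrow>
      integrable lebesgue (\<lambda>x. indicator I x *\<^sub>R hform (sol z (v n0)) (sol z (v n0)) x)"
    proof (rule integrable_cong_AE)
      show "AE x in lebesgue. indicator I x *\<^sub>R hform f f x = indicator I x *\<^sub>R hform (sol z (v n0)) (sol z (v n0)) x"
        using AE H_pos
      proof eventually_elim
        case (elim x)
        let ?s = "sol z (v n0) x"
        \<comment> \<open>Moving \<open>H\<close> across the inner product shows that the quadratic
          form depends on the function only through its image under \<open>H\<close>.\<close>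
        have sym: "cinner (H x *v u) w = cinner u (H x *v w)" for u w
          using elim(2) by (simp add: cinner_adjoint' pos_semidef_def)
        have "cinner (f x) (H x *v f x) = cinner ?s (H x *v ?s)" if "x \<in> I"
        proof -
          have eq: "H x *v f x = H x *v ?s" using elim(1) that by blast
          have "cinner (f x) (H x *v f x) = cinner (f x) (H x *v ?s)" by (simp only: eq)
          also have "\<dots> = cinner (H x *v f x) ?s" by (simp only: sym)
          also have "\<dots> = cinner (H x *v ?s) ?s" by (simp only: eq)
          also have "\<dots> = cinner ?s (H x *v ?s)" by (simp only: sym)
          finally show ?thesis .
        qed
        then show ?case by (cases "x \<in> I") (simp_all add: hform_def)
      qed
    qed (use f in \<open>auto intro!: hform_measurable[OF Ib] sol_measurable simp: L2H_iff simp del: indicator_scaleR_eq_if\<close>)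
    then show "set_integrable lebesgue I (hform (sol z (v n0)) (sol z (v n0)))"
      using f by (simp add: L2H_iff set_integrable_def)
  qed
  then show thesis using AE by (intro that) (simp_all add: sol_space_def)
qed

end

section \<open>Deficiency indices\<close>

context first_order_system
begin

definition preminimal :: "real set \<Rightarrow> 'n relation_L2" where
  "preminimal I = {(L2_class H I f, L2_class H I g) | f g. f \<in> AC I \<and> g \<in> L2H H I \<and>
        compactly_supported_in_interior I f \<and> compactly_supported_in_interior I g \<and>
        system_eq J B H I f g}"

lemma minimal_rel_eq: "minimal_rel J B H I = closure_rel H I (preminimal I)"
  by (simp add: minimal_rel_def preminimal_def)

context
  fixes I :: "real set"
  assumes I: "I \<in> {UNIV, {0..}, {..0}}"
begin

lemma borel_I: "I \<in> sets borel"
  using I by auto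

lemma AC_compact_support_L2H:
  assumes "f \<in> AC I" "compactly_supported_in_interior I f"
  shows "f \<in> L2H H I"
proof -
  obtain K where "compact K" "K \<subseteq> interior I" "\<And>x. x \<in> I - K \<Longrightarrow> f x = 0"
    using assms(2) unfolding compactly_supported_in_interior_def by blast
  then show ?thesis
    using interior_subset by (intro L2H_compact_support[OF borel_I AC_continuous_on[OF I assms(1)], of K]) blast+
qed

lemma preminimal_subset_minimal:
  assumes f: "f \<in> AC I" "compactly_supported_in_interior I f" and g: "g \<in> L2H H I" "compactly_supported_in_interior I g"
    and eq: "system_eq J B H I f g"
  shows "(L2_class H I f, L2_class H I g) \<in> minimal_rel J B H I"
proof -
  have f2: "f \<in> L2H H I" by (rule AC_compact_support_L2H[OF f])
  have "(L2_class H I f, L2_class H I g) \<in> preminimal I" unfolding preminimal_def using f g eq by blast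
  moreover have "normH H I (\<lambda>x. k x - k x) = 0" for k :: "real \<Rightarrow> complex^'n"
    using normH_zero_iff[OF borel_I L2H_zero] by (simp add: mv.zero_right)
  ultimately show ?thesis
    unfolding minimal_rel_eq closure_rel_def using f2 g(1) by force
qed

text \<open>The identity holds on the generating pairs by \<open>sol_adjoint\<close>, and both of
  its sides are continuous for \<open>normH\<close> by Cauchy-Schwarz, so it passes to the
  closure.\<close>

lemma sol_orthogonal_minimal:
  assumes v: "v \<in> sol_space z I" and p: "\<phi> \<in> L2H H I" "\<psi> \<in> L2H H I"
    and pm: "(L2_class H I \<phi>, L2_class H I \<psi>) \<in> minimal_rel J B H I"
  shows "innerH H I (sol z v) \<psi> = cnj z * innerH H I (sol z v) \<phi>"
proof -
  let ?s = "sol z v"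
  have s: "?s \<in> L2H H I" using v by (simp add: sol_space_def)
  obtain f g where fg: "L2_class H I \<phi> = L2_class H I f" "L2_class H I \<psi> = L2_class H I g" "f \<in> L2H H I" "g \<in> L2H H I"
    "\<And>\<epsilon>. \<epsilon> > 0 \<Longrightarrow> \<exists>\<phi>\<in>L2H H I. \<exists>\<psi>\<in>L2H H I. (L2_class H I \<phi>, L2_class H I \<psi>) \<in> preminimal I \<and>
           normH H I (\<lambda>x. f x - \<phi> x) < \<epsilon> \<and> normH H I (\<lambda>x. g x - \<psi> x) < \<epsilon>"
    using pm unfolding minimal_rel_eq closure_rel_def by blast
  let ?d = "innerH H I ?s g - cnj z * innerH H I ?s f"
  define C where "C = normH H I ?s * (1 + cmod z)"
  have C: "0 \<le> C" using normH_nonneg[OF borel_I s] by (simp add: C_def)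
  have "cmod ?d \<le> C * \<epsilon>" if "\<epsilon> > 0" for \<epsilon>
  proof -
    obtain f1 g1 where 1: "f1 \<in> L2H H I" "g1 \<in> L2H H I" "(L2_class H I f1, L2_class H I g1) \<in> preminimal I"
      "normH H I (\<lambda>x. f x - f1 x) < \<epsilon>" "normH H I (\<lambda>x. g x - g1 x) < \<epsilon>"
      using fg(5)[OF \<open>\<epsilon> > 0\<close>] by blast
    obtain f0 g0 where 0: "L2_class H I f1 = L2_class H I f0" "L2_class H I g1 = L2_class H I g0"
      "f0 \<in> AC I" "g0 \<in> L2H H I" "compactly_supported_in_interior I f0" "compactly_supported_in_interior I g0"
      "system_eq J B H I f0 g0"
      using 1(3) unfolding preminimal_def by blast
    have f0: "f0 \<in> L2H H I" by (rule AC_compact_support_L2H[OF 0(3,5)])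
    have "innerH H I ?s g1 = cnj z * innerH H I ?s f1"
      using sol_adjoint[OF I 0(3,4,5,6,7)] innerH_cong_class[OF borel_I s s 1(1) f0 refl 0(1)]
        innerH_cong_class[OF borel_I s s 1(2) 0(4) refl 0(2)] by simp
    then have d: "?d = innerH H I ?s (\<lambda>x. g x - g1 x) - cnj z * innerH H I ?s (\<lambda>x. f x - f1 x)"
      unfolding innerH_diff_right[OF borel_I fg(4) 1(2) s] innerH_diff_right[OF borel_I fg(3) 1(1) s]
      by (simp add: right_diff_distrib)
    have "cmod ?d \<le> cmod (innerH H I ?s (\<lambda>x. g x - g1 x)) + cmod z * cmod (innerH H I ?s (\<lambda>x. f x - f1 x))"
      unfolding d by (rule order_trans[OF norm_triangle_ineq4]) (simp add: norm_mult)
    also have "\<dots> \<le> normH H I ?s * \<epsilon> + cmod z * (normH H I ?s * \<epsilon>)"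
    proof (intro add_mono mult_left_mono)
      show "cmod (innerH H I ?s (\<lambda>x. g x - g1 x)) \<le> normH H I ?s * \<epsilon>"
        using innerH_Cauchy_Schwarz[OF borel_I s L2H_diff[OF borel_I fg(4) 1(2)]] 1(5) normH_nonneg[OF borel_I s]
        by (meson less_imp_le mult_left_mono order_trans)
      show "cmod (innerH H I ?s (\<lambda>x. f x - f1 x)) \<le> normH H I ?s * \<epsilon>"
        using innerH_Cauchy_Schwarz[OF borel_I s L2H_diff[OF borel_I fg(3) 1(1)]] 1(4) normH_nonneg[OF borel_I s]
        by (meson less_imp_le mult_left_mono order_trans)
    qed simp
    also have "\<dots> = C * \<epsilon>" by (simp add: C_def algebra_simps)
    finally show ?thesis .
  qed
  note small = this
  have "cmod ?d \<le> 0"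
  proof (rule field_le_epsilon)
    fix e :: real assume "0 < e"
    have "cmod ?d \<le> C * (e / (C + 1))" by (rule small) (use \<open>0 < e\<close> C in simp)
    also have "\<dots> \<le> 0 + e" using \<open>0 < e\<close> C by (simp add: field_simps)
    finally show "cmod ?d \<le> 0 + e" .
  qed
  then have "innerH H I ?s g = cnj z * innerH H I ?s f" by simp
  then show ?thesis
    using innerH_cong_class[OF borel_I s s p(1) fg(3) refl fg(1)] innerH_cong_class[OF borel_I s s p(2) fg(4) refl fg(2)]
    by simp
qed

definition defect :: "complex \<Rightarrow> (real \<Rightarrow> complex^'n) set" where
  "defect z = \<Union>{L2_class H I f | f. f \<in> L2H H I \<and>
     (L2_class H I f, L2_class H I (\<lambda>x. z *s f x)) \<in> adjoint_rel H I (minimal_rel J B H I)}"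

text \<open>In one direction the adjoint identity is tested on the generating pairs only; in the
  other it must hold on the whole closure. A class determines its members only through
  \<open>H\<close>, hence the form of the condition.\<close>

lemma defect_iff:
  assumes def: "definite_on J B H I"
  shows "g \<in> defect z \<longleftrightarrow> g \<in> L2H H I \<and> (\<exists>v\<in>sol_space z I. AE x\<in>I in lebesgue. H x *v g x = H x *v sol z v x)"
proof
  assume "g \<in> defect z"
  then obtain f where f: "f \<in> L2H H I" "g \<in> L2_class H I f"
    "(L2_class H I f, L2_class H I (\<lambda>x. z *s f x)) \<in> adjoint_rel H I (minimal_rel J B H I)"
    unfolding defect_def by blast
  then have g: "g \<in> L2H H I" by (simp add: L2_class_def)
  obtain f1 g1 where 1: "L2_class H I f = L2_class H I f1" "L2_class H I (\<lambda>x. z *s f x) = L2_class H I g1"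
    "f1 \<in> L2H H I" "g1 \<in> L2H H I"
    "\<And>\<phi> \<psi>. \<phi> \<in> L2H H I \<Longrightarrow> \<psi> \<in> L2H H I \<Longrightarrow> (L2_class H I \<phi>, L2_class H I \<psi>) \<in> minimal_rel J B H I \<Longrightarrow>
       innerH H I f1 \<psi> = innerH H I g1 \<phi>"
    using f(3) unfolding adjoint_rel_def by blast
  obtain v where v: "v \<in> sol_space z I" "AE x\<in>I in lebesgue. H x *v f1 x = H x *v sol z v x"
  proof (rule adjoint_is_solution[OF I def 1(3)])
    fix \<phi> \<psi> assume p: "\<phi> \<in> AC I" "\<phi> \<in> L2H H I" "\<psi> \<in> L2H H I" "compactly_supported_in_interior I \<phi>"
       "compactly_supported_in_interior I \<psi>" "system_eq J B H I \<phi> \<psi>"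
    have "innerH H I f1 \<psi> = innerH H I g1 \<phi>"
      by (rule 1(5)[OF p(2,3) preminimal_subset_minimal[OF p(1,4,3,5,6)]])
    also have "\<dots> = innerH H I (\<lambda>x. z *s f x) \<phi>"
      by (rule innerH_cong_class[OF borel_I 1(4) L2H_scale[OF f(1)] p(2,2) 1(2)[symmetric] refl])
    also have "\<dots> = cnj z * innerH H I f1 \<phi>"
      using innerH_cong_class[OF borel_I f(1) 1(3) p(2,2) 1(1) refl] by (simp add: innerH_scale_left[OF borel_I])
    finally show "innerH H I f1 \<psi> = cnj z * innerH H I f1 \<phi>" .
  qed
  have "AE x\<in>I in lebesgue. H x *v g x = H x *v f1 x"
    using f(2) L2_class_iff[OF borel_I 1(3) g] by (simp add: 1(1))
  then have "AE x\<in>I in lebesgue. H x *v g x = H x *v sol z v x"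
    using v(2) by eventually_elim auto
  then show "g \<in> L2H H I \<and> (\<exists>v\<in>sol_space z I. AE x\<in>I in lebesgue. H x *v g x = H x *v sol z v x)"
    using g v(1) by blast
next
  assume "g \<in> L2H H I \<and> (\<exists>v\<in>sol_space z I. AE x\<in>I in lebesgue. H x *v g x = H x *v sol z v x)"
  then obtain v where g: "g \<in> L2H H I" and v: "v \<in> sol_space z I" "AE x\<in>I in lebesgue. H x *v g x = H x *v sol z v x"
    by blast
  have s: "sol z v \<in> L2H H I" using v by (simp add: sol_space_def)
  have "g \<in> L2_class H I (sol z v)" using L2_class_iff[OF borel_I s g] v(2) by simp
  moreover have "(L2_class H I (sol z v), L2_class H I (\<lambda>x. z *s sol z v x)) \<in> adjoint_rel H I (minimal_rel J B H I)"
    unfolding adjoint_rel_def using s L2H_scale[OF s] sol_orthogonal_minimal[OF v(1)] innerH_scale_left[OF borel_I]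
    by (intro CollectI exI[of _ "sol z v"] exI[of _ "\<lambda>x. z *s sol z v x"]) simp
  ultimately show "g \<in> defect z" unfolding defect_def using s by blast
qed

lemma deficiency_index_eq:
  assumes def: "definite_on J B H I"
  shows "deficiency_index H I z (minimal_rel J B H I) = enat (vec.dim (sol_space z I))"
  unfolding deficiency_index_def defect_def[symmetric]
proof -
  have I0: "0 \<in> I" using I by auto
  \<comment> \<open>The initial value of the solution representing the class of \<open>g\<close>.
    Definiteness makes it unique, so the choice is harmless and linear combinations are respected
    modulo the zero class.\<close>
  define r where "r g = (SOME v. v \<in> sol_space z I \<and> (AE x\<in>I in lebesgue. H x *v g x = H x *v sol z v x))" for g
  have r: "r g \<in> sol_space z I" "AE x\<in>I in lebesgue. H x *v g x = H x *v sol z (r g) x" if "g \<in> defect z" for g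
  proof -
    have "\<exists>v. v \<in> sol_space z I \<and> (AE x\<in>I in lebesgue. H x *v g x = H x *v sol z v x)"
      using that defect_iff[OF def] by blast
    from someI_ex[OF this] show "r g \<in> sol_space z I" "AE x\<in>I in lebesgue. H x *v g x = H x *v sol z (r g) x"
      unfolding r_def by blast+
  qed
  show "quotient_dim (defect z) (L2_class H I (\<lambda>x. 0)) = enat (vec.dim (sol_space z I))"
  proof (rule quotient_dim_eq_dim[where r=r])
    show "r g \<in> sol_space z I" if "g \<in> defect z" for g by (rule r(1)[OF that])
    show "\<exists>g\<in>defect z. r g = v" if v: "v \<in> sol_space z I" for v
    proof
      show d: "sol z v \<in> defect z" unfolding defect_iff[OF def] using v by (auto simp: sol_space_def)
      have "AE x\<in>I in lebesgue. H x *v sol z (r (sol z v) - v) x = 0"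
        using r(2)[OF d] by eventually_elim (auto simp: sol_diff mv.diff_right)
      from definite_sol_zero[OF def I0 this] show "r (sol z v) = v" by simp
    qed
    fix F c assume F: "finite F" "F \<subseteq> defect z"
    let ?k = "\<lambda>x. \<Sum>f\<in>F. c f *s f x" and ?w = "\<Sum>f\<in>F. c f *s r f"
    have F2: "f \<in> L2H H I" if "f \<in> F" for f using F(2) that defect_iff[OF def] by blast
    have k: "?k \<in> L2H H I" by (rule L2H_sum[OF borel_I]) (use F2 L2H_scale in blast)
    have "AE x in lebesgue. \<forall>f\<in>F. x \<in> I \<longrightarrow> H x *v f x = H x *v sol z (r f) x"
      using r(2) F by (intro AE_finite_allI) auto
    then have eq: "AE x\<in>I in lebesgue. H x *v ?k x = H x *v sol z ?w x"
      by eventually_elim (simp add: sol_sum matrix_vector_sum)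
    have "?k \<in> L2_class H I (\<lambda>x. 0) \<longleftrightarrow> (AE x\<in>I in lebesgue. H x *v ?k x = 0)"
      using L2_class_iff[OF borel_I L2H_zero k] by (simp add: mv.zero_right)
    also have "\<dots> \<longleftrightarrow> (AE x\<in>I in lebesgue. H x *v sol z ?w x = 0)"
    proof
      assume "AE x\<in>I in lebesgue. H x *v ?k x = 0"
      then show "AE x\<in>I in lebesgue. H x *v sol z ?w x = 0" using eq by eventually_elim auto
    next
      assume "AE x\<in>I in lebesgue. H x *v sol z ?w x = 0"
      then show "AE x\<in>I in lebesgue. H x *v ?k x = 0" using eq by eventually_elim auto
    qed
    also have "\<dots> \<longleftrightarrow> ?w = 0"
    proof
      assume "AE x\<in>I in lebesgue. H x *v sol z ?w x = 0"
      then show "?w = 0" by (rule definite_sol_zero[OF def I0])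
    next
      assume "?w = 0"
      then have "sol z ?w x = 0" for x by (simp add: sol_def mv.zero_right)
      then show "AE x\<in>I in lebesgue. H x *v sol z ?w x = 0" by (simp add: mv.zero_right)
    qed
    finally show "?k \<in> L2_class H I (\<lambda>x. 0) \<longleftrightarrow> ?w = 0" .
  qed
qed

end

lemma definite_on_UNIV:
  assumes "definite_on J B H {0..}" "definite_on J B H {..0}"
  shows "definite_on J B H UNIV"
  unfolding definite_on_def
proof (intro ballI impI)
  fix f x assume f: "f \<in> AC UNIV" and eq: "system_eq J B H UNIV f (\<lambda>x. 0)" and Hf: "AE x\<in>UNIV in lebesgue. H x *v f x = 0"
  have "\<forall>x\<in>S. f x = 0" if S: "definite_on J B H S" for S
  proof -
    have "f \<in> AC S" using f by (auto simp: AC_def)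
    moreover have "system_eq J B H S f (\<lambda>x. 0)"
      unfolding system_eq_def by (rule system_eqD[OF eq]) simp
    moreover have "AE x\<in>S in lebesgue. H x *v f x = 0" using Hf by eventually_elim simp
    ultimately show ?thesis using S unfolding definite_on_def by blast
  qed
  from this[OF assms(1)] this[OF assms(2)] show "f x = 0" by (cases "0 \<le> x") auto
qed

end

text \<open>All indices are finite, being dimensions of subspaces of initial values, so in
  \<open>enat\<close> the formula can be stated with \<open>n\<close> added on the left instead of
  subtracted on the right.\<close>

theorem proposition5p4:
  fixes J B H :: "real \<Rightarrow> complex^'n^'n"
  assumes "symmetric_system J B H"
    and "definite_on J B H {0..}" and "definite_on J B H {..0}"
  shows "\<forall>z\<in>{\<i>, - \<i>}.
      deficiency_index H UNIV z (minimal_rel J B H UNIV) + enat CARD('n) =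
        deficiency_index H {0..} z (minimal_rel J B H {0..}) +
        deficiency_index H {..0} z (minimal_rel J B H {..0}) \<and>
      formal_deficiency_index J B H UNIV z + enat CARD('n) =
        formal_deficiency_index J B H {0..} z + formal_deficiency_index J B H {..0} z"
proof
  interpret first_order_system J B H by unfold_locales (rule assms(1))
  fix z :: complex assume "z \<in> {\<i>, - \<i>}"
  then have z: "Im z \<noteq> 0" by auto
  note dim = dim_sol_space[OF z assms(2,3)]
  show "deficiency_index H UNIV z (minimal_rel J B H UNIV) + enat CARD('n) =
        deficiency_index H {0..} z (minimal_rel J B H {0..}) +
        deficiency_index H {..0} z (minimal_rel J B H {..0}) \<and>
      formal_deficiency_index J B H UNIV z + enat CARD('n) =
        formal_deficiency_index J B H {0..} z + formal_deficiency_index J B H {..0} z"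
    using dim deficiency_index_eq[OF _ definite_on_UNIV[OF assms(2,3)], of z]
      deficiency_index_eq[OF _ assms(2), of z] deficiency_index_eq[OF _ assms(3), of z]
    by (simp add: formal_deficiency_index_eq)
qed

end
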